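(* Let $n\ge1$ and $L>0$. If $T<L$, the cost of null-control $C(\varepsilon)$ of system $(S_v)$ tends to infinity exponentially as $\varepsilon\to0$: for every $T\in(0,L)$ there exist $\varepsilon_0>0$ and constants $C,k>0$ such that $$C(\varepsilon)\ge C e^{k/\varepsilon}\qquad\text{for all }\varepsilon\in(0,\varepsilon_0).$$
   Context: Let $n\ge1$, $L>0$, $T>0$, $\varepsilon>0$, $\Omega:=\mathbb{R}^{n-1}\times(-L,0)$ with points $x=(x',x_n)$, $\Gamma_0:=\mathbb{R}^{n-1}\times\{0\}$, $\Gamma_1:=\mathbb{R}^{n-1}\times\{-L\}$, $\partial\Omega=\Gamma_0\cup\Gamma_1$. $\partial_\nu$ denotes the outward normal derivative on $\partial\Omega$. The space $X$ is the closure of $\mathcal C^\infty(\overline\Omega)$ (functions with finite norm) for the norm $\|u\|_X:=\left(\|u\|_{L^2(\Omega)}^2+\varepsilon\|u\|_{L^2(\partial\Omega)}^2\right)^{1/2}$, a Hilbert space with the corresponding inner product. It is identified with $L^2(\Omega)\times L^2(\partial\Omega)$: an element of $X$ consists of an interior part and a boundary part (playing the role of the trace), both denoted by the same letter. For $u_0\in X$ and a control $v\in L^2((0,T)\times\Gamma_0)$ (also written $L^2((0,T),\Gamma_0)$), consider $$(S_v)\quad\begin{cases}u_t+\partial_{x_n}u-\varepsilon\Delta u=0&\text{in }(0,T)\times\Omega,\\ \varepsilon(u_t+\partial_\nu u)=v&\text{on }(0,T)\times\Gamma_0,\\ \varepsilon(u_t+\partial_\nu u)+u=0&\text{on }(0,T)\times\Gamma_1,\\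 u(0,\cdot)=u_0&\text{in }\Omega.\end{cases}$$ This system is well posed in $X$: its solution is the unique $u\in\mathcal C([0,T],X)$ with $u(0)=u_0$ such that for all $\tau\in[0,T]$ and all $\psi\in\mathcal C^\infty_c([0,T]\times\overline\Omega)$, $$\langle u(\tau),\psi(\tau)\rangle_X-\langle u_0,\psi(0)\rangle_X=\int_0^\tau\Big(\langle u,\psi_t\rangle_X+\int_\Omega u(\varepsilon\Delta\psi+\partial_{x_n}\psi)-\varepsilon\int_{\partial\Omega}u\,\partial_\nu\psi-\int_{\Gamma_0}u\psi+\int_{\Gamma_0}v\psi\Big)dt.$$ The cost of null-control $C(\varepsilon)\in[0,+\infty]$ (depending also on $T,L,n$) is the smallest constant $C$ such that for every $u_0\in X$ there exists $v\in L^2((0,T)\times\Gamma_0)$ for which the solution of $(S_v)$ satisfies $u(T)=0$ in $X$ and $\|v\|_{L^2((0,T)\times\Gamma_0)}\le C\|u_0\|_X$; $C(\varepsilon)=+\infty$ if there is no such constant (in particular when null controllability fails). *)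

theory Defs
  imports "HOL-Analysis.Analysis"
begin

text \<open>
  The ambient space of dimension \<open>n \<ge> 1\<close> is \<open>real ^ 'n\<close> with \<open>n = CARD('n)\<close>. A distinguished index
  \<open>d :: 'n\<close> singles out the coordinate written \<open>x\<^sub>n\<close>; the remaining coordinates form \<open>x'\<close>. In this
  way the case \<open>n = 1\<close>, where \<open>x'\<close> ranges over a point, is included.
\<close>

definition strip :: "'n::finite \<Rightarrow> real \<Rightarrow> (real ^ 'n) set" where
  "strip d L = {x. - L < x $ d \<and> x $ d < 0}"

definition strip_measure :: "'n::finite \<Rightarrow> real \<Rightarrow> (real ^ 'n) measure" where
  "strip_measure d L = restrict_space lborel (strip d L)"

text \<open>
  Surface measure on the hyperplane \<open>{x. x $ d = c}\<close>: the image of \<open>(n-1)\<close>-dimensional Lebesgue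
  measure under \<open>x' \<mapsto> (x', c)\<close>. It is a measure on the Borel sets of the whole space, carried by the
  hyperplane; for \<open>n = 1\<close> it is the unit mass at the point \<open>c\<close>.
\<close>

definition hyperplane_measure :: "'n::finite \<Rightarrow> real \<Rightarrow> (real ^ 'n) measure" where
  "hyperplane_measure d c =
     distr (PiM (UNIV - {d}) (\<lambda>_. lborel)) borel (\<lambda>y. \<chi> i. if i = d then c else y i)"

abbreviation Gamma0 :: "'n::finite \<Rightarrow> (real ^ 'n) measure" where
  "Gamma0 d \<equiv> hyperplane_measure d 0"

abbreviation Gamma1 :: "'n::finite \<Rightarrow> real \<Rightarrow> (real ^ 'n) measure" where
  "Gamma1 d L \<equiv> hyperplane_measure d (- L)"

definition bdry_integral :: "'n::finite \<Rightarrow> real \<Rightarrow> (real ^ 'n \<Rightarrow> real) \<Rightarrow> real" where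
  "bdry_integral d L f = integral\<^sup>L (Gamma0 d) f + integral\<^sup>L (Gamma1 d L) f"

definition in_L2 :: "'a measure \<Rightarrow> ('a \<Rightarrow> real) \<Rightarrow> bool" where
  "in_L2 M f \<longleftrightarrow> f \<in> borel_measurable M \<and> integrable M (\<lambda>x. (f x)\<^sup>2)"

definition L2_norm :: "'a measure \<Rightarrow> ('a \<Rightarrow> real) \<Rightarrow> real" where
  "L2_norm M f = sqrt (\<integral>x. (f x)\<^sup>2 \<partial>M)"

text \<open>
  An element of \<open>X = L\<^sup>2(\<Omega>) \<times> L\<^sup>2(\<partial>\<Omega>)\<close> is represented by one function on the closed strip: its values
  on the open strip are the interior part, and its values on the two bounding hyperplanes are the
  boundary part. The two parts are unrelated, since no regularity is imposed. Two functions represent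
  the same element iff they agree almost everywhere for each of the three measures.
\<close>

definition in_X :: "'n::finite \<Rightarrow> real \<Rightarrow> (real ^ 'n \<Rightarrow> real) \<Rightarrow> bool" where
  "in_X d L u \<longleftrightarrow> in_L2 (strip_measure d L) u \<and> in_L2 (Gamma0 d) u \<and> in_L2 (Gamma1 d L) u"

definition eq_X :: "'n::finite \<Rightarrow> real \<Rightarrow> (real ^ 'n \<Rightarrow> real) \<Rightarrow> (real ^ 'n \<Rightarrow> real) \<Rightarrow> bool" where
  "eq_X d L u w \<longleftrightarrow>
     (AE x in strip_measure d L. u x = w x) \<and>
     (AE x in Gamma0 d. u x = w x) \<and> (AE x in Gamma1 d L. u x = w x)"

definition inner_X ::
    "'n::finite \<Rightarrow> real \<Rightarrow> real \<Rightarrow> (real ^ 'n \<Rightarrow> real) \<Rightarrow> (real ^ 'n \<Rightarrow> real) \<Rightarrow> real" where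
  "inner_X d L \<epsilon> u w =
     (\<integral>x. u x * w x \<partial>strip_measure d L) + \<epsilon> * bdry_integral d L (\<lambda>x. u x * w x)"

definition norm_X :: "'n::finite \<Rightarrow> real \<Rightarrow> real \<Rightarrow> (real ^ 'n \<Rightarrow> real) \<Rightarrow> real" where
  "norm_X d L \<epsilon> u = sqrt (inner_X d L \<epsilon> u u)"

definition continuous_into_X ::
    "'n::finite \<Rightarrow> real \<Rightarrow> real \<Rightarrow> real \<Rightarrow> (real \<Rightarrow> real ^ 'n \<Rightarrow> real) \<Rightarrow> bool" where
  "continuous_into_X d L T \<epsilon> u \<longleftrightarrow>
     (\<forall>t\<in>{0..T}. in_X d L (u t) \<and>
        ((\<lambda>s. norm_X d L \<epsilon> (\<lambda>x. u s x - u t x)) \<longlongrightarrow> 0) (at t within {0..T}))"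

primrec C_diff :: "nat \<Rightarrow> ('a::euclidean_space \<Rightarrow> real) \<Rightarrow> bool" where
  "C_diff 0 f \<longleftrightarrow> continuous_on UNIV f"
| "C_diff (Suc m) f \<longleftrightarrow>
     (\<forall>x. f differentiable at x) \<and> (\<forall>h. C_diff m (\<lambda>x. frechet_derivative f (at x) h))"

text \<open>
  The elements of \<open>C\<^sub>c\<^sup>\<infinity>([0,T] \<times> closure \<Omega>)\<close> are the restrictions of smooth compactly supported
  functions on the whole of space-time. They need not vanish on the boundary or at the end times, and
  only the values on \<open>[0,T] \<times> closure \<Omega>\<close> enter the formulas below.
\<close>

definition test_function :: "(real \<times> (real ^ 'n::finite) \<Rightarrow> real) \<Rightarrow> bool" where
  "test_function \<psi> \<longleftrightarrow> (\<forall>m. C_diff m \<psi>) \<and> (\<exists>K. compact K \<and> (\<forall>p. p \<notin> K \<longrightarrow> \<psi> p = 0))"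

definition partial :: "'n::finite \<Rightarrow> (real ^ 'n \<Rightarrow> real) \<Rightarrow> real ^ 'n \<Rightarrow> real" where
  "partial i f x = frechet_derivative f (at x) (axis i 1)"

definition laplacian :: "(real ^ 'n::finite \<Rightarrow> real) \<Rightarrow> real ^ 'n \<Rightarrow> real" where
  "laplacian f x = (\<Sum>i\<in>UNIV. partial i (partial i f) x)"

text \<open>Meaningful on the boundary only: the outward normal is \<open>+e\<^sub>n\<close> at \<open>x\<^sub>n = 0\<close> and \<open>-e\<^sub>n\<close> at
  \<open>x\<^sub>n = -L\<close>.\<close>

definition outward_normal :: "'n::finite \<Rightarrow> real ^ 'n \<Rightarrow> real ^ 'n" where
  "outward_normal d x = (if x $ d = 0 then axis d 1 else - axis d 1)"

definition normal_deriv :: "'n::finite \<Rightarrow> (real ^ 'n \<Rightarrow> real) \<Rightarrow> real ^ 'n \<Rightarrow> real" where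
  "normal_deriv d f x = frechet_derivative f (at x) (outward_normal d x)"

definition control_measure :: "'n::finite \<Rightarrow> real \<Rightarrow> (real \<times> (real ^ 'n)) measure" where
  "control_measure d T = restrict_space lborel {0<..<T} \<Otimes>\<^sub>M Gamma0 d"

text \<open>The integrand in time of the weak formulation, for the slice \<open>u\<close> of the solution at time \<open>t\<close>.\<close>

definition weak_integrand ::
    "'n::finite \<Rightarrow> real \<Rightarrow> real \<Rightarrow> (real \<times> (real ^ 'n) \<Rightarrow> real) \<Rightarrow> (real \<times> (real ^ 'n) \<Rightarrow> real)
      \<Rightarrow> (real ^ 'n \<Rightarrow> real) \<Rightarrow> real \<Rightarrow> real" where
  "weak_integrand d L \<epsilon> v \<psi> u t =
     inner_X d L \<epsilon> u (\<lambda>x. deriv (\<lambda>s. \<psi> (s, x)) t)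
     + (\<integral>x. u x * (\<epsilon> * laplacian (\<lambda>y. \<psi> (t, y)) x + partial d (\<lambda>y. \<psi> (t, y)) x) \<partial>strip_measure d L)
     - \<epsilon> * bdry_integral d L (\<lambda>x. u x * normal_deriv d (\<lambda>y. \<psi> (t, y)) x)
     - (\<integral>x. u x * \<psi> (t, x) \<partial>Gamma0 d)
     + (\<integral>x. v (t, x) * \<psi> (t, x) \<partial>Gamma0 d)"

definition is_solution ::
    "'n::finite \<Rightarrow> real \<Rightarrow> real \<Rightarrow> real \<Rightarrow> (real ^ 'n \<Rightarrow> real) \<Rightarrow> (real \<times> (real ^ 'n) \<Rightarrow> real)
      \<Rightarrow> (real \<Rightarrow> real ^ 'n \<Rightarrow> real) \<Rightarrow> bool" where
  "is_solution d L T \<epsilon> u0 v u \<longleftrightarrow>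
     continuous_into_X d L T \<epsilon> u \<and> eq_X d L (u 0) u0 \<and>
     (\<forall>\<tau>\<in>{0..T}. \<forall>\<psi>. test_function \<psi> \<longrightarrow>
        inner_X d L \<epsilon> (u \<tau>) (\<lambda>x. \<psi> (\<tau>, x)) - inner_X d L \<epsilon> u0 (\<lambda>x. \<psi> (0, x)) =
        (LINT t:{0..\<tau>}|lborel. weak_integrand d L \<epsilon> v \<psi> (u t) t))"

text \<open>Solutions are unique up to equality in \<open>X\<close>, so \<open>\<exists>u\<close> expresses that the solution vanishes at
  time \<open>T\<close>.\<close>

definition steers_to_zero ::
    "'n::finite \<Rightarrow> real \<Rightarrow> real \<Rightarrow> real \<Rightarrow> (real ^ 'n \<Rightarrow> real) \<Rightarrow> (real \<times> (real ^ 'n) \<Rightarrow> real) \<Rightarrow> bool"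
  where
  "steers_to_zero d L T \<epsilon> u0 v \<longleftrightarrow>
     (\<exists>u. is_solution d L T \<epsilon> u0 v u \<and> eq_X d L (u T) (\<lambda>_. 0))"

definition null_control_constant :: "'n::finite \<Rightarrow> real \<Rightarrow> real \<Rightarrow> real \<Rightarrow> real \<Rightarrow> bool" where
  "null_control_constant d L T \<epsilon> C \<longleftrightarrow> 0 \<le> C \<and>
     (\<forall>u0. in_X d L u0 \<longrightarrow>
        (\<exists>v. in_L2 (control_measure d T) v \<and> steers_to_zero d L T \<epsilon> u0 v \<and>
             L2_norm (control_measure d T) v \<le> C * norm_X d L \<epsilon> u0))"

text \<open>The infimum of the empty set is \<open>\<infinity>\<close>.\<close>

definition null_control_cost :: "'n::finite \<Rightarrow> real \<Rightarrow> real \<Rightarrow> real \<Rightarrow> ereal" where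
  "null_control_cost d L T \<epsilon> = Inf (ereal ` {C. null_control_constant d L T \<epsilon> C})"

end

theory Submission
  imports Defs "HOL-Computational_Algebra.Polynomial"
begin

text \<open>
  Testing the weak formulation at time \<open>T\<close> with a solution \<open>\<psi>\<close> of the adjoint problem turns null
  controllability into the observability inequality \<open>\<bar>\<langle>u\<^sub>0, \<psi>(0)\<rangle>\<^sub>X\<bar> \<le> \<parallel>v\<parallel> \<parallel>\<psi>\<parallel>\<close>, the last norm being that
  of \<open>L\<^sup>2((0,T) \<times> \<Gamma>\<^sub>0)\<close>. The adjoint problem has the modes
  \<open>e\<^bsup>\<lambda>t\<^esup> w(x\<^sub>n) \<Prod>\<^sub>i cos(\<xi>\<^sub>i x\<^sub>i)\<close> with \<open>w(y) = e\<^bsup>-y/2\<epsilon>\<^esup> cos(k(y + L/2)) / cos(kL/2)\<close> and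
  \<open>\<lambda> = 1/4\<epsilon> + \<epsilon>k\<^sup>2 + \<epsilon>\<bar>\<xi>\<bar>\<^sup>2\<close>. Both boundary conditions hold iff
  \<open>\<epsilon>k tan(kL/2) = 1/4 - \<epsilon>\<^sup>2\<bar>\<xi>\<bar>\<^sup>2 - \<epsilon>\<^sup>2k\<^sup>2\<close>, which has a root \<open>k\<close> between \<open>0\<close> and \<open>\<pi>/L\<close>. Then \<open>w(0) = 1\<close>
  and \<open>w(-L) = e\<^bsup>L/2\<epsilon>\<^esup>\<close>, while the time factor is at most about \<open>e\<^bsup>T/4\<epsilon>\<^esup>\<close>; data on \<open>\<Gamma>\<^sub>1\<close> thus force
  a control of size at least about \<open>e\<^bsup>(L/2 - T/4)/\<epsilon>\<^esup>\<close>.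

  The modes are not square integrable in the tangential variables, so one adds up those with
  \<open>\<xi> \<in> {1/N, \<dots>, 1}\<^bsup>n-1\<^esup>\<close> and multiplies by a cut-off at scale \<open>N\<close>. By orthogonality of the modes on
  the cube \<open>[-\<pi>N, \<pi>N]\<^bsup>n-1\<^esup>\<close>, both norms of \<open>\<psi>\<close> are of order \<open>N\<^bsup>n-1\<^esup>\<close> and the residual caused by the
  cut-off is smaller by a factor \<open>N\<close>. Letting \<open>N \<rightarrow> \<infinity>\<close> for one fixed solution \<open>u\<close> removes the residual,
  so that no a priori estimate for \<open>u\<close> is needed.
\<close>

section \<open>Smooth functions of one and several variables\<close>

definition smooth :: "('a::euclidean_space \<Rightarrow> real) \<Rightarrow> bool" where
  "smooth f \<longleftrightarrow> (\<forall>m. C_diff m f)"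

lemma C_diff_Suc_imp: "C_diff (Suc m) f \<Longrightarrow> C_diff m f"
proof (induction m arbitrary: f)
  case 0
  then show ?case
    by (auto intro!: continuous_at_imp_continuous_on differentiable_imp_continuous_within)
next
  case (Suc m)
  then show ?case by (metis C_diff.simps(2))
qed

lemma C_diff_const: "C_diff m (\<lambda>x. c)"
proof (induction m arbitrary: c)
  case (Suc m)
  have "frechet_derivative (\<lambda>x::'a. c) (at x) = (\<lambda>h. 0)" for x
    by (rule frechet_derivative_at[symmetric]) (auto intro!: derivative_eq_intros)
  then show ?case using Suc by simp
qed auto

lemma frechet_derivative_eq: "(f has_derivative f') (at x) \<Longrightarrow> frechet_derivative f (at x) = f'"
  by (metis frechet_derivative_at)

lemma C_diff_add: "C_diff m f \<Longrightarrow> C_diff m g \<Longrightarrow> C_diff m (\<lambda>x. f x + g x)"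
proof (induction m arbitrary: f g)
  case 0
  then show ?case by (auto intro: continuous_intros)
next
  case (Suc m)
  have "frechet_derivative (\<lambda>x. f x + g x) (at x) =
      (\<lambda>h. frechet_derivative f (at x) h + frechet_derivative g (at x) h)" for x
    using Suc.prems by (auto intro!: frechet_derivative_eq has_derivative_add simp: frechet_derivative_works[symmetric])
  then show ?case using Suc by (auto intro: differentiable_add)
qed

lemma C_diff_mult: "C_diff m f \<Longrightarrow> C_diff m g \<Longrightarrow> C_diff m (\<lambda>x. f x * g x)"
proof (induction m arbitrary: f g)
  case 0
  then show ?case by (auto intro: continuous_intros)
next
  case (Suc m)
  have "frechet_derivative (\<lambda>x. f x * g x) (at x) =
      (\<lambda>h. f x * frechet_derivative g (at x) h + frechet_derivative f (at x) h * g x)" for x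
    using Suc.prems by (auto intro!: frechet_derivative_eq has_derivative_mult simp: frechet_derivative_works[symmetric])
  moreover have "C_diff m f" "C_diff m g"
    using Suc.prems C_diff_Suc_imp by blast+
  ultimately show ?case using Suc by (auto intro!: differentiable_mult C_diff_add)
qed

lemma C_diff_sum: "(\<And>i. i \<in> A \<Longrightarrow> C_diff m (f i)) \<Longrightarrow> C_diff m (\<lambda>x. \<Sum>i\<in>A. f i x)"
  by (induction A rule: infinite_finite_induct) (auto intro: C_diff_const C_diff_add)

lemma C_diff_prod: "(\<And>i. i \<in> A \<Longrightarrow> C_diff m (f i)) \<Longrightarrow> C_diff m (\<lambda>x. \<Prod>i\<in>A. f i x)"
  by (induction A rule: infinite_finite_induct) (auto intro: C_diff_const C_diff_mult)

lemma frechet_derivative_real: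
  "(f has_real_derivative D) (at x) \<Longrightarrow> frechet_derivative f (at x) = (\<lambda>h. D * h)"
  by (auto simp: has_field_derivative_def intro: frechet_derivative_eq)

text \<open>With an affine inner map, the derivative at \<open>x\<close> in direction
  \<open>h\<close> is the derivative of \<open>f\<close> at \<open>l x + c\<close> in the fixed
  direction \<open>l h\<close>. This is again a function composed with the same map, so the
  induction closes without a general chain rule for \<open>C_diff\<close>.\<close>

lemma C_diff_compose_affine:
  fixes l :: "'a::euclidean_space \<Rightarrow> real"
  assumes l: "bounded_linear l"
  shows "C_diff m f \<Longrightarrow> C_diff m (\<lambda>x. f (l x + c))"
proof (induction m arbitrary: f)
  case 0
  have "continuous_on UNIV (\<lambda>x. l x + c)"
    by (intro continuous_intros linear_continuous_on l)
  with 0 show ?case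
    by (auto intro: continuous_on_compose2)
next
  case (Suc m)
  have fd: "f differentiable at y" for y using Suc.prems by simp
  have hd: "((\<lambda>x. f (l x + c)) has_derivative (\<lambda>h. frechet_derivative f (at (l x + c)) (l h))) (at x)" for x
  proof -
    have "((\<lambda>x. l x + c) has_derivative l) (at x)"
      by (auto intro!: derivative_eq_intros bounded_linear_imp_has_derivative l)
    moreover have "(f has_derivative frechet_derivative f (at (l x + c))) (at (l x + c))"
      using fd frechet_derivative_works by blast
    ultimately show ?thesis by (rule has_derivative_compose)
  qed
  have "frechet_derivative (\<lambda>x. f (l x + c)) (at x) h = frechet_derivative f (at (l x + c)) (l h)" for x h
    using frechet_derivative_eq[OF hd] by simp
  moreover have "C_diff m (\<lambda>x. frechet_derivative f (at (l x + c)) (l h))" for h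
    using Suc.prems by (intro Suc.IH[of "\<lambda>y. frechet_derivative f (at y) (l h)"]) auto
  moreover have "(\<lambda>x. f (l x + c)) differentiable at x" for x
    using hd by (rule differentiableI)
  ultimately show ?case by simp
qed

lemma smooth_const: "smooth (\<lambda>x. c)"
  and smooth_add: "smooth f \<Longrightarrow> smooth g \<Longrightarrow> smooth (\<lambda>x. f x + g x)"
  and smooth_mult: "smooth f \<Longrightarrow> smooth g \<Longrightarrow> smooth (\<lambda>x. f x * g x)"
  and smooth_sum: "(\<And>i. i \<in> A \<Longrightarrow> smooth (F i)) \<Longrightarrow> smooth (\<lambda>x. \<Sum>i\<in>A. F i x)"
  and smooth_prod: "(\<And>i. i \<in> A \<Longrightarrow> smooth (F i)) \<Longrightarrow> smooth (\<lambda>x. \<Prod>i\<in>A. F i x)"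
  and smooth_compose_affine: "bounded_linear l \<Longrightarrow> smooth \<phi> \<Longrightarrow> smooth (\<lambda>x. \<phi> (l x + c))"
  by (auto simp: smooth_def intro: C_diff_const C_diff_add C_diff_mult C_diff_sum C_diff_prod
      C_diff_compose_affine)

text \<open>Induction on the order, for all members of the class at once. It serves for explicit
  families in which differentiation only changes the parameters.\<close>

lemma smooth_closed_under_deriv:
  fixes f :: "real \<Rightarrow> real"
  assumes step: "\<And>f. P f \<Longrightarrow> \<exists>g. P g \<and> (\<forall>x. (f has_real_derivative g x) (at x))"
    and "P f"
  shows "smooth f"
proof -
  have "P f \<Longrightarrow> C_diff m f" for m f
  proof (induction m arbitrary: f)
    case 0
    then show ?case
      using step[of f] by (auto intro!: continuous_at_imp_continuous_on intro: DERIV_isCont)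
  next
    case (Suc m)
    then obtain g where g: "P g" "\<And>x. (f has_real_derivative g x) (at x)"
      using step[of f] by auto
    have "C_diff m (\<lambda>x. g x * h)" for h
      by (intro C_diff_mult C_diff_const Suc.IH g)
    then show ?case
      using g by (auto simp: frechet_derivative_real[OF g(2)] real_differentiable_def)
  qed
  with \<open>P f\<close> show ?thesis by (simp add: smooth_def)
qed

text \<open>For antiderivatives of smooth functions, where no explicit family is at hand.\<close>

lemma smooth_if_deriv_smooth:
  fixes f :: "real \<Rightarrow> real"
  assumes "\<And>x. (f has_real_derivative f' x) (at x)" "smooth f'"
  shows "smooth f"
proof -
  have "C_diff m f" for m
  proof (cases m)
    case 0
    then show ?thesis
      using assms by (auto intro!: continuous_at_imp_continuous_on DERIV_isCont)
  next
    case (Suc k)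
    have "C_diff k (\<lambda>x. f' x * h)" for h
      using assms by (auto simp: smooth_def intro!: C_diff_mult C_diff_const)
    then show ?thesis
      using assms by (auto simp: Suc frechet_derivative_real[OF assms(1)] real_differentiable_def)
  qed
  then show ?thesis by (simp add: smooth_def)
qed

lemma smooth_has_deriv:
  fixes f :: "real \<Rightarrow> real"
  assumes "smooth f"
  shows "(f has_real_derivative deriv f x) (at x)"
proof -
  have "C_diff (Suc 0) f" using assms by (simp only: smooth_def)
  then show ?thesis by (simp add: DERIV_deriv_iff_real_differentiable)
qed

lemma smooth_deriv:
  fixes f :: "real \<Rightarrow> real"
  assumes "smooth f"
  shows "smooth (deriv f)"
proof -
  have "frechet_derivative f (at x) 1 = deriv f x" for x
    by (simp add: frechet_derivative_real[OF smooth_has_deriv[OF assms]])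
  moreover have "C_diff m (\<lambda>x. frechet_derivative f (at x) 1)" for m
  proof -
    have "C_diff (Suc m) f" using assms by (simp only: smooth_def)
    then show ?thesis by simp
  qed
  ultimately show ?thesis by (simp add: smooth_def)
qed

lemma smooth_continuous: "smooth f \<Longrightarrow> continuous_on A f"
  using continuous_on_subset[of UNIV f A] by (auto simp: smooth_def dest: spec[of _ 0])

section \<open>Explicit smooth functions and cut-offs\<close>

lemma smooth_exp_trig:
  "smooth (\<lambda>x::real. exp (a * x) * (p * cos (b * x + c) + q * sin (b * x + c)))"
proof (rule smooth_closed_under_deriv[where P="\<lambda>f. \<exists>p q. f = (\<lambda>x. exp (a * x) * (p * cos (b * x + c) + q * sin (b * x + c)))"])
  fix f :: "real \<Rightarrow> real"
  assume "\<exists>p q. f = (\<lambda>x. exp (a * x) * (p * cos (b * x + c) + q * sin (b * x + c)))"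
  then obtain p q where f: "f = (\<lambda>x. exp (a * x) * (p * cos (b * x + c) + q * sin (b * x + c)))"
    by auto
  \<comment> \<open>With \<open>a\<close>, \<open>b\<close>, \<open>c\<close> fixed, differentiation
    sends \<open>(p, q)\<close> to \<open>(a p + b q, a q - b p)\<close>.\<close>
  have "(f has_real_derivative exp (a * x) * ((a * p + b * q) * cos (b * x + c) + (a * q - b * p) * sin (b * x + c))) (at x)" for x
    unfolding f by (auto intro!: derivative_eq_intros simp: algebra_simps)
  then show "\<exists>g. (\<exists>p q. g = (\<lambda>x. exp (a * x) * (p * cos (b * x + c) + q * sin (b * x + c)))) \<and>
      (\<forall>x. (f has_real_derivative g x) (at x))"
    by blast
qed auto

text \<open>The usual flat function \<open>e^(-1/x)\<close> times a polynomial in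
  \<open>1/x\<close>. With the polynomial as a parameter, the derivative has the same form.\<close>

definition flat_exp :: "real poly \<Rightarrow> real \<Rightarrow> real" where
  "flat_exp p x = (if x > 0 then poly p (1 / x) * exp (- (1 / x)) else 0)"

lemma poly_exp_tendsto_0: "((\<lambda>y::real. poly p y * exp (- y)) \<longlongrightarrow> 0) at_top"
proof -
  have "((\<lambda>y. \<Sum>i\<le>degree p. coeff p i * (y ^ i / exp y)) \<longlongrightarrow> (\<Sum>i\<le>degree p. coeff p i * 0)) at_top"
    by (intro tendsto_intros tendsto_power_div_exp_0)
  then show ?thesis
    by (simp add: poly_altdef sum_distrib_right exp_minus divide_inverse mult.assoc)
qed

text \<open>For \<open>x > 0\<close> differentiation gives
  \<open>x^(-2) (p - p')(1/x) e^(-1/x)\<close>, and \<open>[:0, 0, 1:]\<close> has the value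
  \<open>x^(-2)\<close> at \<open>1/x\<close>. At 0 both one-sided difference quotients tend to 0,
  since the exponential beats every polynomial.\<close>

lemma flat_exp_DERIV:
  "(flat_exp p has_real_derivative flat_exp ([:0, 0, 1:] * (p - pderiv p)) x) (at x)"
proof -
  consider "x > 0" | "x < 0" | "x = 0" by linarith
  then show ?thesis
  proof cases
    case 1
    have "((\<lambda>x. poly p (1 / x) * exp (- (1 / x))) has_real_derivative
        poly ([:0, 0, 1:] * (p - pderiv p)) (1 / x) * exp (- (1 / x))) (at x)"
      using 1 by (auto intro!: derivative_eq_intros simp: field_simps power2_eq_square)
    then have "(flat_exp p has_real_derivative
        poly ([:0, 0, 1:] * (p - pderiv p)) (1 / x) * exp (- (1 / x))) (at x)"
      by (rule has_field_derivative_transform_within_open[where S="{0<..}"])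
         (use 1 in \<open>auto simp: flat_exp_def\<close>)
    then show ?thesis using 1 by (simp add: flat_exp_def)
  next
    case 2
    have "((\<lambda>x. 0) has_real_derivative 0) (at x)" by simp
    then have "(flat_exp p has_real_derivative 0) (at x)"
      by (rule has_field_derivative_transform_within_open[where S="{..<0}"])
         (use 2 in \<open>auto simp: flat_exp_def\<close>)
    then show ?thesis using 2 by (simp add: flat_exp_def)
  next
    case 3
    have "((\<lambda>h. flat_exp p h / h) \<longlongrightarrow> 0) (at_right 0)"
    proof -
      \<comment> \<open>\<open>pCons 0 p\<close> is \<open>p\<close> times the variable; the extra
        factor \<open>1/h\<close> is the division in the difference quotient.\<close>
      have "((\<lambda>h. poly (pCons 0 p) (inverse h) * exp (- inverse h)) \<longlongrightarrow> 0) (at_right (0::real))"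
        using filterlim_compose[OF poly_exp_tendsto_0 filterlim_inverse_at_top_right] .
      then show ?thesis
        by (rule Lim_transform_eventually)
           (auto simp: eventually_at_right_less flat_exp_def divide_inverse eventually_at_filter)
    qed
    moreover have "((\<lambda>h. flat_exp p h / h) \<longlongrightarrow> 0) (at_left 0)"
      by (rule tendsto_eventually) (auto simp: flat_exp_def eventually_at_filter)
    ultimately have "((\<lambda>h. flat_exp p h / h) \<longlongrightarrow> 0) (at 0)"
      by (simp add: filterlim_split_at)
    then show ?thesis using 3 by (simp add: DERIV_def flat_exp_def)
  qed
qed

lemma smooth_shift: "smooth f \<Longrightarrow> smooth (\<lambda>x::real. f (a * x + c))"
  by (rule smooth_compose_affine[OF bounded_linear_mult_right])

lemma smooth_flat_exp: "smooth (flat_exp p)"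
  by (rule smooth_closed_under_deriv[where P="\<lambda>f. \<exists>p. f = flat_exp p"]) (auto intro: flat_exp_DERIV)

text \<open>Integrate the bump \<open>b\<close>, which is positive exactly on \<open>(0, 1)\<close>,
  and divide by its total mass.\<close>

lemma smooth_step_exists:
  obtains H :: "real \<Rightarrow> real"
  where "smooth H" "\<And>x. 0 \<le> H x" "\<And>x. H x \<le> 1" "\<And>x. x \<le> 0 \<Longrightarrow> H x = 0" "\<And>x. 1 \<le> x \<Longrightarrow> H x = 1"
proof -
  define b where "b x = flat_exp 1 x * flat_exp 1 (1 - x)" for x
  have sb: "smooth b"
  proof -
    have "smooth (\<lambda>x. flat_exp 1 (- 1 * x + 1))"
      by (rule smooth_shift) (rule smooth_flat_exp)
    then show ?thesis
      unfolding b_def by (intro smooth_mult smooth_flat_exp) (simp add: algebra_simps)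
  qed
  have b0: "b x = 0" if "x \<le> 0 \<or> 1 \<le> x" for x using that by (auto simp: b_def flat_exp_def)
  have bpos: "b x \<ge> 0" for x by (auto simp: b_def flat_exp_def)
  have bpos': "b x > 0" if "0 < x" "x < 1" for x using that by (auto simp: b_def flat_exp_def)
  \<comment> \<open>Starting at \<open>-1\<close> instead of \<open>0\<close> makes every
    \<open>x \<ge> 0\<close> an interior point of \<open>{-1..x+1}\<close>, so that the derivative
    within this interval is a full derivative.\<close>
  define G where "G x = integral {-1..x} b" for x
  have G0: "G x = 0" if "x \<le> 0" for x
  proof -
    have "integral {-1..x} b = integral {-1..x} (\<lambda>_. 0)"
      using that by (intro integral_cong) (auto simp: b0)
    then show ?thesis by (simp add: G_def)
  qed
  have dG: "(G has_real_derivative b x) (at x)" for x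
  proof (cases "x < 0")
    case True
    have "((\<lambda>x. 0) has_real_derivative 0) (at x)" by simp
    then have "(G has_real_derivative 0) (at x)"
      by (rule has_field_derivative_transform_within_open[where S="{..<0}"]) (use True G0 in auto)
    with True show ?thesis by (simp add: b0)
  next
    case False
    have "(G has_real_derivative b x) (at x within {-1..x+1})"
      unfolding G_def using False by (intro integral_has_real_derivative smooth_continuous sb) auto
    moreover have "at x within {-1..x+1} = at x"
      using False by (intro at_within_interior) auto
    ultimately show ?thesis by simp
  qed
  have mono: "G x \<le> G y" if "x \<le> y" for x y
    using that by (rule DERIV_nonneg_imp_nondecreasing) (use dG bpos in blast)
  have G1: "G x = G 1" if "x \<ge> 1" for x
  proof (cases "x = 1")
    case False
    then have "1 < x" using that by simp
    then obtain z where "1 < z" "z < x" "G x - G 1 = (x - 1) * b z"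
      using MVT2[of 1 x G b] dG by auto
    then show ?thesis by (simp add: b0)
  qed auto
  obtain z where "0 < z" "z < 1" "G 1 - G 0 = (1 - 0) * b z"
    using MVT2[of 0 1 G b] dG by auto
  then have pos: "G 1 > 0" using bpos'[of z] by (simp add: G0)
  define H where "H x = inverse (G 1) * G x" for x
  show ?thesis
  proof
    show "smooth H" unfolding H_def
      by (intro smooth_mult smooth_const smooth_if_deriv_smooth[OF dG sb])
    have "0 \<le> G x" "G x \<le> G 1" for x
      using mono[of 0 x] mono[of x 1] G0[of x] G0[of 0] G1[of x] pos by linarith+
    then show "0 \<le> H x" "H x \<le> 1" for x
      using pos by (auto simp: H_def field_simps)
    show "H x = 0" if "x \<le> 0" for x using G0[OF that] by (simp add: H_def)
    show "H x = 1" if "1 \<le> x" for x using G1[OF that] pos by (simp add: H_def)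
  qed
qed

text \<open>A step that rises on \<open>[-2, -1]\<close> times its mirror image.\<close>

lemma plateau_exists:
  obtains \<eta> :: "real \<Rightarrow> real"
  where "smooth \<eta>" "\<And>x. 0 \<le> \<eta> x" "\<And>x. \<eta> x \<le> 1"
    "\<And>x. \<bar>x\<bar> \<le> 1 \<Longrightarrow> \<eta> x = 1" "\<And>x. 2 \<le> \<bar>x\<bar> \<Longrightarrow> \<eta> x = 0"
proof -
  obtain H :: "real \<Rightarrow> real"
    where H: "smooth H" "\<And>x. 0 \<le> H x" "\<And>x. H x \<le> 1" "\<And>x. x \<le> 0 \<Longrightarrow> H x = 0" "\<And>x. 1 \<le> x \<Longrightarrow> H x = 1"
    using smooth_step_exists by blast
  have "smooth (\<lambda>x. H (1 * x + 2) * H (- 1 * x + 2))"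
    by (intro smooth_mult smooth_shift H)
  then show ?thesis
  proof (rule that)
    show "H (1 * x + 2) * H (- 1 * x + 2) = 0" if "2 \<le> \<bar>x\<bar>" for x
      using that H(4)[of "x + 2"] H(4)[of "2 - x"] by (cases "x \<ge> 0") auto
  qed (use H in \<open>auto intro!: mult_le_one\<close>)
qed

section \<open>Square-integrable functions and product functions\<close>

text \<open>If \<open>a\<close> and \<open>b\<close> are positive, the bound at
  \<open>s = sqrt b / sqrt a\<close> is \<open>sqrt a * sqrt b\<close>; if one of them vanishes, the
  bound gets arbitrarily small. Since the bound is linear in \<open>a\<close> and \<open>b\<close>,
  it can be reached by integrating a pointwise inequality, which yields Cauchy-Schwarz inequalities
  in space and in time.\<close>

lemma mult_sqrt_le:
  fixes a b X :: real
  assumes "0 \<le> a" "0 \<le> b" and le: "\<And>s. s > 0 \<Longrightarrow> X \<le> (s * a + b / s) / 2"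
  shows "X \<le> sqrt a * sqrt b"
proof (cases "a = 0 \<or> b = 0")
  case True
  have "X \<le> e" if "e > 0" for e
  proof (cases "a = 0")
    case True
    \<comment> \<open>The \<open>+ 1\<close> keeps \<open>s\<close> positive when
      \<open>b = 0\<close>.\<close>
    have "X \<le> (((b + 1) / e) * a + b / ((b + 1) / e)) / 2"
      using that assms by (intro le) auto
    also have "\<dots> = e * (b / (b + 1)) / 2" using True by simp
    also have "\<dots> \<le> e * 1 / 2" using that assms by (intro divide_right_mono mult_left_mono) auto
    finally show ?thesis using that by simp
  next
    case False
    then have "a > 0" "b = 0" using True assms by auto
    have "X \<le> ((e / a) * a + b / (e / a)) / 2"
      using that \<open>a > 0\<close> by (intro le) auto
    also have "\<dots> \<le> e" using \<open>a > 0\<close> \<open>b = 0\<close> that by simp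
    finally show ?thesis .
  qed
  then have "X \<le> 0" by (rule field_le_epsilon[where y=0, simplified])
  with True show ?thesis by auto
next
  case False
  then have "a > 0" "b > 0" using assms by auto
  have "X \<le> ((sqrt b / sqrt a) * a + b / (sqrt b / sqrt a)) / 2"
    using \<open>a > 0\<close> \<open>b > 0\<close> by (intro le) simp
  also have "(sqrt b / sqrt a) * a = sqrt a * sqrt b"
    using \<open>a > 0\<close> by (simp add: real_div_sqrt field_simps)
  also have "b / (sqrt b / sqrt a) = sqrt a * sqrt b"
    using \<open>b > 0\<close> by (simp add: real_div_sqrt field_simps)
  finally show ?thesis by simp
qed

section \<open>Cauchy-Schwarz and triangle inequality for square-integrable functions\<close>

lemma L2_norm_nonneg: "0 \<le> L2_norm M f"
  by (simp add: L2_norm_def)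

lemma L2_norm_power2: "(L2_norm M f)\<^sup>2 = (\<integral>x. (f x)\<^sup>2 \<partial>M)"
  by (simp add: L2_norm_def)

lemma in_L2_integrable_mult:
  assumes "in_L2 M f" "in_L2 M g"
  shows "integrable M (\<lambda>x. f x * g x)"
proof (rule Bochner_Integration.integrable_bound)
  show "integrable M (\<lambda>x. (f x)\<^sup>2 + (g x)\<^sup>2)"
    using assms by (auto simp: in_L2_def)
  show "(\<lambda>x. f x * g x) \<in> borel_measurable M"
    using assms by (auto simp: in_L2_def)
  have "\<bar>f x * g x\<bar> \<le> (f x)\<^sup>2 + (g x)\<^sup>2" for x
    using sum_squares_bound[of "f x" "g x"] sum_squares_bound[of "f x" "- g x"] by (simp add: abs_le_iff)
  then show "AE x in M. norm (f x * g x) \<le> norm ((f x)\<^sup>2 + (g x)\<^sup>2)"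
    by simp
qed

lemma L2_Cauchy_Schwarz:
  assumes "in_L2 M f" "in_L2 M g"
  shows "\<bar>\<integral>x. f x * g x \<partial>M\<bar> \<le> L2_norm M f * L2_norm M g"
  unfolding L2_norm_def
proof (rule mult_sqrt_le)
  fix s :: real assume s: "s > 0"
  have "\<bar>\<integral>x. f x * g x \<partial>M\<bar> \<le> (\<integral>x. \<bar>f x * g x\<bar> \<partial>M)"
    by (rule integral_abs_bound)
  also have "\<dots> \<le> (\<integral>x. (s * (f x)\<^sup>2 + (g x)\<^sup>2 / s) / 2 \<partial>M)"
  proof (rule integral_mono)
    show "integrable M (\<lambda>x. \<bar>f x * g x\<bar>)"
      using in_L2_integrable_mult[OF assms] by auto
    show "integrable M (\<lambda>x. (s * (f x)\<^sup>2 + (g x)\<^sup>2 / s) / 2)"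
      using assms by (auto simp: in_L2_def)
    show "\<bar>f x * g x\<bar> \<le> (s * (f x)\<^sup>2 + (g x)\<^sup>2 / s) / 2" for x
    proof -
      have "2 * (s * \<bar>f x\<bar>) * \<bar>g x\<bar> \<le> (s * \<bar>f x\<bar>)\<^sup>2 + \<bar>g x\<bar>\<^sup>2"
        by (rule sum_squares_bound)
      then show ?thesis using s by (simp add: field_simps power2_eq_square abs_mult)
    qed
  qed
  also have "\<dots> = (s * (\<integral>x. (f x)\<^sup>2 \<partial>M) + (\<integral>x. (g x)\<^sup>2 \<partial>M) / s) / 2"
    using assms by (simp add: in_L2_def)
  finally show "\<bar>\<integral>x. f x * g x \<partial>M\<bar> \<le> (s * (\<integral>x. (f x)\<^sup>2 \<partial>M) + (\<integral>x. (g x)\<^sup>2 \<partial>M) / s) / 2" .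
qed auto

lemma in_L2_add:
  assumes "in_L2 M f" "in_L2 M g"
  shows "in_L2 M (\<lambda>x. f x + g x)"
proof -
  have "integrable M (\<lambda>x. (f x)\<^sup>2 + (g x)\<^sup>2 + 2 * (f x * g x))"
    using assms in_L2_integrable_mult[OF assms] by (auto simp: in_L2_def)
  then show ?thesis using assms by (auto simp: in_L2_def power2_sum mult.assoc)
qed

lemma in_L2_cmult: "in_L2 M f \<Longrightarrow> in_L2 M (\<lambda>x. c * f x)"
  by (auto simp: in_L2_def power_mult_distrib)

lemma in_L2_sum: "(\<And>i. i \<in> A \<Longrightarrow> in_L2 M (f i)) \<Longrightarrow> in_L2 M (\<lambda>x. \<Sum>i\<in>A. f i x)"
  by (induction A rule: infinite_finite_induct) (auto intro: in_L2_add simp: in_L2_def[of _ "\<lambda>x. 0"])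

lemma in_L2_diff: "in_L2 M f \<Longrightarrow> in_L2 M g \<Longrightarrow> in_L2 M (\<lambda>x. f x - g x)"
  using in_L2_add[of M f "\<lambda>x. - 1 * g x"] in_L2_cmult[of M g "-1"] by simp

lemma L2_norm_triangle:
  assumes "in_L2 M f" "in_L2 M g"
  shows "L2_norm M (\<lambda>x. f x + g x) \<le> L2_norm M f + L2_norm M g"
proof (rule power2_le_imp_le)
  have "(\<integral>x. (f x + g x)\<^sup>2 \<partial>M) = (\<integral>x. (f x)\<^sup>2 \<partial>M) + (\<integral>x. (g x)\<^sup>2 \<partial>M) + 2 * (\<integral>x. f x * g x \<partial>M)"
    using assms in_L2_integrable_mult[OF assms]
    by (simp add: in_L2_def power2_sum mult.assoc)
  also have "\<dots> \<le> (L2_norm M f)\<^sup>2 + (L2_norm M g)\<^sup>2 + 2 * (L2_norm M f * L2_norm M g)"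
    using L2_Cauchy_Schwarz[OF assms] by (auto simp: L2_norm_power2)
  finally show "(L2_norm M (\<lambda>x. f x + g x))\<^sup>2 \<le> (L2_norm M f + L2_norm M g)\<^sup>2"
    by (simp add: L2_norm_power2 power2_sum mult.assoc)
qed (simp add: L2_norm_nonneg)

lemma L2_norm_sum:
  assumes "finite A" "\<And>i. i \<in> A \<Longrightarrow> in_L2 M (f i)"
  shows "L2_norm M (\<lambda>x. \<Sum>i\<in>A. f i x) \<le> (\<Sum>i\<in>A. L2_norm M (f i))"
  using assms
proof (induction A rule: finite_induct)
  case (insert a A)
  then have "L2_norm M (\<lambda>x. \<Sum>i\<in>insert a A. f i x) \<le> L2_norm M (f a) + L2_norm M (\<lambda>x. \<Sum>i\<in>A. f i x)"
    by (simp add: L2_norm_triangle in_L2_sum)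
  with insert show ?case by auto
qed (simp add: L2_norm_def)

lemma L2_norm_mono:
  assumes "in_L2 M f" "in_L2 M g" "AE x in M. \<bar>f x\<bar> \<le> \<bar>g x\<bar>"
  shows "L2_norm M f \<le> L2_norm M g"
  unfolding L2_norm_def using assms
  by (auto simp: in_L2_def abs_le_square_iff intro!: integral_mono_AE real_sqrt_le_mono)

lemma L2_norm_cmult: "L2_norm M (\<lambda>x. c * f x) = \<bar>c\<bar> * L2_norm M f"
  by (simp add: L2_norm_def power_mult_distrib real_sqrt_mult)

section \<open>Integration of product functions\<close>

definition sprod :: "('n::finite \<Rightarrow> real \<Rightarrow> real) \<Rightarrow> real ^ 'n \<Rightarrow> real" where
  "sprod q x = (\<Prod>i\<in>UNIV. q i (x $ i))"

lemma sprod_split: "sprod q x = q d (x $ d) * (\<Prod>i\<in>UNIV - {d}. q i (x $ i))"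
  unfolding sprod_def by (subst prod.remove[of _ d]) auto

lemma sprod_mult: "sprod q x * sprod r x = sprod (\<lambda>i y. q i y * r i y) x"
  by (simp add: sprod_def prod.distrib)

text \<open>Holds for Lebesgue measure (\<open>\<kappa> = lborel\<close>) and for a hyperplane (\<open>\<kappa>\<close> a point mass), so that the
  interior and the boundary norms are computed together.\<close>

definition integrates_products :: "(real ^ 'n::finite) measure \<Rightarrow> 'n \<Rightarrow> real measure \<Rightarrow> bool" where
  "integrates_products \<mu> d \<kappa> \<longleftrightarrow> (\<forall>f. (\<forall>i. i \<noteq> d \<longrightarrow> integrable lborel (f i)) \<longrightarrow> integrable \<kappa> (f d) \<longrightarrow>
     has_bochner_integral \<mu> (sprod f) ((\<integral>y. f d y \<partial>\<kappa>) * (\<Prod>i\<in>UNIV - {d}. \<integral>y. f i y \<partial>lborel)))"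

lemma borel_measurable_vec_nth [measurable]: "(\<lambda>x::real ^ 'n::finite. x $ i) \<in> borel_measurable borel"
  by (intro borel_measurable_continuous_onI continuous_intros)

lemma borel_measurable_sprod:
  assumes "\<And>i. q i \<in> borel_measurable borel"
  shows "sprod q \<in> borel_measurable borel"
  unfolding sprod_def using assms by measurable

text \<open>Lebesgue measure on \<open>real ^ 'n\<close> is the image of a product measure indexed
  by the vectors of \<open>Basis\<close>. Renaming these indices to coordinates reduces the claim to
  Fubini's theorem for products.\<close>

lemma integrates_products_lborel: "integrates_products (lborel :: (real ^ 'n::finite) measure) d lborel"
  unfolding integrates_products_def
proof (intro allI impI)
  fix f :: "'n \<Rightarrow> real \<Rightarrow> real"
  assume "\<forall>i. i \<noteq> d \<longrightarrow> integrable lborel (f i)" "integrable lborel (f d)"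
  then have f: "integrable lborel (f i)" for i by (cases "i = d") auto
  then have fm: "f i \<in> borel_measurable borel" for i
    using borel_measurable_integrable by fastforce
  interpret product_sigma_finite "\<lambda>_::real ^ 'n. lborel :: real measure"
    by (rule product_sigma_finite.intro) (rule sigma_finite_lborel)
  \<comment> \<open>The inverse of the enumeration of the basis by coordinates.\<close>
  define ix where "ix b = (THE i. b = axis i (1::real))" for b :: "real ^ 'n"
  have ix: "ix (axis i 1) = i" for i
    by (auto simp: ix_def axis_eq_axis)
  have B: "(Basis :: (real ^ 'n) set) = range (\<lambda>i. axis i 1)"
    by (auto simp: Basis_vec_def)
  have inj: "inj (\<lambda>i::'n. axis i (1::real))"
    by (auto simp: inj_on_def axis_eq_axis)
  have comp: "sprod f (\<Sum>b\<in>Basis. y b *\<^sub>R b) = (\<Prod>b\<in>Basis. f (ix b) (y b))" for y :: "real ^ 'n \<Rightarrow> real"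
  proof -
    have "(\<Sum>b\<in>Basis. y b *\<^sub>R b) $ i = y (axis i 1)" for i
    proof -
      have "(\<Sum>b\<in>Basis. y b *\<^sub>R b) $ i = (\<Sum>b\<in>Basis. y b *\<^sub>R b) \<bullet> axis i 1"
        by (simp add: inner_axis)
      also have "\<dots> = y (axis i 1)" by (rule inner_sum_left_Basis) (auto simp: B)
      finally show ?thesis .
    qed
    then show ?thesis by (simp add: sprod_def B prod.reindex[OF inj] ix)
  qed
  have int: "integrable (\<Pi>\<^sub>M b\<in>(Basis::(real ^ 'n) set). lborel) (\<lambda>y. \<Prod>b\<in>Basis. f (ix b) (y b))"
    by (intro product_integrable_prod f) simp
  have val: "(\<integral>y. (\<Prod>b\<in>Basis. f (ix b) (y b)) \<partial>(\<Pi>\<^sub>M b\<in>(Basis::(real ^ 'n) set). lborel)) = 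
     (\<Prod>i\<in>UNIV. \<integral>y. f i y \<partial>lborel)"
    by (subst product_integral_prod) (auto intro: f simp: B prod.reindex[OF inj] ix)
  have m: "(\<lambda>y. \<Sum>b\<in>Basis. y b *\<^sub>R b) \<in> (\<Pi>\<^sub>M b\<in>(Basis::(real ^ 'n) set). lborel) \<rightarrow>\<^sub>M (borel :: (real ^ 'n) measure)"
    by measurable
  have "has_bochner_integral lborel (sprod f) (\<Prod>i\<in>UNIV. \<integral>y. f i y \<partial>lborel)"
    unfolding has_bochner_integral_iff lborel_eq[where 'a="real ^ 'n"]
    using int val m borel_measurable_sprod[of f] fm
    by (simp add: integrable_distr_eq integral_distr comp)
  then show "has_bochner_integral lborel (sprod f) ((\<integral>y. f d y \<partial>lborel) * (\<Prod>i\<in>UNIV - {d}. \<integral>y. f i y \<partial>lborel))"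
    by (subst (asm) prod.remove[of _ d]) auto
qed

lemma hyperplane_map_measurable [measurable]:
  "(\<lambda>y. \<chi> i. if i = d then c else y i) \<in> (\<Pi>\<^sub>M i\<in>UNIV - {d::'n::finite}. lborel) \<rightarrow>\<^sub>M (borel :: (real ^ 'n) measure)"
proof (subst borel_measurable_euclidean_space, intro ballI)
  fix b :: "real ^ 'n" assume "b \<in> Basis"
  then obtain j where j: "b = axis j 1" by (auto simp: Basis_vec_def)
  show "(\<lambda>y. (\<chi> i. if i = d then c else y i) \<bullet> b) \<in> borel_measurable (\<Pi>\<^sub>M i\<in>UNIV - {d}. lborel)"
    by (cases "j = d") (auto simp: j inner_axis intro!: measurable_component_singleton)
qed

lemma sets_hyperplane_measure [simp, measurable_cong]: "sets (hyperplane_measure d c) = sets borel"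
  by (simp add: hyperplane_measure_def)

lemma space_hyperplane_measure [simp]: "space (hyperplane_measure d c) = UNIV"
  by (simp add: hyperplane_measure_def)

lemma AE_hyperplane_measure: "AE x in hyperplane_measure d c. x $ d = c"
  unfolding hyperplane_measure_def
  by (subst AE_distr_iff[OF hyperplane_map_measurable]) auto

text \<open>The unit point mass, taken on all Borel sets of the line so that it can stand beside
  \<open>lborel\<close> in the role of \<open>\<kappa>\<close>.\<close>

definition dirac :: "real \<Rightarrow> real measure" where
  "dirac c = distr (count_space {c}) borel (\<lambda>y. y)"

lemma sets_dirac [simp, measurable_cong]: "sets (dirac c) = sets borel"
  by (simp add: dirac_def)

lemma integrable_dirac:
  fixes f :: "real \<Rightarrow> real"
  shows "f \<in> borel_measurable borel \<Longrightarrow> integrable (dirac c) f"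
  by (simp add: dirac_def integrable_distr_eq integrable_count_space)

lemma integral_dirac:
  fixes f :: "real \<Rightarrow> real"
  shows "f \<in> borel_measurable borel \<Longrightarrow> (\<integral>y. f y \<partial>dirac c) = f c"
  by (simp add: dirac_def integral_distr lebesgue_integral_count_space_finite)

text \<open>The map that defines the measure freezes coordinate \<open>d\<close> at
  \<open>c\<close>; the factor \<open>f d c\<close> leaves the integral, and Fubini's theorem
  applies to the other coordinates.\<close>

lemma integrates_products_hyperplane:
  "integrates_products (hyperplane_measure (d :: 'n::finite) c) d (dirac c)"
  unfolding integrates_products_def
proof (intro allI impI)
  fix f :: "'n \<Rightarrow> real \<Rightarrow> real"
  assume f: "\<forall>i. i \<noteq> d \<longrightarrow> integrable lborel (f i)" and fd: "integrable (dirac c) (f d)"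
  have fm: "f i \<in> borel_measurable borel" for i
  proof (cases "i = d")
    case True
    then show ?thesis using borel_measurable_integrable[OF fd] by (simp cong: measurable_cong_sets)
  next
    case False
    then show ?thesis using f borel_measurable_integrable[of lborel "f i"] by auto
  qed
  interpret product_sigma_finite "\<lambda>_::'n. lborel :: real measure"
    by (rule product_sigma_finite.intro) (rule sigma_finite_lborel)
  have comp: "sprod f (\<chi> i. if i = d then c else y i) = f d c * (\<Prod>i\<in>UNIV - {d}. f i (y i))" for y
    by (subst sprod_split[of _ _ d]) auto
  have int: "integrable (\<Pi>\<^sub>M i\<in>UNIV - {d}. lborel) (\<lambda>y. \<Prod>i\<in>UNIV - {d}. f i (y i))"
    using f by (intro product_integrable_prod) auto
  have val: "(\<integral>y. (\<Prod>i\<in>UNIV - {d}. f i (y i)) \<partial>(\<Pi>\<^sub>M i\<in>UNIV - {d}. lborel)) = 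
     (\<Prod>i\<in>UNIV - {d}. \<integral>y. f i y \<partial>lborel)"
    using f by (intro product_integral_prod) auto
  show "has_bochner_integral (hyperplane_measure d c) (sprod f)
     ((\<integral>y. f d y \<partial>dirac c) * (\<Prod>i\<in>UNIV - {d}. \<integral>y. f i y \<partial>lborel))"
    unfolding has_bochner_integral_iff hyperplane_measure_def
    using int val hyperplane_map_measurable[of d c] borel_measurable_sprod[of f] fm
    by (simp add: integrable_distr_eq integral_distr comp integral_dirac)
qed

text \<open>Expand the square. Distinct indices differ in some coordinate
  \<open>i \<noteq> d\<close>, where the one-dimensional integral vanishes, so only the diagonal
  survives. The factors \<open>g m\<close> in direction \<open>d\<close> may be correlated; the
  tangential factors alone remove the mixed terms.\<close>

lemma orthogonal_product_sum:
  fixes e :: "'n::finite \<Rightarrow> nat \<Rightarrow> real \<Rightarrow> real" and g :: "('n \<Rightarrow> nat) \<Rightarrow> real \<Rightarrow> real"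
  assumes ip: "integrates_products \<mu> d \<kappa>"
    and M: "M = (\<Pi>\<^sub>E i\<in>UNIV - {d}. A)" and "finite A"
    and orth: "\<And>i m m'. i \<noteq> d \<Longrightarrow> m \<in> A \<Longrightarrow> m' \<in> A \<Longrightarrow>
        has_bochner_integral lborel (\<lambda>y. e i m y * e i m' y) (if m = m' then B else 0)"
    and g: "\<And>m m'. m \<in> M \<Longrightarrow> m' \<in> M \<Longrightarrow> integrable \<kappa> (\<lambda>y. g m y * g m' y)"
  shows "has_bochner_integral \<mu> (\<lambda>x. (\<Sum>m\<in>M. sprod (\<lambda>i. if i = d then g m else e i (m i)) x)\<^sup>2)
      (\<Sum>m\<in>M. (\<integral>y. (g m y)\<^sup>2 \<partial>\<kappa>) * B ^ card (UNIV - {d}))"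
proof -
  define Q where "Q m = sprod (\<lambda>i. if i = d then g m else e i (m i))" for m
  have finM: "finite M" unfolding M using \<open>finite A\<close> by (intro finite_PiE) auto
  have pair: "has_bochner_integral \<mu> (\<lambda>x. Q m x * Q m' x)
      (if m' = m then (\<integral>y. (g m y)\<^sup>2 \<partial>\<kappa>) * B ^ card (UNIV - {d}) else 0)"
    if m: "m \<in> M" "m' \<in> M" for m m'
  proof -
    define q where "q i y = (if i = d then g m y * g m' y else e i (m i) y * e i (m' i) y)" for i y
    have o: "has_bochner_integral lborel (q i) (if m i = m' i then B else 0)" if "i \<noteq> d" for i
    proof -
      have "q i = (\<lambda>y. e i (m i) y * e i (m' i) y)" using that by (simp add: q_def fun_eq_iff)
      then show ?thesis using orth[of i "m i" "m' i"] m that by (auto simp: M PiE_def Pi_def)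
    qed
    have "has_bochner_integral \<mu> (sprod q)
        ((\<integral>y. q d y \<partial>\<kappa>) * (\<Prod>i\<in>UNIV - {d}. \<integral>y. q i y \<partial>lborel))"
    proof -
      have "q d = (\<lambda>y. g m y * g m' y)" by (simp add: q_def fun_eq_iff)
      then have "integrable \<kappa> (q d)" using g[OF m] by simp
      then show ?thesis
        using ip o unfolding integrates_products_def has_bochner_integral_iff by blast
    qed
    moreover have "(\<Prod>i\<in>UNIV - {d}. \<integral>y. q i y \<partial>lborel) = (\<Prod>i\<in>UNIV - {d}. if m i = m' i then B else 0)"
      using o by (intro prod.cong) (auto simp: has_bochner_integral_iff)
    moreover have "(\<Prod>i\<in>UNIV - {d}. if m i = m' i then B else 0) = 
        (if m' = m then B ^ card (UNIV - {d}) else 0)"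
    proof (cases "m = m'")
      case False
      \<comment> \<open>Members of \<open>M\<close> are extensional, hence equal as soon as they
        agree off \<open>d\<close>.\<close>
      then obtain i where "i \<in> UNIV - {d}" "m i \<noteq> m' i"
        using m PiE_ext[of m "UNIV - {d}" "\<lambda>_. A" m'] unfolding M by blast
      then show ?thesis using False by (auto intro!: prod_zero)
    qed simp
    moreover have "(\<integral>y. q d y \<partial>\<kappa>) = (\<integral>y. g m y * g m' y \<partial>\<kappa>)"
      by (simp add: q_def)
    moreover have "sprod q = (\<lambda>x. Q m x * Q m' x)"
      unfolding Q_def sprod_mult by (auto simp: q_def sprod_def fun_eq_iff intro!: prod.cong)
    ultimately show ?thesis
      by (cases "m' = m") (simp_all add: power2_eq_square)
  qed
  have "has_bochner_integral \<mu> (\<lambda>x. \<Sum>m\<in>M. \<Sum>m'\<in>M. Q m x * Q m' x)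
     (\<Sum>m\<in>M. \<Sum>m'\<in>M. if m' = m then (\<integral>y. (g m y)\<^sup>2 \<partial>\<kappa>) * B ^ card (UNIV - {d}) else 0)"
    by (intro has_bochner_integral_sum pair)
  then show ?thesis
    using finM by (simp add: Q_def power2_eq_square sum_product)
qed

text \<open>The product-to-sum formulas leave cosines of frequencies \<open>a = (m - m')/N\<close>
  and \<open>b = (m + m')/N\<close>. At the ends of the interval their arguments are integer
  multiples of \<open>pi\<close>, so the sines in the antiderivative vanish there. Positive indices
  keep \<open>b\<close> away from 0.\<close>

lemma trig_orthogonal:
  fixes N m m' :: nat
  assumes s: "s = cos \<or> s = (sin :: real \<Rightarrow> real)" and N: "N > 0" and m: "m > 0" "m' > 0"
  defines "e \<equiv> \<lambda>m y. indicator {- (pi * real N)..pi * real N} y * s (real m * y / real N)"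
  shows "has_bochner_integral lborel (\<lambda>y. e m y * e m' y) (if m = m' then pi * real N else 0)"
proof -
  define a b where "a = (real m - real m') / real N" and "b = (real m + real m') / real N"
  define R where "R = pi * real N"
  \<comment> \<open>The product of two cosines is half the sum, that of two sines half the
    difference, of the cosines of the difference and of the sum of the arguments.\<close>
  define sg where "sg = (if s = cos then 1 else - 1 :: real)"
  have R: "R > 0" using N by (simp add: R_def)
  have b: "b > 0" using m N by (simp add: b_def)
  \<comment> \<open>For \<open>a = 0\<close> the integrand \<open>cos (a * y)\<close> is 1, with
    antiderivative \<open>y\<close>; the other formula would give 0, as division by 0 does.\<close>
  define F where "F y = ((if a = 0 then y else sin (a * y) / a) + sg * (sin (b * y) / b)) / 2" for y
  have ne: "cos \<noteq> (sin :: real \<Rightarrow> real)"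
    by (metis cos_zero sin_zero zero_neq_one)
  have prod: "s (real m * y / real N) * s (real m' * y / real N) = (cos (a * y) + sg * cos (b * y)) / 2" for y
  proof -
    have "a * y = real m * y / real N - real m' * y / real N" "b * y = real m * y / real N + real m' * y / real N"
      by (simp_all add: a_def b_def add_divide_distrib diff_divide_distrib ring_distribs)
    then show ?thesis using s ne by (auto simp: sg_def cos_times_cos sin_times_sin)
  qed
  have "has_bochner_integral lborel (\<lambda>y. indicator {- R..R} y *\<^sub>R ((cos (a * y) + sg * cos (b * y)) / 2)) (F R - F (- R))"
  proof (rule has_bochner_integral_FTC_Icc)
    show "(F has_vector_derivative (cos (a * y) + sg * cos (b * y)) / 2) (at y within {- R..R})" for y
      unfolding F_def has_real_derivative_iff_has_vector_derivative[symmetric] using b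
      by (cases "a = 0") (auto intro!: derivative_eq_intros)
  qed (use R in \<open>auto intro!: continuous_intros\<close>)
  moreover have "indicator {- R..R} y *\<^sub>R ((cos (a * y) + sg * cos (b * y)) / 2) = e m y * e m' y" for y
    by (simp add: prod[symmetric] e_def R_def indicator_def)
  moreover have "F R - F (- R) = (if m = m' then pi * real N else 0)"
  proof -
    have "b * R = real (m + m') * pi" using N by (simp add: b_def R_def)
    then have sb: "sin (b * R) = 0" by (simp only: sin_npi)
    have "a * R = of_int (int m - int m') * pi" using N by (simp add: a_def R_def)
    then have sa: "sin (a * R) = 0"
      by (simp only: sin_zero_iff_int2) blast
    have "a = 0 \<longleftrightarrow> m = m'" using N by (simp add: a_def)
    then show ?thesis using sa sb by (simp add: F_def R_def[symmetric])
  qed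
  ultimately show ?thesis by simp
qed

section \<open>Eigenmodes of the adjoint problem\<close>

text \<open>The product rule, with the differentiated factor written as an update of the family
  \<open>q\<close>. Partial derivatives of product functions are thus product functions
  again.\<close>

lemma sprod_has_derivative:
  assumes "\<And>i. (q i has_real_derivative q' i (x $ i)) (at (x $ i))"
  shows "(sprod q has_derivative (\<lambda>h. \<Sum>i\<in>UNIV. sprod (q(i := q' i)) x * h $ i)) (at x)"
proof -
  have "((\<lambda>x. q i (x $ i)) has_derivative (\<lambda>h. q' i (x $ i) * h $ i)) (at x)" for i
    using assms[of i, unfolded has_field_derivative_def]
    by (rule has_derivative_compose[OF bounded_linear_imp_has_derivative[OF bounded_linear_vec_nth]])
  then have "((\<lambda>x. \<Prod>i\<in>UNIV. q i (x $ i)) has_derivative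
      (\<lambda>h. \<Sum>i\<in>UNIV. q' i (x $ i) * h $ i * (\<Prod>j\<in>UNIV - {i}. q j (x $ j)))) (at x)"
    by (intro has_derivative_prod)
  moreover have "sprod (q(i := q' i)) x = q' i (x $ i) * (\<Prod>j\<in>UNIV - {i}. q j (x $ j))" for i
    by (subst sprod_split[of _ _ i]) auto
  ultimately show ?thesis by (simp add: sprod_def[abs_def] mult_ac)
qed

lemma sum_sprod_has_derivative:
  assumes "\<And>m i. m \<in> A \<Longrightarrow> smooth (q m i)"
  shows "((\<lambda>x. \<Sum>m\<in>A. c m * sprod (q m) x) has_derivative
    (\<lambda>h. \<Sum>i\<in>UNIV. (\<Sum>m\<in>A. c m * sprod ((q m)(i := deriv (q m i))) x) * h $ i)) (at x)"
proof -
  have "((\<lambda>x. \<Sum>m\<in>A. c m * sprod (q m) x) has_derivative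
    (\<lambda>h. \<Sum>m\<in>A. c m * (\<Sum>i\<in>UNIV. sprod ((q m)(i := deriv (q m i))) x * h $ i))) (at x)"
    using assms
    by (intro has_derivative_sum has_derivative_mult_right sprod_has_derivative smooth_has_deriv)
  moreover have "(\<Sum>m\<in>A. c m * (\<Sum>i\<in>UNIV. sprod ((q m)(i := deriv (q m i))) x * h $ i)) =
      (\<Sum>i\<in>UNIV. (\<Sum>m\<in>A. c m * sprod ((q m)(i := deriv (q m i))) x) * h $ i)" for h
    by (simp add: sum_distrib_left sum_distrib_right mult.assoc) (rule sum.swap)
  ultimately show ?thesis by simp
qed

lemma partial_sum_sprod:
  assumes "\<And>m i. m \<in> A \<Longrightarrow> smooth (q m i)"
  shows "partial j (\<lambda>x. \<Sum>m\<in>A. c m * sprod (q m) x) =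
    (\<lambda>x. \<Sum>m\<in>A. c m * sprod ((q m)(j := deriv (q m j))) x)"
  unfolding partial_def
  by (auto simp: frechet_derivative_eq[OF sum_sprod_has_derivative[OF assms]] axis_def
      if_distrib sum.delta fun_eq_iff cong: if_cong)

lemma partial2_sum_sprod:
  assumes "\<And>m i. m \<in> A \<Longrightarrow> smooth (q m i)"
  shows "partial j (partial j (\<lambda>x. \<Sum>m\<in>A. c m * sprod (q m) x)) =
    (\<lambda>x. \<Sum>m\<in>A. c m * sprod ((q m)(j := deriv (deriv (q m j)))) x)"
proof -
  have s: "smooth (((q m)(j := deriv (q m j))) i)" if "m \<in> A" for m i
    using assms[OF that] by (auto intro: smooth_deriv)
  have "partial j (\<lambda>x. \<Sum>m\<in>A. c m * sprod (q m) x) =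
      (\<lambda>x. \<Sum>m\<in>A. c m * sprod ((q m)(j := deriv (q m j))) x)"
    by (rule partial_sum_sprod[OF assms])
  then show ?thesis
    using partial_sum_sprod[of A "\<lambda>m. (q m)(j := deriv (q m j))" j c, OF s] by simp
qed

lemma normal_deriv_sum_sprod:
  assumes "\<And>m i. m \<in> A \<Longrightarrow> smooth (q m i)"
  shows "normal_deriv d (\<lambda>x. \<Sum>m\<in>A. c m * sprod (q m) x) x =
    (if x $ d = 0 then 1 else -1) * partial d (\<lambda>x. \<Sum>m\<in>A. c m * sprod (q m) x) x"
  unfolding partial_def normal_deriv_def outward_normal_def
  by (auto simp: frechet_derivative_eq[OF sum_sprod_has_derivative[OF assms]] sum_negf)

section \<open>Square integrability of products of compactly supported functions\<close>

definition cont_cs :: "(real \<Rightarrow> real) \<Rightarrow> bool" where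
  "cont_cs q \<longleftrightarrow> continuous_on UNIV q \<and> (\<exists>R. \<forall>y. \<bar>y\<bar> > R \<longrightarrow> q y = 0)"

lemma cont_cs_integrable_power2:
  assumes "cont_cs q"
  shows "integrable lborel (\<lambda>y. (q y)\<^sup>2)"
proof -
  obtain R where R: "\<And>y. \<bar>y\<bar> > R \<Longrightarrow> q y = 0" using assms by (auto simp: cont_cs_def)
  have "integrable lborel (\<lambda>y. indicator {- R..R} y *\<^sub>R (q y)\<^sup>2)"
    using assms continuous_on_subset[of UNIV q "{- R..R}"] unfolding cont_cs_def
    by (intro borel_integrable_compact continuous_on_power) auto
  moreover have "indicator {- R..R} y *\<^sub>R (q y)\<^sup>2 = (q y)\<^sup>2" for y
    using R[of y] by (cases "\<bar>y\<bar> > R") (auto simp: indicator_def)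
  ultimately show ?thesis by (simp only:)
qed

lemma cont_cs_measurable: "cont_cs q \<Longrightarrow> q \<in> borel_measurable borel"
  by (auto simp: cont_cs_def intro: borel_measurable_continuous_onI)

lemma in_L2_sprod_of_integrates:
  assumes "integrates_products \<mu> d \<kappa>" "sets \<mu> = sets borel"
    and "\<And>i. q i \<in> borel_measurable borel"
    and "\<And>i. i \<noteq> d \<Longrightarrow> integrable lborel (\<lambda>y. (q i y)\<^sup>2)"
    and "integrable \<kappa> (\<lambda>y. (q d y)\<^sup>2)"
  shows "in_L2 \<mu> (sprod q)"
proof -
  have "has_bochner_integral \<mu> (sprod (\<lambda>i y. (q i y)\<^sup>2))
      ((\<integral>y. (q d y)\<^sup>2 \<partial>\<kappa>) * (\<Prod>i\<in>UNIV - {d}. \<integral>y. (q i y)\<^sup>2 \<partial>lborel))"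
    using assms(1)[unfolded integrates_products_def, rule_format, of "\<lambda>i y. (q i y)\<^sup>2"] assms(4,5)
    by simp
  moreover have "sprod (\<lambda>i y. (q i y)\<^sup>2) = (\<lambda>x. (sprod q x)\<^sup>2)"
    by (simp add: sprod_def fun_eq_iff prod_power_distrib)
  ultimately show ?thesis
    using borel_measurable_sprod[of q] assms(3) unfolding in_L2_def has_bochner_integral_iff
    by (simp cong: measurable_cong_sets[OF assms(2) refl])
qed

lemma strip_in_sets [measurable]: "strip d L \<in> sets borel"
  unfolding strip_def by measurable

lemma space_strip_measure [simp]: "space (strip_measure d L) = strip d L"
  by (simp add: strip_measure_def space_restrict_space)

lemma in_L2_strip: "in_L2 lborel f \<Longrightarrow> in_L2 (strip_measure d L) f"
  using integrable_mult_indicator[of "strip d L" lborel "\<lambda>x. (f x)\<^sup>2"]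
  by (auto simp: in_L2_def strip_measure_def integrable_restrict_space intro!: measurable_restrict_space1)

lemma L2_norm_strip_le:
  assumes "in_L2 lborel f"
  shows "L2_norm (strip_measure d L) f \<le> L2_norm lborel f"
proof -
  have "(\<integral>x. (f x)\<^sup>2 \<partial>strip_measure d L) = (\<integral>x. indicator (strip d L) x *\<^sub>R (f x)\<^sup>2 \<partial>lborel)"
    by (simp add: strip_measure_def integral_restrict_space)
  also have "\<dots> \<le> (\<integral>x. (f x)\<^sup>2 \<partial>lborel)"
    using assms integrable_mult_indicator[of "strip d L" lborel "\<lambda>x. (f x)\<^sup>2"]
    by (intro integral_mono) (auto simp: in_L2_def indicator_def)
  finally show ?thesis by (simp add: L2_norm_def)
qed

lemma in_L2_sprod_cont_cs:
  assumes "\<And>i. cont_cs (q i)"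
  shows "in_L2 (hyperplane_measure d c) (sprod q)" "in_L2 (strip_measure d L) (sprod q)"
proof -
  show "in_L2 (hyperplane_measure d c) (sprod q)"
    using assms
    by (intro in_L2_sprod_of_integrates[OF integrates_products_hyperplane] integrable_dirac cont_cs_integrable_power2)
       (auto intro: cont_cs_measurable borel_measurable_power)
  show "in_L2 (strip_measure d L) (sprod q)"
    using assms
    by (intro in_L2_strip in_L2_sprod_of_integrates[OF integrates_products_lborel[of d]] cont_cs_integrable_power2)
       (auto intro: cont_cs_measurable)
qed

lemma in_L2_sum_sprod_cont_cs:
  assumes "\<And>m i. m \<in> A \<Longrightarrow> cont_cs (q m i)"
  shows "in_L2 (hyperplane_measure d c) (\<lambda>x. \<Sum>m\<in>A. a m * sprod (q m) x)"
    "in_L2 (strip_measure d L) (\<lambda>x. \<Sum>m\<in>A. a m * sprod (q m) x)"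
  using assms by (auto intro!: in_L2_sum in_L2_cmult in_L2_sprod_cont_cs)

lemma deriv_eq_0_outside:
  fixes q :: "real \<Rightarrow> real"
  assumes R: "\<And>y. \<bar>y\<bar> > R \<Longrightarrow> q y = 0" and y: "\<bar>y\<bar> > R"
  shows "deriv q y = 0"
proof -
  have "open {y. \<bar>y\<bar> > R}" by (intro open_Collect_less continuous_intros)
  then have "eventually (\<lambda>y. q y = 0) (nhds y)"
    using y R by (auto simp: eventually_nhds intro!: exI[of _ "{y. \<bar>y\<bar> > R}"])
  then have "deriv q y = deriv (\<lambda>_. 0) y" by (intro deriv_cong_ev) auto
  then show ?thesis by simp
qed

lemma cont_cs_deriv:
  assumes "smooth q" "cont_cs q"
  shows "cont_cs (deriv q)"
proof -
  obtain R where R: "\<And>y. \<bar>y\<bar> > R \<Longrightarrow> q y = 0" using assms by (auto simp: cont_cs_def)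
  then have "deriv q y = 0" if "\<bar>y\<bar> > R" for y
    using that by (rule deriv_eq_0_outside)
  then show ?thesis using assms smooth_continuous[OF smooth_deriv] by (auto simp: cont_cs_def)
qed

text \<open>One choice of parameters for the modes cut off at scale \<open>N\<close>. The last
  assumption contains the equation that the boundary conditions impose on \<open>k\<close>,
  multiplied by the cosine. The constant \<open>c\<^sub>0\<close> bounds the denominators in
  \<open>w\<close> from below, uniformly over the modes.\<close>

locale modes =
  fixes d :: "'n::finite" and L T \<epsilon> c\<^sub>0 :: real and N :: nat and \<eta> :: "real \<Rightarrow> real"
    and k :: "('n \<Rightarrow> nat) \<Rightarrow> real"
  assumes L: "L > 0" and T: "T > 0" and eps: "\<epsilon> > 0" and N: "N > 0"
    and eta: "smooth \<eta>" "\<And>y. 0 \<le> \<eta> y" "\<And>y. \<eta> y \<le> 1"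
      "\<And>y. \<bar>y\<bar> \<le> 1 \<Longrightarrow> \<eta> y = 1" "\<And>y. 2 \<le> \<bar>y\<bar> \<Longrightarrow> \<eta> y = 0"
    and c0: "c\<^sub>0 > 0"
    and k: "\<And>m. m \<in> (\<Pi>\<^sub>E i\<in>UNIV - {d}. {1..N}) \<Longrightarrow> 0 \<le> k m \<and> k m \<le> pi / L \<and> c\<^sub>0 \<le> cos (k m * L / 2) \<and>
      \<epsilon> * k m * sin (k m * L / 2) =
        (1 / 4 - \<epsilon>\<^sup>2 * (\<Sum>i\<in>UNIV - {d}. (real (m i) / real N)\<^sup>2) - \<epsilon>\<^sup>2 * (k m)\<^sup>2) * cos (k m * L / 2)"
begin

section \<open>The cut-off modes as a test function\<close>

definition "M = (\<Pi>\<^sub>E i\<in>UNIV - {d}. {1..N})"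

definition "p = card (UNIV - {d})"

definition freq :: "('n \<Rightarrow> nat) \<Rightarrow> real" where
  "freq m = (\<Sum>i\<in>UNIV - {d}. (real (m i) / real N)\<^sup>2)"

definition lam :: "('n \<Rightarrow> nat) \<Rightarrow> real" where
  "lam m = 1 / (4 * \<epsilon>) + \<epsilon> * (k m)\<^sup>2 + \<epsilon> * freq m"

text \<open>The vanishing summands in \<open>w\<close> and \<open>fac\<close> put them syntactically in the family of lemma
  \<open>smooth_exp_trig\<close>.\<close>

definition w :: "('n \<Rightarrow> nat) \<Rightarrow> real \<Rightarrow> real" where
  "w m y = exp (- 1 / (2 * \<epsilon>) * y) * (1 / cos (k m * L / 2) * cos (k m * y + k m * L / 2)
     + 0 * sin (k m * y + k m * L / 2))"

definition w1 :: "('n \<Rightarrow> nat) \<Rightarrow> real \<Rightarrow> real" where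
  "w1 m y = exp (- 1 / (2 * \<epsilon>) * y) * (- 1 / (2 * \<epsilon>) * cos (k m * y + k m * L / 2)
     - k m * sin (k m * y + k m * L / 2)) / cos (k m * L / 2)"

text \<open>A cut-off equal to 1 near \<open>[-L, 0]\<close> and near \<open>[0, T]\<close>, used
  both in time and in the normal variable. It gives \<open>\<psi>\<close> compact support without
  changing the equations on \<open>[0, T]\<close> and the closed strip.\<close>

definition \<theta> :: "real \<Rightarrow> real" where "\<theta> y = \<eta> (1 / (L + T + 1) * y + 0)"

definition fac :: "('n \<Rightarrow> nat) \<Rightarrow> 'n \<Rightarrow> real \<Rightarrow> real" where
  "fac m i y = (if i = d then \<theta> y * w m y
     else \<eta> (1 / real N * y + 0) * (exp (0 * y) * (1 * cos (real (m i) / real N * y + 0)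
        + 0 * sin (real (m i) / real N * y + 0))))"

definition \<psi> :: "real \<times> (real ^ 'n) \<Rightarrow> real" where
  "\<psi> = (\<lambda>(t, x). \<Sum>m\<in>M. (\<theta> t * exp (lam m * t)) * sprod (fac m) x)"

lemma card_M: "card M = N ^ p"
  unfolding M_def p_def by (simp add: card_PiE)

lemma M_D: "m \<in> M \<Longrightarrow> i \<noteq> d \<Longrightarrow> 1 \<le> m i \<and> m i \<le> N"
  by (auto simp: M_def PiE_def Pi_def)

lemma k_D:
  assumes "m \<in> M"
  shows "0 \<le> k m" "k m \<le> pi / L" "c\<^sub>0 \<le> cos (k m * L / 2)" "cos (k m * L / 2) > 0"
    "\<epsilon> * k m * sin (k m * L / 2) = (1 / 4 - \<epsilon>\<^sup>2 * freq m - \<epsilon>\<^sup>2 * (k m)\<^sup>2) * cos (k m * L / 2)"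
  using k[of m] assms c0 unfolding M_def freq_def by auto

lemma smooth_\<theta>: "smooth \<theta>"
  unfolding \<theta>_def by (intro smooth_shift eta)

lemma smooth_w: "smooth (w m)"
  unfolding w_def by (rule smooth_exp_trig)

lemma smooth_fac: "smooth (fac m i)"
proof (cases "i = d")
  case True
  then show ?thesis
    unfolding fac_def by (simp only: if_True simp_thms) (intro smooth_mult smooth_\<theta> smooth_w)
next
  case False
  then show ?thesis
    unfolding fac_def
    by (simp only: if_False simp_thms) (rule smooth_mult[OF smooth_shift[OF eta(1)] smooth_exp_trig])
qed

lemma \<theta>_eq_1: "\<bar>y\<bar> \<le> L + T + 1 \<Longrightarrow> \<theta> y = 1"
  unfolding \<theta>_def using L T by (intro eta) (auto simp: field_simps abs_mult)

lemma \<theta>_eq_0: "\<bar>y\<bar> \<ge> 2 * (L + T + 1) \<Longrightarrow> \<theta> y = 0"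
  unfolding \<theta>_def using L T by (intro eta) (auto simp: field_simps abs_mult)

lemma fac_eq: "i \<noteq> d \<Longrightarrow> fac m i y = \<eta> (y / real N) * cos (real (m i) * y / real N)"
  by (simp add: fac_def)

lemma fac_eq_0: "\<bar>y\<bar> > 2 * (L + T + 1) + 2 * real N \<Longrightarrow> fac m i y = 0"
  using \<theta>_eq_0[of y] eta(5)[of "y / real N"] N L T by (auto simp: fac_def field_simps)

lemma cont_cs_fac: "cont_cs (fac m i)"
  unfolding cont_cs_def using smooth_continuous[OF smooth_fac] fac_eq_0 by blast

lemma test_function_\<psi>: "test_function \<psi>"
proof -
  \<comment> \<open>The exponential is put into the form of \<open>smooth_exp_trig\<close>.\<close>
  have "\<theta> t * exp (lam m * t) = \<theta> t * (exp (lam m * t) * (1 * cos (0 * t + 0) + 0 * sin (0 * t + 0)))" for m t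
    by simp
  then have s: "smooth (\<lambda>t. \<theta> t * exp (lam m * t))" for m
    by (simp only:) (intro smooth_mult smooth_\<theta> smooth_exp_trig)
  have "smooth (\<lambda>q::real \<times> (real ^ 'n). (\<lambda>t. \<theta> t * exp (lam m * t)) (fst q + 0) * (\<Prod>i\<in>UNIV. fac m i (snd q $ i + 0)))" for m
    by (intro smooth_mult smooth_prod smooth_compose_affine s smooth_fac bounded_linear_fst
        bounded_linear_compose[OF bounded_linear_vec_nth bounded_linear_snd])
  then have "smooth (\<lambda>q. \<Sum>m\<in>M. (\<theta> (fst q) * exp (lam m * fst q)) * sprod (fac m) (snd q))"
    by (intro smooth_sum) (simp add: sprod_def)
  then have "smooth \<psi>"
    by (simp add: \<psi>_def case_prod_unfold)
  moreover have "\<exists>K. compact K \<and> (\<forall>q. q \<notin> K \<longrightarrow> \<psi> q = 0)"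
  proof -
    define R where "R = 2 * (L + T + 1) + 2 * real N"
    define K where "K = {- R..R} \<times> cbox (\<chi> i. - R) (\<chi> i::'n. R)"
    have "compact K" unfolding K_def by (intro compact_Times compact_cbox compact_Icc)
    moreover have "\<psi> q = 0" if "q \<notin> K" for q
    proof -
      obtain t x where q: "q = (t, x)" by (cases q)
      have "\<bar>t\<bar> > R \<or> (\<exists>i. \<bar>x $ i\<bar> > R)"
        using that by (auto simp: q K_def mem_box_cart not_le abs_le_iff not_less) (smt (verit))+
      then show ?thesis
      proof
        assume "\<bar>t\<bar> > R"
        then have "\<theta> t = 0" by (intro \<theta>_eq_0) (simp add: R_def)
        then show ?thesis by (simp add: q \<psi>_def)
      next
        assume "\<exists>i. \<bar>x $ i\<bar> > R"
        then have "sprod (fac m) x = 0" for m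
          using fac_eq_0 by (auto simp: sprod_def R_def intro!: prod_zero)
        then show ?thesis by (simp add: q \<psi>_def)
      qed
    qed
    ultimately show ?thesis by blast
  qed
  ultimately show ?thesis by (simp add: test_function_def smooth_def)
qed

text \<open>By the strict inequality \<open>\<theta>\<close> is 1 in a whole neighbourhood of
  \<open>y\<close>, hence invisible to derivatives at \<open>y\<close>.\<close>

lemma deriv_\<theta>_mult: "\<bar>y\<bar> < L + T + 1 \<Longrightarrow> deriv (\<lambda>y. \<theta> y * g y) y = deriv g y"
proof (rule deriv_cong_ev)
  assume y: "\<bar>y\<bar> < L + T + 1"
  have "open {y. \<bar>y\<bar> < L + T + 1}" by (intro open_Collect_less continuous_intros)
  then show "eventually (\<lambda>y. \<theta> y * g y = g y) (nhds y)"
    using y \<theta>_eq_1 by (auto simp: eventually_nhds intro!: exI[of _ "{y. \<bar>y\<bar> < L + T + 1}"])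
qed auto

lemma deriv2_\<theta>_mult:
  assumes "\<bar>y\<bar> < L + T + 1"
  shows "deriv (deriv (\<lambda>y. \<theta> y * g y)) y = deriv (deriv g) y"
proof (rule deriv_cong_ev)
  have "open {y. \<bar>y\<bar> < L + T + 1}" by (intro open_Collect_less continuous_intros)
  then show "eventually (\<lambda>y. deriv (\<lambda>y. \<theta> y * g y) y = deriv g y) (nhds y)"
    using assms deriv_\<theta>_mult by (auto simp: eventually_nhds intro!: exI[of _ "{y. \<bar>y\<bar> < L + T + 1}"])
qed auto

section \<open>The equation in the normal variable and the boundary conditions\<close>

lemma w_DERIV: "(w m has_real_derivative w1 m y) (at y)"
proof -
  define a where "a = - 1 / (2 * \<epsilon>)"
  define c where "c = 1 / cos (k m * L / 2)"
  have w: "w m = (\<lambda>y. exp (a * y) * (c * cos (k m * y + k m * L / 2)))"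
    by (simp add: w_def[abs_def] a_def c_def)
  have w1: "w1 m y = exp (a * y) * (a * cos (k m * y + k m * L / 2) - k m * sin (k m * y + k m * L / 2)) * c"
    by (simp add: w1_def a_def c_def)
  show ?thesis
    unfolding w w1 by (auto intro!: derivative_eq_intros simp: algebra_simps)
qed

text \<open>\<open>w m\<close> combines exponentials with exponents
  \<open>-1/(2 \<epsilon>) + i k\<close> and \<open>-1/(2 \<epsilon>) - i k\<close>, the roots of
  \<open>\<epsilon> r^2 + r + \<epsilon> k^2 + 1/(4 \<epsilon>)\<close>. It therefore solves the
  corresponding second-order equation, which is written here solved for the second
  derivative.\<close>

lemma w1_DERIV: "(w1 m has_real_derivative (- w1 m y - (\<epsilon> * (k m)\<^sup>2 + 1 / (4 * \<epsilon>)) * w m y) / \<epsilon>) (at y)"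
proof -
  define a where "a = - 1 / (2 * \<epsilon>)"
  define c where "c = 1 / cos (k m * L / 2)"
  have w1: "w1 m = (\<lambda>y. exp (a * y) * (a * cos (k m * y + k m * L / 2) - k m * sin (k m * y + k m * L / 2)) * c)"
    by (simp add: w1_def[abs_def] a_def c_def)
  have w: "w m y = exp (a * y) * (c * cos (k m * y + k m * L / 2))"
    by (simp add: w_def a_def c_def)
  have e: "1 / \<epsilon> = - 2 * a" "1 / (4 * \<epsilon>) / \<epsilon> = a\<^sup>2"
    using eps by (auto simp: a_def power2_eq_square field_simps)
  have "(- w1 m y - (\<epsilon> * (k m)\<^sup>2 + 1 / (4 * \<epsilon>)) * w m y) / \<epsilon> =
      - w1 m y * (1 / \<epsilon>) - ((k m)\<^sup>2 + 1 / (4 * \<epsilon>) / \<epsilon>) * w m y"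
    using eps by (simp add: field_simps)
  also have "\<dots> = - w1 m y * (- 2 * a) - ((k m)\<^sup>2 + a\<^sup>2) * w m y"
    unfolding e ..
  also have "\<dots> = exp (a * y) * ((a\<^sup>2 - (k m)\<^sup>2) * cos (k m * y + k m * L / 2)
      - 2 * a * k m * sin (k m * y + k m * L / 2)) * c"
    unfolding w1 w by (simp add: algebra_simps power2_eq_square)
  finally have eq: "(- w1 m y - (\<epsilon> * (k m)\<^sup>2 + 1 / (4 * \<epsilon>)) * w m y) / \<epsilon> = \<dots>" .
  show ?thesis
    unfolding eq unfolding w1 by (auto intro!: derivative_eq_intros simp: algebra_simps power2_eq_square)
qed

lemma deriv_w: "deriv (w m) = w1 m"
  using w_DERIV by (auto intro!: ext DERIV_imp_deriv)

lemma fac_d: "fac m d = (\<lambda>y. \<theta> y * w m y)"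
  by (simp add: fac_def fun_eq_iff)

text \<open>Near \<open>[-L, 0]\<close> the cut-off \<open>\<theta>\<close> is 1, so the equation of
  \<open>w m\<close> carries over; the coefficient on the right comes from the definition of
  \<open>lam\<close>.\<close>

lemma fac_d_equation:
  assumes "m \<in> M" "- L \<le> y" "y \<le> 0"
  shows "fac m d y = w m y" "deriv (fac m d) y = w1 m y"
    "\<epsilon> * deriv (deriv (fac m d)) y + deriv (fac m d) y = (\<epsilon> * freq m - lam m) * fac m d y"
proof -
  have y: "\<bar>y\<bar> < L + T + 1" using assms T L by auto
  show 1: "fac m d y = w m y" using y by (simp add: fac_d \<theta>_eq_1)
  show 2: "deriv (fac m d) y = w1 m y" using y by (simp add: fac_d deriv_\<theta>_mult deriv_w)
  have "deriv (deriv (fac m d)) y = (- w1 m y - (\<epsilon> * (k m)\<^sup>2 + 1 / (4 * \<epsilon>)) * w m y) / \<epsilon>"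
    unfolding fac_d deriv2_\<theta>_mult[OF y] deriv_w by (intro DERIV_imp_deriv w1_DERIV)
  then show "\<epsilon> * deriv (deriv (fac m d)) y + deriv (fac m d) y = (\<epsilon> * freq m - lam m) * fac m d y"
    using eps unfolding 1 2 lam_def by (simp add: field_simps)
qed

text \<open>The cosine in \<open>w m\<close> is even about the midpoint of \<open>[-L, 0]\<close>,
  so the terms with \<open>tan (k L / 2)\<close> in the logarithmic derivatives at the two ends have
  opposite signs. This turns both boundary conditions into one and the same equation, the one
  assumed for \<open>k m\<close>.\<close>

lemma w_boundary:
  assumes "m \<in> M"
  shows "w m 0 = 1" "w m (- L) = exp (L / (2 * \<epsilon>))"
    "\<epsilon> * lam m * w m 0 - \<epsilon> * w1 m 0 - w m 0 = 0"
    "lam m * w m (- L) + w1 m (- L) = 0"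
proof -
  note kD = k_D[OF assms]
  have neg: "- (k m * L) + k m * L / 2 = - (k m * L / 2)" by simp
  show w0: "w m 0 = 1" using kD by (simp add: w_def)
  show wL: "w m (- L) = exp (L / (2 * \<epsilon>))" using kD by (simp add: w_def neg mult.commute[of L])
  have t: "\<epsilon> * k m * (sin (k m * L / 2) / cos (k m * L / 2)) = 1 / 4 - \<epsilon>\<^sup>2 * freq m - \<epsilon>\<^sup>2 * (k m)\<^sup>2"
    using kD(5,4) by (simp add: field_simps)
  have l: "\<epsilon> * lam m = 1 / 4 + \<epsilon>\<^sup>2 * (k m)\<^sup>2 + \<epsilon>\<^sup>2 * freq m"
    using eps by (simp add: lam_def field_simps power2_eq_square)
  have "\<epsilon> * w1 m 0 = - 1 / 2 - \<epsilon> * k m * (sin (k m * L / 2) / cos (k m * L / 2))"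
    using eps kD(4) by (simp add: w1_def field_simps)
  then show "\<epsilon> * lam m * w m 0 - \<epsilon> * w1 m 0 - w m 0 = 0"
    using l t by (simp add: w0)
  have "\<epsilon> * w1 m (- L) = exp (L / (2 * \<epsilon>)) * (- 1 / 2 + \<epsilon> * k m * (sin (k m * L / 2) / cos (k m * L / 2)))"
    using eps kD(4) by (simp add: w1_def neg) (simp add: field_simps)
  then have "\<epsilon> * (lam m * w m (- L) + w1 m (- L)) = exp (L / (2 * \<epsilon>)) * 
     (\<epsilon> * lam m - 1 / 2 + \<epsilon> * k m * (sin (k m * L / 2) / cos (k m * L / 2)))"
    by (simp add: wL algebra_simps)
  also have "\<dots> = 0" using l t by simp
  finally show "lam m * w m (- L) + w1 m (- L) = 0" using eps by simp
qed

text \<open>The two parts of the residual, containing \<open>\<eta>''\<close> and \<open>\<eta>'\<close>, that \<open>fac m j\<close> leaves in the equation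
  \<open>g'' + (m j / N)\<^sup>2 g = 0\<close>.\<close>

definition r\<^sub>1 :: "('n \<Rightarrow> nat) \<Rightarrow> 'n \<Rightarrow> real \<Rightarrow> real" where
  "r\<^sub>1 m j y = deriv (deriv \<eta>) (y / real N) / (real N)\<^sup>2 * cos (real (m j) * y / real N)"

definition r\<^sub>2 :: "('n \<Rightarrow> nat) \<Rightarrow> 'n \<Rightarrow> real \<Rightarrow> real" where
  "r\<^sub>2 m j y = - 2 * deriv \<eta> (y / real N) / real N * ((real (m j) / real N) * sin (real (m j) * y / real N))"

lemma deriv2_fac:
  assumes "j \<noteq> d"
  shows "deriv (deriv (fac m j)) y = r\<^sub>1 m j y + r\<^sub>2 m j y - (real (m j) / real N)\<^sup>2 * fac m j y"
proof -
  have D: "((\<lambda>y. y / real N) has_real_derivative 1 / real N) (at y)" for y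
    using N by (auto intro!: derivative_eq_intros)
  have e1: "((\<lambda>y. \<eta> (y / real N)) has_real_derivative deriv \<eta> (y / real N) / real N) (at y)" for y
    using DERIV_chain2[OF smooth_has_deriv[OF eta(1)] D] by simp
  have e2: "((\<lambda>y. deriv \<eta> (y / real N)) has_real_derivative deriv (deriv \<eta>) (y / real N) / real N) (at y)" for y
    using DERIV_chain2[OF smooth_has_deriv[OF smooth_deriv[OF eta(1)]] D] by simp
  have 0: "fac m j = (\<lambda>y. \<eta> (y / real N) * cos (real (m j) * y / real N))"
    using assms by (auto simp: fac_eq)
  have "(fac m j has_real_derivative deriv \<eta> (y / real N) / real N * cos (real (m j) * y / real N)
      - \<eta> (y / real N) * (real (m j) / real N * sin (real (m j) * y / real N))) (at y)" for y
    unfolding 0 using N by (auto intro!: derivative_eq_intros e1)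
  then have 1: "deriv (fac m j) = (\<lambda>y. deriv \<eta> (y / real N) / real N * cos (real (m j) * y / real N)
      - \<eta> (y / real N) * (real (m j) / real N * sin (real (m j) * y / real N)))"
    by (auto intro!: ext DERIV_imp_deriv)
  have "(deriv (fac m j) has_real_derivative r\<^sub>1 m j y + r\<^sub>2 m j y - (real (m j) / real N)\<^sup>2 * fac m j y) (at y)"
  proof -
    define x where "x = real (m j) / real N"
    have x: "real (m j) * y / real N = x * y" for y by (simp add: x_def)
    have e2': "((\<lambda>y. deriv \<eta> (y / real N) / real N) has_real_derivative
        deriv (deriv \<eta>) (y / real N) / (real N)\<^sup>2) (at y)"
      using DERIV_cdivide[OF e2[of y], of "real N"] by (simp add: power2_eq_square)
    define A where "A y = deriv \<eta> (y / real N) / real N" for y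
    define G where "G y = \<eta> (y / real N)" for y
    have "((\<lambda>y. A y * cos (x * y) - G y * (x * sin (x * y))) has_real_derivative
        deriv (deriv \<eta>) (y / real N) / (real N)\<^sup>2 * cos (x * y) - 2 * A y * (x * sin (x * y))
         - x\<^sup>2 * (G y * cos (x * y))) (at y)"
      by (auto intro!: derivative_eq_intros e1[folded A_def G_def] e2'[folded A_def]
          simp: algebra_simps power2_eq_square)
    then show ?thesis
      unfolding 1 unfolding 0 r\<^sub>1_def r\<^sub>2_def x x_def[symmetric] A_def G_def
      by (simp add: algebra_simps)
  qed
  then show ?thesis by (rule DERIV_imp_deriv)
qed

end

lemma sprod_upd: "sprod (q(j := g)) x = g (x $ j) * (\<Prod>i\<in>UNIV - {j}. q i (x $ i))"
  by (subst sprod_split[of _ _ j]) auto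

context modes
begin

section \<open>The residual of the adjoint equation\<close>

definition E :: "('n \<Rightarrow> nat) \<Rightarrow> real \<Rightarrow> real" where "E m t = exp (lam m * t)"

lemma \<psi>_slice:
  assumes "0 \<le> t" "t \<le> T"
  shows "\<psi> (t, x) = (\<Sum>m\<in>M. E m t * sprod (fac m) x)"
  using assms L by (simp add: \<psi>_def E_def \<theta>_eq_1)

lemma \<psi>_time_deriv:
  assumes "0 \<le> t" "t \<le> T"
  shows "deriv (\<lambda>s. \<psi> (s, x)) t = (\<Sum>m\<in>M. (lam m * E m t) * sprod (fac m) x)"
proof -
  have eq: "(\<lambda>s. \<psi> (s, x)) = (\<lambda>s. \<theta> s * (\<Sum>m\<in>M. E m s * sprod (fac m) x))"
    by (simp add: \<psi>_def E_def sum_distrib_left mult.assoc)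
  have "deriv (\<lambda>s. \<psi> (s, x)) t = deriv (\<lambda>s. \<Sum>m\<in>M. E m s * sprod (fac m) x) t"
    unfolding eq using assms L by (intro deriv_\<theta>_mult) auto
  also have "\<dots> = (\<Sum>m\<in>M. (lam m * E m t) * sprod (fac m) x)"
    unfolding E_def by (intro DERIV_imp_deriv) (auto intro!: derivative_eq_intros sum.cong)
  finally show ?thesis .
qed

text \<open>The residual is split according to the trigonometric function in coordinate
  \<open>j\<close>, a cosine in \<open>R\<^sub>1\<close> and a sine in \<open>R\<^sub>2\<close>, so
  that the orthogonality relations can be applied to each part.\<close>

definition R\<^sub>1 :: "'n \<Rightarrow> real \<Rightarrow> real ^ 'n \<Rightarrow> real" where
  "R\<^sub>1 j t x = (\<Sum>m\<in>M. E m t * sprod ((fac m)(j := r\<^sub>1 m j)) x)"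

definition R\<^sub>2 :: "'n \<Rightarrow> real \<Rightarrow> real ^ 'n \<Rightarrow> real" where
  "R\<^sub>2 j t x = (\<Sum>m\<in>M. E m t * sprod ((fac m)(j := r\<^sub>2 m j)) x)"

definition \<rho> :: "real \<Rightarrow> real ^ 'n \<Rightarrow> real" where
  "\<rho> t x = (\<Sum>j\<in>UNIV - {d}. \<epsilon> * (R\<^sub>1 j t x + R\<^sub>2 j t x))"

text \<open>For times in \<open>[0, T]\<close>, \<open>Dn\<close>, \<open>Lap\<close>,
  \<open>Dt\<close> and \<open>Ps\<close> are the derivative in direction \<open>d\<close>, the
  Laplacian, the time derivative and the value of \<open>\<psi>\<close>, with the cut-off in time
  dropped.\<close>

definition Dn :: "real \<Rightarrow> real ^ 'n \<Rightarrow> real" where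
  "Dn t x = (\<Sum>m\<in>M. E m t * sprod ((fac m)(d := deriv (fac m d))) x)"

definition Lap :: "real \<Rightarrow> real ^ 'n \<Rightarrow> real" where
  "Lap t x = (\<Sum>j\<in>UNIV. \<Sum>m\<in>M. E m t * sprod ((fac m)(j := deriv (deriv (fac m j)))) x)"

definition Dt :: "real \<Rightarrow> real ^ 'n \<Rightarrow> real" where
  "Dt t x = (\<Sum>m\<in>M. (lam m * E m t) * sprod (fac m) x)"

definition Ps :: "real \<Rightarrow> real ^ 'n \<Rightarrow> real" where
  "Ps t x = (\<Sum>m\<in>M. E m t * sprod (fac m) x)"

lemma \<psi>_space_derivs:
  assumes "0 \<le> t" "t \<le> T"
  shows "partial d (\<lambda>y. \<psi> (t, y)) = Dn t"
    and "laplacian (\<lambda>y. \<psi> (t, y)) = Lap t"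
    and "normal_deriv d (\<lambda>y. \<psi> (t, y)) x = (if x $ d = 0 then 1 else -1) * Dn t x"
proof -
  show 1: "partial d (\<lambda>y. \<psi> (t, y)) = Dn t"
    unfolding \<psi>_slice[OF assms] Dn_def[abs_def] by (intro partial_sum_sprod smooth_fac)
  have "partial j (partial j (\<lambda>y. \<psi> (t, y))) =
     (\<lambda>x. \<Sum>m\<in>M. E m t * sprod ((fac m)(j := deriv (deriv (fac m j)))) x)" for j
    unfolding \<psi>_slice[OF assms] by (intro partial2_sum_sprod smooth_fac)
  then show "laplacian (\<lambda>y. \<psi> (t, y)) = Lap t"
    by (simp add: laplacian_def[abs_def] Lap_def[abs_def])
  show "normal_deriv d (\<lambda>y. \<psi> (t, y)) x = (if x $ d = 0 then 1 else -1) * Dn t x"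
    using 1 unfolding \<psi>_slice[OF assms] by (subst normal_deriv_sum_sprod) (auto intro: smooth_fac)
qed

text \<open>Mode by mode: besides the residual terms, the tangential part of the Laplacian
  contributes \<open>- \<epsilon> * freq m\<close>, the normal variable contributes
  \<open>\<epsilon> * freq m - lam m\<close>, and the time derivative contributes
  \<open>lam m\<close>.\<close>

lemma interior_residual:
  assumes "x \<in> strip d L"
  shows "Dt t x + (\<epsilon> * Lap t x + Dn t x) = \<rho> t x"
proof -
  have x: "- L \<le> x $ d" "x $ d \<le> 0" using assms by (auto simp: strip_def)
  have mode: "lam m * sprod (fac m) x + \<epsilon> * (\<Sum>j\<in>UNIV. sprod ((fac m)(j := deriv (deriv (fac m j)))) x)
     + sprod ((fac m)(d := deriv (fac m d))) x =
     (\<Sum>j\<in>UNIV - {d}. \<epsilon> * (sprod ((fac m)(j := r\<^sub>1 m j)) x + sprod ((fac m)(j := r\<^sub>2 m j)) x))"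
    if m: "m \<in> M" for m
  proof -
    define X where "X = (\<Prod>i\<in>UNIV - {d}. fac m i (x $ i))"
    have h: "sprod ((fac m)(j := deriv (deriv (fac m j)))) x =
       (sprod ((fac m)(j := r\<^sub>1 m j)) x + sprod ((fac m)(j := r\<^sub>2 m j)) x)
        - (real (m j) / real N)\<^sup>2 * sprod (fac m) x" if "j \<noteq> d" for j
      unfolding sprod_upd deriv2_fac[OF that] by (subst sprod_split[of "fac m" x j]) (simp add: algebra_simps)
    define S where "S = (\<Sum>j\<in>UNIV. sprod ((fac m)(j := deriv (deriv (fac m j)))) x)"
    define R where "R = (\<Sum>j\<in>UNIV - {d}. sprod ((fac m)(j := r\<^sub>1 m j)) x + sprod ((fac m)(j := r\<^sub>2 m j)) x)"
    have P: "sprod (fac m) x = fac m d (x $ d) * X" "sprod ((fac m)(d := deriv (fac m d))) x = deriv (fac m d) (x $ d) * X"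
      by (auto simp: sprod_upd X_def sprod_split[of "fac m" x d])
    have "S = deriv (deriv (fac m d)) (x $ d) * X + (\<Sum>j\<in>UNIV - {d}. sprod ((fac m)(j := deriv (deriv (fac m j)))) x)"
      unfolding S_def by (subst sum.remove[of _ d]) (auto simp: sprod_upd X_def)
    also have "(\<Sum>j\<in>UNIV - {d}. sprod ((fac m)(j := deriv (deriv (fac m j)))) x) =
      R - freq m * sprod (fac m) x"
      unfolding R_def using h by (simp add: sum_subtractf freq_def sum_distrib_right)
    finally have S: "S = deriv (deriv (fac m d)) (x $ d) * X + (R - freq m * sprod (fac m) x)" .
    have "lam m * sprod (fac m) x + \<epsilon> * S + sprod ((fac m)(d := deriv (fac m d))) x =
       (lam m * fac m d (x $ d) + (\<epsilon> * deriv (deriv (fac m d)) (x $ d) + deriv (fac m d) (x $ d))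
         - \<epsilon> * freq m * fac m d (x $ d)) * X
       + \<epsilon> * R"
      unfolding S P by (simp add: algebra_simps)
    also have "(lam m * fac m d (x $ d) + (\<epsilon> * deriv (deriv (fac m d)) (x $ d) + deriv (fac m d) (x $ d))
         - \<epsilon> * freq m * fac m d (x $ d)) = 0"
      unfolding fac_d_equation(3)[OF m x] by (simp add: algebra_simps)
    finally show ?thesis
      by (simp only: S_def R_def sum_distrib_left mult_zero_left add_0_left)
  qed
  have "Dt t x + (\<epsilon> * Lap t x + Dn t x) =
     (\<Sum>m\<in>M. E m t * (lam m * sprod (fac m) x + \<epsilon> * (\<Sum>j\<in>UNIV. sprod ((fac m)(j := deriv (deriv (fac m j)))) x)
     + sprod ((fac m)(d := deriv (fac m d))) x))"
    unfolding Dt_def Lap_def Dn_def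
    by (subst sum.swap[of _ M UNIV]) (simp add: algebra_simps sum.distrib sum_distrib_left)
  also have "\<dots> = (\<Sum>m\<in>M. E m t * (\<Sum>j\<in>UNIV - {d}. \<epsilon> * (sprod ((fac m)(j := r\<^sub>1 m j)) x + sprod ((fac m)(j := r\<^sub>2 m j)) x)))"
    using mode by simp
  also have "\<dots> = \<rho> t x"
    unfolding \<rho>_def R\<^sub>1_def R\<^sub>2_def sum.distrib[symmetric] sum_distrib_left
    by (subst sum.swap) (auto intro!: sum.cong simp: algebra_simps)
  finally show ?thesis .
qed

text \<open>The tangential factors merely multiply the boundary conditions of \<open>w m\<close>,
  which contain no tangential derivative. The cut-off at scale \<open>N\<close> thus leaves no
  residual on the boundary.\<close>

lemma boundary_residuals:
  shows "x $ d = 0 \<Longrightarrow> \<epsilon> * Dt t x - \<epsilon> * Dn t x - Ps t x = 0"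
    and "x $ d = - L \<Longrightarrow> Dt t x + Dn t x = 0"
proof -
  assume x: "x $ d = 0"
  have "\<epsilon> * Dt t x - \<epsilon> * Dn t x - Ps t x =
     (\<Sum>m\<in>M. E m t * ((\<epsilon> * lam m * w m 0 - \<epsilon> * w1 m 0 - w m 0) * (\<Prod>i\<in>UNIV - {d}. fac m i (x $ i))))"
    unfolding Dt_def Dn_def Ps_def sum_distrib_left sum_subtractf[symmetric]
    using x L by (intro sum.cong)
      (auto simp: sprod_upd sprod_split[of "fac m" x d for m] fac_d_equation algebra_simps)
  also have "\<dots> = 0"
    using w_boundary(3) by (intro sum.neutral) auto
  finally show "\<epsilon> * Dt t x - \<epsilon> * Dn t x - Ps t x = 0" .
next
  assume x: "x $ d = - L"
  have "Dt t x + Dn t x =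
     (\<Sum>m\<in>M. E m t * ((lam m * w m (- L) + w1 m (- L)) * (\<Prod>i\<in>UNIV - {d}. fac m i (x $ i))))"
    unfolding Dt_def Dn_def sum.distrib[symmetric]
    using x L by (intro sum.cong)
      (auto simp: sprod_upd sprod_split[of "fac m" x d for m] fac_d_equation algebra_simps)
  also have "\<dots> = 0"
    using w_boundary(4) by (intro sum.neutral) auto
  finally show "Dt t x + Dn t x = 0" .
qed

lemma cont_cs_fac_upd: "cont_cs g \<Longrightarrow> cont_cs (((fac m)(j := g)) i)"
  by (simp add: cont_cs_fac)

lemma cont_cs_fac_deriv: "cont_cs (deriv (fac m i))" "cont_cs (deriv (deriv (fac m i)))"
  by (intro cont_cs_deriv smooth_deriv smooth_fac cont_cs_fac)+

lemma in_L2_derivs: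
  "in_L2 (hyperplane_measure d c) (Dt t)" "in_L2 (strip_measure d L) (Dt t)"
  "in_L2 (hyperplane_measure d c) (Dn t)" "in_L2 (strip_measure d L) (Dn t)"
  "in_L2 (hyperplane_measure d c) (Ps t)" "in_L2 (strip_measure d L) (Ps t)"
  "in_L2 (strip_measure d L) (Lap t)"
  unfolding Dt_def[abs_def] Dn_def[abs_def] Ps_def[abs_def] Lap_def[abs_def]
  by (intro in_L2_sum in_L2_sum_sprod_cont_cs cont_cs_fac_upd cont_cs_fac_deriv cont_cs_fac)+

text \<open>The terms with \<open>u\<close> are collected on the strip and on each face. On the
  strip they form the residual; on the faces they are the boundary conditions of the adjoint problem
  and cancel.\<close>

lemma weak_integrand_eq:
  assumes t: "0 \<le> t" "t \<le> T" and u: "in_X d L u"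
  shows "weak_integrand d L \<epsilon> v \<psi> u t =
    (\<integral>x. u x * \<rho> t x \<partial>strip_measure d L) + (\<integral>x. v (t, x) * \<psi> (t, x) \<partial>Gamma0 d)"
proof -
  have uS: "in_L2 (strip_measure d L) u" and u0: "in_L2 (Gamma0 d) u" and u1: "in_L2 (Gamma1 d L) u"
    using u by (auto simp: in_X_def)
  have Ps: "\<psi> (t, x) = Ps t x" for x using \<psi>_slice[OF t] by (simp add: Ps_def)
  have DtE: "deriv (\<lambda>s. \<psi> (s, x)) t = Dt t x" for x using \<psi>_time_deriv[OF t] by (simp add: Dt_def)
  note i0 = in_L2_integrable_mult[OF u0] and i1 = in_L2_integrable_mult[OF u1] and iS = in_L2_integrable_mult[OF uS]
  have m0: "u \<in> borel_measurable (Gamma0 d)" "Dn t \<in> borel_measurable (Gamma0 d)"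
    using u0 in_L2_derivs(3) by (auto simp: in_L2_def)
  have m1: "u \<in> borel_measurable (Gamma1 d L)" "Dn t \<in> borel_measurable (Gamma1 d L)"
    using u1 in_L2_derivs(3) by (auto simp: in_L2_def)
  \<comment> \<open>The sign in \<open>normal_deriv\<close> depends on \<open>x $ d\<close>, which
    is constant almost everywhere for each face measure.\<close>
  have n0: "(\<integral>x. u x * normal_deriv d (\<lambda>y. \<psi> (t, y)) x \<partial>Gamma0 d) = (\<integral>x. u x * Dn t x \<partial>Gamma0 d)"
    unfolding \<psi>_space_derivs[OF t]
  proof (rule integral_cong_AE)
    show "AE x in Gamma0 d. u x * ((if x $ d = 0 then 1 else - 1) * Dn t x) = u x * Dn t x"
      using AE_hyperplane_measure[of d 0] by eventually_elim auto
  qed (use m0 in measurable)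
  have n1: "(\<integral>x. u x * normal_deriv d (\<lambda>y. \<psi> (t, y)) x \<partial>Gamma1 d L) = - (\<integral>x. u x * Dn t x \<partial>Gamma1 d L)"
    unfolding \<psi>_space_derivs[OF t] integral_minus[symmetric]
  proof (rule integral_cong_AE)
    show "AE x in Gamma1 d L. u x * ((if x $ d = 0 then 1 else - 1) * Dn t x) = - (u x * Dn t x)"
      using AE_hyperplane_measure[of d "- L"] by eventually_elim (use L in auto)
  qed (use m1 in measurable)
  have z0: "(\<integral>x. u x * (\<epsilon> * Dt t x - \<epsilon> * Dn t x - Ps t x) \<partial>Gamma0 d) = 0"
    by (rule integral_eq_zero_AE)
       (use AE_hyperplane_measure[of d 0] in \<open>eventually_elim, auto simp: boundary_residuals\<close>)
  have z1: "(\<integral>x. u x * (Dt t x + Dn t x) \<partial>Gamma1 d L) = 0"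
    by (rule integral_eq_zero_AE)
       (use AE_hyperplane_measure[of d "- L"] in \<open>eventually_elim, auto simp: boundary_residuals\<close>)
  have "\<epsilon> * (\<integral>x. u x * Dt t x \<partial>Gamma0 d) - \<epsilon> * (\<integral>x. u x * Dn t x \<partial>Gamma0 d) - (\<integral>x. u x * Ps t x \<partial>Gamma0 d) =
     (\<integral>x. \<epsilon> * (u x * Dt t x) - \<epsilon> * (u x * Dn t x) - u x * Ps t x \<partial>Gamma0 d)"
    using i0[OF in_L2_derivs(1)] i0[OF in_L2_derivs(3)] i0[OF in_L2_derivs(5)] by simp
  also have "\<dots> = (\<integral>x. u x * (\<epsilon> * Dt t x - \<epsilon> * Dn t x - Ps t x) \<partial>Gamma0 d)"
    by (intro Bochner_Integration.integral_cong) (auto simp: algebra_simps)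
  finally have 0: "\<epsilon> * (\<integral>x. u x * Dt t x \<partial>Gamma0 d) - \<epsilon> * (\<integral>x. u x * Dn t x \<partial>Gamma0 d) - (\<integral>x. u x * Ps t x \<partial>Gamma0 d) = 0"
    using z0 by simp
  have 1: "(\<integral>x. u x * Dt t x \<partial>Gamma1 d L) + (\<integral>x. u x * Dn t x \<partial>Gamma1 d L) = 0"
    using z1 i1[OF in_L2_derivs(1)] i1[OF in_L2_derivs(3)] by (simp add: distrib_left)
  have Lp: "in_L2 (strip_measure d L) (\<lambda>x. \<epsilon> * Lap t x + Dn t x)"
    by (intro in_L2_add in_L2_cmult in_L2_derivs)
  have S: "(\<integral>x. u x * Dt t x \<partial>strip_measure d L) + (\<integral>x. u x * (\<epsilon> * Lap t x + Dn t x) \<partial>strip_measure d L) =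
     (\<integral>x. u x * \<rho> t x \<partial>strip_measure d L)"
    using iS[OF in_L2_derivs(2)] iS[OF Lp]
    by (subst Bochner_Integration.integral_add[symmetric])
       (auto intro!: Bochner_Integration.integral_cong simp: distrib_left[symmetric] interior_residual)
  show ?thesis
    unfolding weak_integrand_def inner_X_def bdry_integral_def n0 n1
    unfolding DtE \<psi>_space_derivs(1,2)[OF t]
    unfolding Ps
    using 0 S arg_cong[OF 1, of "\<lambda>z. \<epsilon> * z"] by (simp add: algebra_simps)
qed

section \<open>Norms of sums of cut-off modes\<close>

definition trig :: "('n \<Rightarrow> real \<Rightarrow> real) \<Rightarrow> 'n \<Rightarrow> nat \<Rightarrow> real \<Rightarrow> real" where
  "trig s i m y = indicator {- (pi * real N)..pi * real N} y * s i (real m * y / real N)"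

text \<open>By orthogonality the squared norm is a sum of \<open>N^p\<close> terms, each at most
  \<open>V * (pi * N)^p\<close>. The number of modes and the volume of the cube thus contribute
  equally to the order \<open>N^p\<close> of the norm.\<close>

lemma trig_sum_norm:
  assumes ip: "integrates_products \<mu> d \<kappa>" and sets: "sets \<mu> = sets borel"
    and s: "\<And>i. i \<noteq> d \<Longrightarrow> s i = cos \<or> s i = sin"
    and gm: "\<And>m. m \<in> M \<Longrightarrow> g m \<in> borel_measurable borel"
    and gi: "\<And>m m'. m \<in> M \<Longrightarrow> m' \<in> M \<Longrightarrow> integrable \<kappa> (\<lambda>y. g m y * g m' y)"
    and V: "\<And>m. m \<in> M \<Longrightarrow> (\<integral>y. (g m y)\<^sup>2 \<partial>\<kappa>) \<le> V"
  shows "in_L2 \<mu> (\<lambda>x. \<Sum>m\<in>M. sprod (\<lambda>i. if i = d then g m else trig s i (m i)) x)" (is "in_L2 \<mu> ?S")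
    and "L2_norm \<mu> (\<lambda>x. \<Sum>m\<in>M. sprod (\<lambda>i. if i = d then g m else trig s i (m i)) x) \<le>
      sqrt (V * pi ^ p) * real N ^ p"
proof -
  have orth: "has_bochner_integral lborel (\<lambda>y. trig s i m y * trig s i m' y) (if m = m' then pi * real N else 0)"
    if "i \<noteq> d" "m \<in> {1..N}" "m' \<in> {1..N}" for i m m'
    unfolding trig_def using that N by (intro trig_orthogonal s) auto
  have main: "has_bochner_integral \<mu> (\<lambda>x. (?S x)\<^sup>2) (\<Sum>m\<in>M. (\<integral>y. (g m y)\<^sup>2 \<partial>\<kappa>) * (pi * real N) ^ p)"
    unfolding p_def by (rule orthogonal_product_sum[OF ip M_def _ orth gi]) auto
  have "?S \<in> borel_measurable \<mu>"
  proof -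
    have "trig s i j \<in> borel_measurable borel" if "i \<noteq> d" for i j
      unfolding trig_def using s[OF that] by (elim disjE) (simp_all, measurable)
    then have "?S \<in> borel_measurable borel"
      using gm by (intro borel_measurable_sum borel_measurable_sprod) auto
    then show ?thesis by (simp cong: measurable_cong_sets[OF sets refl])
  qed
  with main show "in_L2 \<mu> ?S" by (simp add: in_L2_def has_bochner_integral_iff)
  have "(\<integral>x. (?S x)\<^sup>2 \<partial>\<mu>) = (\<Sum>m\<in>M. (\<integral>y. (g m y)\<^sup>2 \<partial>\<kappa>) * (pi * real N) ^ p)"
    using main by (simp add: has_bochner_integral_iff)
  also have "\<dots> \<le> (\<Sum>m\<in>M. V * (pi * real N) ^ p)"
    using V by (intro sum_mono mult_right_mono) auto
  also have "\<dots> = V * pi ^ p * (real N ^ p)\<^sup>2"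
    by (simp add: card_M power_mult_distrib power2_eq_square)
  finally have "L2_norm \<mu> ?S \<le> sqrt (V * pi ^ p * (real N ^ p)\<^sup>2)"
    unfolding L2_norm_def by (rule real_sqrt_le_mono)
  then show "L2_norm \<mu> ?S \<le> sqrt (V * pi ^ p) * real N ^ p"
    by (simp add: real_sqrt_mult)
qed

text \<open>The cut-off is common to all modes and can be pulled out of the sum. Since it vanishes
  outside the cube of orthogonality, the modes may be truncated there.\<close>

lemma cutoff_trig_sum:
  assumes a: "\<And>i y. i \<noteq> d \<Longrightarrow> \<bar>y\<bar> > pi * real N \<Longrightarrow> a i y = 0"
  shows "(\<Sum>m\<in>M. g m (x $ d) * (\<Prod>i\<in>UNIV - {d}. a i (x $ i) * s i (real (m i) * x $ i / real N))) =
     (\<Prod>i\<in>UNIV - {d}. a i (x $ i)) * (\<Sum>m\<in>M. sprod (\<lambda>i. if i = d then g m else trig s i (m i)) x)"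
proof -
  have "a i (x $ i) * s i (real (m i) * x $ i / real N) = a i (x $ i) * trig s i (m i) (x $ i)" if "i \<noteq> d" for i m
    using a[OF that, of "x $ i"] by (cases "\<bar>x $ i\<bar> > pi * real N") (auto simp: trig_def indicator_def)
  then have "(\<Prod>i\<in>UNIV - {d}. a i (x $ i) * s i (real (m i) * x $ i / real N)) =
      (\<Prod>i\<in>UNIV - {d}. a i (x $ i)) * (\<Prod>i\<in>UNIV - {d}. trig s i (m i) (x $ i))" for m
    unfolding prod.distrib[symmetric] by (intro prod.cong) auto
  then show ?thesis
    by (simp add: sprod_split[of _ x d] sum_distrib_left mult_ac)
qed

text \<open>An upper bound for all \<open>lam m\<close> that does not depend on
  \<open>N\<close>.\<close>

definition "\<Lambda> = 1 / (4 * \<epsilon>) + \<epsilon> * (pi / L)\<^sup>2 + \<epsilon> * real p"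

lemma freq_bounds: "m \<in> M \<Longrightarrow> 0 \<le> freq m \<and> freq m \<le> real p"
proof -
  assume m: "m \<in> M"
  have "(real (m i) / real N)\<^sup>2 \<le> 1" if "i \<noteq> d" for i
    using M_D[OF m that] N by (intro power_le_one) auto
  then have "freq m \<le> (\<Sum>i\<in>UNIV - {d}. 1)" unfolding freq_def by (intro sum_mono) auto
  then show ?thesis by (auto simp: freq_def p_def sum_nonneg)
qed

lemma E_bounds:
  assumes "m \<in> M" "0 \<le> t" "t \<le> T"
  shows "0 < E m t" "E m t \<le> exp (\<Lambda> * T)"
proof -
  have "(k m)\<^sup>2 \<le> (pi / L)\<^sup>2" using k_D[OF assms(1)] by (intro power_mono) auto
  then have "lam m \<le> \<Lambda>"
    using freq_bounds[OF assms(1)] eps by (auto simp: lam_def \<Lambda>_def intro!: add_mono mult_left_mono)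
  moreover have "0 \<le> lam m"
    using freq_bounds[OF assms(1)] eps by (auto simp: lam_def)
  ultimately have "lam m * t \<le> \<Lambda> * T" using assms by (intro mult_mono) auto
  then show "E m t \<le> exp (\<Lambda> * T)" by (simp add: E_def)
qed (simp add: E_def)

definition "W = exp (L / (2 * \<epsilon>)) / c\<^sub>0"

lemma w_bound:
  assumes "m \<in> M" "- L \<le> y" "y \<le> 0"
  shows "\<bar>w m y\<bar> \<le> W"
proof -
  have "\<bar>w m y\<bar> = exp (- y / (2 * \<epsilon>)) * (\<bar>cos (k m * y + k m * L / 2)\<bar> / cos (k m * L / 2))"
    using k_D(4)[OF assms(1)] by (simp add: w_def abs_mult)
  also have "\<dots> \<le> exp (L / (2 * \<epsilon>)) * (1 / c\<^sub>0)"
    using k_D(3,4)[OF assms(1)] c0 eps assms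
    by (intro mult_mono frac_le) (auto simp: divide_simps)
  finally show ?thesis by (simp add: W_def)
qed

lemma indicator_w_bound:
  fixes c :: "('n \<Rightarrow> nat) \<Rightarrow> real"
  defines "g \<equiv> \<lambda>m y. indicator {- L..0} y * (c m * w m y)"
  assumes c: "\<And>m. m \<in> M \<Longrightarrow> \<bar>c m\<bar> \<le> G"
  shows "g m \<in> borel_measurable borel" "integrable lborel (\<lambda>y. g m y * g m' y)"
    "m \<in> M \<Longrightarrow> (\<integral>y. (g m y)\<^sup>2 \<partial>lborel) \<le> (G * W)\<^sup>2 * L"
proof -
  have cw: "continuous_on A (w m)" for A m by (rule smooth_continuous[OF smooth_w])
  have wm: "w m \<in> borel_measurable borel" for m by (intro borel_measurable_continuous_onI cw)
  then show "g m \<in> borel_measurable borel" unfolding g_def by measurable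
  have int: "integrable lborel (\<lambda>y. g m y * g m' y)" for m m'
  proof -
    have "integrable lborel (\<lambda>y. indicator {- L..0} y *\<^sub>R (c m * w m y * (c m' * w m' y)))"
      by (intro borel_integrable_compact continuous_intros cw) auto
    moreover have "indicator {- L..0} y *\<^sub>R (c m * w m y * (c m' * w m' y)) = g m y * g m' y" for y
      by (simp add: g_def indicator_def)
    ultimately show ?thesis by (simp only:)
  qed
  then show "integrable lborel (\<lambda>y. g m y * g m' y)" .
  assume m: "m \<in> M"
  have "(\<integral>y. (g m y)\<^sup>2 \<partial>lborel) \<le> (\<integral>y. indicator {- L..0} y * (G * W)\<^sup>2 \<partial>lborel)"
  proof (rule integral_mono)
    show "integrable lborel (\<lambda>y. (g m y)\<^sup>2)" using int[of m m] by (simp add: power2_eq_square)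
    show "integrable lborel (\<lambda>y. indicator {- L..0} y * (G * W)\<^sup>2)"
      by (intro integrable_mult_left integrable_real_indicator) (auto simp: emeasure_lborel_Icc_eq)
    show "(g m y)\<^sup>2 \<le> indicator {- L..0} y * (G * W)\<^sup>2" for y
    proof (cases "y \<in> {- L..0}")
      case True
      then have "\<bar>c m * w m y\<bar> \<le> G * W"
        using c[OF m] w_bound[OF m, of y] by (auto simp: abs_mult intro!: mult_mono)
      then have "(c m * w m y)\<^sup>2 \<le> (G * W)\<^sup>2"
        by (metis abs_ge_zero power2_abs power_mono)
      then show ?thesis using True by (simp add: g_def)
    qed (simp add: g_def)
  qed
  also have "\<dots> = (G * W)\<^sup>2 * L" using L by simp
  finally show "(\<integral>y. (g m y)\<^sup>2 \<partial>lborel) \<le> (G * W)\<^sup>2 * L" .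
qed

text \<open>On the strip \<open>f\<close> is a bounded cut-off times the trigonometric sum
  \<open>S\<close>. Bounding the cut-off by \<open>B\<close> and passing from the strip to the whole
  space leaves the norm of \<open>S\<close>, for which orthogonality is available. The choice of
  \<open>a\<close>, \<open>s\<close> and \<open>c\<close> is open in order to cover both parts of
  the residual.\<close>

lemma strip_norm_bound:
  assumes f: "in_L2 (strip_measure d L) f"
    and feq: "\<And>x. x \<in> strip d L \<Longrightarrow> f x =
        (\<Sum>m\<in>M. c m * w m (x $ d) * (\<Prod>i\<in>UNIV - {d}. a i (x $ i) * s i (real (m i) * x $ i / real N)))"
    and s: "\<And>i. i \<noteq> d \<Longrightarrow> s i = cos \<or> s i = sin"
    and a: "\<And>i y. i \<noteq> d \<Longrightarrow> \<bar>y\<bar> > pi * real N \<Longrightarrow> a i y = 0"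
    and B: "\<And>x. \<bar>\<Prod>i\<in>UNIV - {d}. a i (x $ i)\<bar> \<le> B"
    and c: "\<And>m. m \<in> M \<Longrightarrow> \<bar>c m\<bar> \<le> G"
  shows "L2_norm (strip_measure d L) f \<le> B * (sqrt ((G * W)\<^sup>2 * L * pi ^ p) * real N ^ p)"
proof -
  define g where "g m y = indicator {- L..0} y * (c m * w m y)" for m y
  define S where "S x = (\<Sum>m\<in>M. sprod (\<lambda>i. if i = d then g m else trig s i (m i)) x)" for x
  note gb = indicator_w_bound[where c=c and G=G, OF c, folded g_def]
  have S: "in_L2 lborel S" "L2_norm lborel S \<le> sqrt ((G * W)\<^sup>2 * L * pi ^ p) * real N ^ p"
    unfolding S_def[abs_def] using gb
    by (intro trig_sum_norm[OF integrates_products_lborel _ s]; auto)+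
  have B0: "B \<ge> 0" using B[of 0] by (meson abs_ge_zero order_trans)
  have "L2_norm (strip_measure d L) f \<le> L2_norm (strip_measure d L) (\<lambda>x. B * S x)"
  proof (rule L2_norm_mono[OF f _ AE_I2])
    show "in_L2 (strip_measure d L) (\<lambda>x. B * S x)"
      by (intro in_L2_cmult in_L2_strip S)
    fix x assume "x \<in> space (strip_measure d L)"
    then have x: "x \<in> strip d L" by simp
    then have "c m * w m (x $ d) = g m (x $ d)" for m by (simp add: g_def strip_def)
    then have "f x = (\<Prod>i\<in>UNIV - {d}. a i (x $ i)) * S x"
      unfolding feq[OF x] S_def using cutoff_trig_sum[of a g x s] a by simp
    then show "\<bar>f x\<bar> \<le> \<bar>B * S x\<bar>"
      using B[of x] B0 by (simp add: abs_mult mult_right_mono)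
  qed
  also have "\<dots> = B * L2_norm (strip_measure d L) S" using B0 by (simp add: L2_norm_cmult)
  also have "\<dots> \<le> B * (sqrt ((G * W)\<^sup>2 * L * pi ^ p) * real N ^ p)"
    using L2_norm_strip_le[OF S(1), of d L] S(2) B0 by (intro mult_left_mono) auto
  finally show ?thesis .
qed

text \<open>On this face every \<open>w m\<close> equals 1, so only the time factors remain. The
  factor \<open>exp (L / (2 * \<epsilon>))\<close> of the opposite face is absent, and this gap
  produces the lower bound for the cost.\<close>

lemma boundary_norm_bound:
  assumes t: "0 \<le> t" "t \<le> T"
  shows "in_L2 (Gamma0 d) (\<lambda>x. \<psi> (t, x))"
    and "L2_norm (Gamma0 d) (\<lambda>x. \<psi> (t, x)) \<le> exp (\<Lambda> * T) * sqrt (pi ^ p) * real N ^ p"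
proof -
  have Ps: "(\<lambda>x. \<psi> (t, x)) = Ps t" using \<psi>_slice[OF t] by (simp add: Ps_def fun_eq_iff)
  show f: "in_L2 (Gamma0 d) (\<lambda>x. \<psi> (t, x))" unfolding Ps by (rule in_L2_derivs)
  define g where "g m y = E m t" for m and y :: real
  define s where "s i = (cos :: real \<Rightarrow> real)" for i :: 'n
  define a where "a i y = \<eta> (y / real N)" for i :: 'n and y
  define S where "S x = (\<Sum>m\<in>M. sprod (\<lambda>i. if i = d then g m else trig s i (m i)) x)" for x
  have "(E m t)\<^sup>2 \<le> (exp (\<Lambda> * T))\<^sup>2" if "m \<in> M" for m
    using E_bounds[OF that t] by (intro power_mono) auto
  then have V: "(\<integral>y. (g m y)\<^sup>2 \<partial>dirac 0) \<le> (exp (\<Lambda> * T))\<^sup>2" if "m \<in> M" for m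
    unfolding g_def by (subst integral_dirac) (use that \<open>\<And>m. m \<in> M \<Longrightarrow> (E m t)\<^sup>2 \<le> (exp (\<Lambda> * T))\<^sup>2\<close> in auto)
  have gm: "g m \<in> borel_measurable borel" for m by (simp add: g_def[abs_def])
  have s: "s i = cos \<or> s i = sin" for i by (simp add: s_def[abs_def])
  have gi: "integrable (dirac 0) (\<lambda>y. g m y * g m' y)" for m m'
    using gm by (intro integrable_dirac) simp
  have S: "in_L2 (Gamma0 d) S" "L2_norm (Gamma0 d) S \<le> sqrt ((exp (\<Lambda> * T))\<^sup>2 * pi ^ p) * real N ^ p"
    unfolding S_def[abs_def]
    by (rule trig_sum_norm[OF integrates_products_hyperplane sets_hyperplane_measure s gm gi V]; assumption)+
  have "L2_norm (Gamma0 d) (\<lambda>x. \<psi> (t, x)) \<le> L2_norm (Gamma0 d) S"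
  proof (rule L2_norm_mono[OF f S(1)])
    have "\<bar>\<psi> (t, x)\<bar> \<le> \<bar>S x\<bar>" if x: "x $ d = 0" for x
    proof -
      have a0: "a i y = 0" if "\<bar>y\<bar> > pi * real N" for i y
      proof -
        \<comment> \<open>The support of the cut-off fits into the cube of orthogonality because
          \<open>2 \<le> pi\<close>.\<close>
        have "2 * real N \<le> pi * real N" using pi_ge_two N by simp
        with that have "2 * real N \<le> \<bar>y\<bar>" by linarith
        then have "2 \<le> \<bar>y / real N\<bar>" using N by (simp add: field_simps)
        then show ?thesis using eta(5) by (simp add: a_def)
      qed
      have "\<psi> (t, x) = (\<Sum>m\<in>M. g m (x $ d) * (\<Prod>i\<in>UNIV - {d}. a i (x $ i) * s i (real (m i) * x $ i / real N)))"
        unfolding \<psi>_slice[OF t] using x L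
        by (intro sum.cong) (auto simp: sprod_split[of _ x d] g_def fac_eq a_def s_def fac_d_equation(1) w_boundary(1))
      also have "\<dots> = (\<Prod>i\<in>UNIV - {d}. a i (x $ i)) * S x"
        unfolding S_def by (rule cutoff_trig_sum) (rule a0)
      also have "\<bar>\<dots>\<bar> \<le> 1 * \<bar>S x\<bar>"
        unfolding abs_mult abs_prod using eta(2,3)
        by (intro mult_right_mono prod_le_1) (auto simp: a_def)
      finally show ?thesis by simp
    qed
    then show "AE x in Gamma0 d. \<bar>\<psi> (t, x)\<bar> \<le> \<bar>S x\<bar>"
      using AE_hyperplane_measure[of d 0] by auto
  qed
  also have "\<dots> \<le> exp (\<Lambda> * T) * sqrt (pi ^ p) * real N ^ p"
    using S(2) by (simp add: real_sqrt_mult)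
  finally show "L2_norm (Gamma0 d) (\<lambda>x. \<psi> (t, x)) \<le> exp (\<Lambda> * T) * sqrt (pi ^ p) * real N ^ p" .
qed

lemma eta_deriv_eq_0:
  assumes "2 < \<bar>y\<bar>"
  shows "deriv \<eta> y = 0" "deriv (deriv \<eta>) y = 0"
  using assms eta(5) deriv_eq_0_outside[of 2 \<eta>] deriv_eq_0_outside[of 2 "deriv \<eta>"] by auto

lemma prod_one_factor_bound:
  assumes "j \<noteq> d" "\<bar>f (x $ j)\<bar> \<le> B"
  shows "\<bar>\<Prod>i\<in>UNIV - {d}. if i = j then f (x $ i) else \<eta> (x $ i / real N)\<bar> \<le> B"
proof -
  have "\<bar>\<Prod>i\<in>UNIV - {d}. if i = j then f (x $ i) else \<eta> (x $ i / real N)\<bar> =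
     \<bar>f (x $ j)\<bar> * (\<Prod>i\<in>UNIV - {d} - {j}. \<bar>\<eta> (x $ i / real N)\<bar>)"
    using assms(1) by (subst prod.remove[of _ j]) (auto simp: abs_mult abs_prod intro!: prod.cong)
  also have "\<dots> \<le> \<bar>f (x $ j)\<bar> * 1"
    using eta(2,3) by (intro mult_left_mono prod_le_1) auto
  finally show ?thesis using assms(2) by simp
qed

text \<open>Each term has at least one derivative on a cut-off of scale \<open>N\<close>, which
  gives the factor \<open>1 / N\<close>; the rest is a mode sum of order \<open>N^p\<close>.\<close>

lemma residual_norm_bound:
  assumes t: "0 \<le> t" "t \<le> T"
    and K: "\<And>y. \<bar>deriv \<eta> y\<bar> \<le> K" "\<And>y. \<bar>deriv (deriv \<eta>) y\<bar> \<le> K"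
  shows "in_L2 (strip_measure d L) (\<rho> t)"
    and "L2_norm (strip_measure d L) (\<rho> t) \<le>
      real p * (\<epsilon> * (3 * K) * sqrt ((exp (\<Lambda> * T) * W)\<^sup>2 * L * pi ^ p)) * (real N ^ p / real N)"
proof -
  define Q where "Q = sqrt ((exp (\<Lambda> * T) * W)\<^sup>2 * L * pi ^ p) * real N ^ p"
  have Q0: "Q \<ge> 0" using L by (simp add: Q_def)
  have K0: "K \<ge> 0" using K(1)[of 0] by linarith
  have ce: "continuous_on UNIV (\<lambda>y. deriv \<eta> (y / real N))" "continuous_on UNIV (\<lambda>y. deriv (deriv \<eta>) (y / real N))"
  proof -
    have c: "continuous_on UNIV (\<lambda>y. y / real N)" using N by (intro continuous_intros) auto
    have "continuous_on UNIV (\<lambda>y. f (y / real N))" if "smooth f" for f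
      using continuous_on_compose2[OF smooth_continuous[OF that] c, of UNIV] by simp
    then show "continuous_on UNIV (\<lambda>y. deriv \<eta> (y / real N))" "continuous_on UNIV (\<lambda>y. deriv (deriv \<eta>) (y / real N))"
      by (simp_all add: smooth_deriv eta)
  qed
  have out: "2 < \<bar>y / real N\<bar>" if "\<bar>y\<bar> > 2 * real N" for y
    using that N by (simp add: field_simps)
  have cc1: "cont_cs (r\<^sub>1 m j)" for m j
    unfolding cont_cs_def r\<^sub>1_def using N out eta_deriv_eq_0(2)
    by (auto intro!: continuous_intros ce exI[of _ "2 * real N"])
  have cc2: "cont_cs (r\<^sub>2 m j)" for m j
    unfolding cont_cs_def r\<^sub>2_def using N out eta_deriv_eq_0(1)
    by (auto intro!: continuous_intros ce exI[of _ "2 * real N"])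
  have L1: "in_L2 (strip_measure d L) (R\<^sub>1 j t)" and L2: "in_L2 (strip_measure d L) (R\<^sub>2 j t)" for j
    unfolding R\<^sub>1_def[abs_def] R\<^sub>2_def[abs_def]
    by (intro in_L2_sum_sprod_cont_cs cont_cs_fac_upd cc1 cc2)+
  show "in_L2 (strip_measure d L) (\<rho> t)"
    unfolding \<rho>_def[abs_def] by (intro in_L2_sum in_L2_cmult in_L2_add L1 L2)
  have N2: "2 * real N \<le> pi * real N" using pi_ge_two N by simp
  have eta0: "\<eta> (y / real N) = 0" if "\<bar>y\<bar> > pi * real N" for y
    using out[of y] that N2 eta(5)[of "y / real N"] by linarith
  have b1: "L2_norm (strip_measure d L) (R\<^sub>1 j t) \<le> (K / real N) * Q" if j: "j \<noteq> d" for j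
    unfolding Q_def
  proof (rule strip_norm_bound[OF L1, where s="\<lambda>_. cos" and c="\<lambda>m. E m t" and
        a="\<lambda>i y. if i = j then deriv (deriv \<eta>) (y / real N) / (real N)\<^sup>2 else \<eta> (y / real N)"])
    fix x assume "x \<in> strip d L"
    then have x: "- L \<le> x $ d" "x $ d \<le> 0" by (auto simp: strip_def)
    have pr: "(\<Prod>i\<in>UNIV - {d}. (if i = j then r\<^sub>1 m j else fac m i) (x $ i)) = (\<Prod>i\<in>UNIV - {d}.
        (if i = j then deriv (deriv \<eta>) (x $ i / real N) / (real N)\<^sup>2 else \<eta> (x $ i / real N)) *
          cos (real (m i) * x $ i / real N))" for m
      by (intro prod.cong refl) (auto simp: r\<^sub>1_def fac_eq)
    show "R\<^sub>1 j t x = (\<Sum>m\<in>M. E m t * w m (x $ d) * (\<Prod>i\<in>UNIV - {d}.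
        (if i = j then deriv (deriv \<eta>) (x $ i / real N) / (real N)\<^sup>2 else \<eta> (x $ i / real N)) *
          cos (real (m i) * x $ i / real N)))"
      unfolding R\<^sub>1_def using j x
      by (intro sum.cong refl) (simp add: sprod_split[of _ x d] pr fac_d_equation(1))
  next
    show "(if i = j then deriv (deriv \<eta>) (y / real N) / (real N)\<^sup>2 else \<eta> (y / real N)) = 0"
      if "\<bar>y\<bar> > pi * real N" for i y
      using that N2 out[of y] eta0 eta_deriv_eq_0(2) by auto
  next
    fix x :: "real ^ 'n"
    have "\<bar>deriv (deriv \<eta>) (x $ j / real N) / (real N)\<^sup>2\<bar> \<le> K / (real N)\<^sup>2"
      using K(2) by (simp add: divide_right_mono)
    \<comment> \<open>Two derivatives on the cut-off give even \<open>1 / N^2\<close>; the weaker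
      bound matches that of \<open>R\<^sub>2\<close>.\<close>
    also have "\<dots> \<le> K / real N"
      using N K0 by (intro divide_left_mono) (auto simp: power2_eq_square)
    finally show "\<bar>\<Prod>i\<in>UNIV - {d}. if i = j then deriv (deriv \<eta>) (x $ i / real N) / (real N)\<^sup>2 else \<eta> (x $ i / real N)\<bar> \<le> K / real N"
      using prod_one_factor_bound[OF j, of "\<lambda>y. deriv (deriv \<eta>) (y / real N) / (real N)\<^sup>2"] by simp
  qed (use E_bounds[OF _ t] in \<open>auto simp: abs_of_pos\<close>)
  have b2: "L2_norm (strip_measure d L) (R\<^sub>2 j t) \<le> (2 * K / real N) * Q" if j: "j \<noteq> d" for j
    unfolding Q_def
  \<comment> \<open>The inner derivative \<open>m j / N\<close> of the cosine depends on the mode,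
    so it goes into the coefficient \<open>c\<close> and not into the common cut-off
    \<open>a\<close>.\<close>
  proof (rule strip_norm_bound[OF L2, where s="\<lambda>i. if i = j then sin else cos" and c="\<lambda>m. E m t * (real (m j) / real N)" and
        a="\<lambda>i y. if i = j then - 2 * deriv \<eta> (y / real N) / real N else \<eta> (y / real N)"])
    fix x assume "x \<in> strip d L"
    then have x: "- L \<le> x $ d" "x $ d \<le> 0" by (auto simp: strip_def)
    have pr: "(\<Prod>i\<in>UNIV - {d}. ((fac m)(j := r\<^sub>2 m j)) i (x $ i)) = (real (m j) / real N) * (\<Prod>i\<in>UNIV - {d}.
        (if i = j then - 2 * deriv \<eta> (x $ i / real N) / real N else \<eta> (x $ i / real N)) *
          (if i = j then sin else cos) (real (m i) * x $ i / real N))" for m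
    proof -
      have "j \<in> UNIV - {d}" using j by simp
      then show ?thesis
        by (subst (1 2) prod.remove[of _ j]) (auto simp: r\<^sub>2_def fac_eq intro!: prod.cong)
    qed
    show "R\<^sub>2 j t x = (\<Sum>m\<in>M. E m t * (real (m j) / real N) * w m (x $ d) * (\<Prod>i\<in>UNIV - {d}.
        (if i = j then - 2 * deriv \<eta> (x $ i / real N) / real N else \<eta> (x $ i / real N)) *
          (if i = j then sin else cos) (real (m i) * x $ i / real N)))"
      unfolding R\<^sub>2_def
    proof (intro sum.cong refl)
      fix m assume m: "m \<in> M"
      have "((fac m)(j := r\<^sub>2 m j)) d (x $ d) = w m (x $ d)"
        using j x m by (simp add: fac_d_equation(1))
      then show "E m t * sprod ((fac m)(j := r\<^sub>2 m j)) x = E m t * (real (m j) / real N) * w m (x $ d) * (\<Prod>i\<in>UNIV - {d}.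
        (if i = j then - 2 * deriv \<eta> (x $ i / real N) / real N else \<eta> (x $ i / real N)) *
          (if i = j then sin else cos) (real (m i) * x $ i / real N))"
        unfolding sprod_split[of _ x d] pr by simp
    qed
  next
    show "(if i = j then - 2 * deriv \<eta> (y / real N) / real N else \<eta> (y / real N)) = 0"
      if "\<bar>y\<bar> > pi * real N" for i y
      using that N2 out[of y] eta0 eta_deriv_eq_0(1) by auto
  next
    fix x :: "real ^ 'n"
    have "\<bar>- 2 * deriv \<eta> (x $ j / real N) / real N\<bar> \<le> 2 * K / real N"
      using K(1)[of "x $ j / real N"] by (simp add: abs_mult divide_right_mono)
    then show "\<bar>\<Prod>i\<in>UNIV - {d}. if i = j then - 2 * deriv \<eta> (x $ i / real N) / real N else \<eta> (x $ i / real N)\<bar> \<le> 2 * K / real N"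
      by (rule prod_one_factor_bound[OF j, of "\<lambda>y. - 2 * deriv \<eta> (y / real N) / real N"])
  next
    fix m assume m: "m \<in> M"
    have "real (m j) / real N \<le> 1" using M_D[OF m j] N by simp
    then have "E m t * (real (m j) / real N) \<le> exp (\<Lambda> * T) * 1"
      using E_bounds[OF m t] by (intro mult_mono) auto
    then show "\<bar>E m t * (real (m j) / real N)\<bar> \<le> exp (\<Lambda> * T)"
      using E_bounds[OF m t] by simp
  qed auto
  have "L2_norm (strip_measure d L) (\<rho> t) \<le> (\<Sum>j\<in>UNIV - {d}. L2_norm (strip_measure d L) (\<lambda>x. \<epsilon> * (R\<^sub>1 j t x + R\<^sub>2 j t x)))"
    unfolding \<rho>_def[abs_def] by (intro L2_norm_sum in_L2_cmult in_L2_add L1 L2) auto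
  also have "\<dots> \<le> (\<Sum>j\<in>UNIV - {d}. \<epsilon> * (3 * K / real N * Q))"
  proof (intro sum_mono)
    fix j assume "j \<in> UNIV - {d}"
    then have j: "j \<noteq> d" by simp
    have "L2_norm (strip_measure d L) (\<lambda>x. R\<^sub>1 j t x + R\<^sub>2 j t x) \<le> (K / real N) * Q + (2 * K / real N) * Q"
      using L2_norm_triangle[OF L1 L2, of j j] b1[OF j] b2[OF j] by linarith
    also have "\<dots> = 3 * K / real N * Q" by (simp add: field_simps)
    finally have "L2_norm (strip_measure d L) (\<lambda>x. R\<^sub>1 j t x + R\<^sub>2 j t x) \<le> 3 * K / real N * Q" .
    then show "L2_norm (strip_measure d L) (\<lambda>x. \<epsilon> * (R\<^sub>1 j t x + R\<^sub>2 j t x)) \<le> \<epsilon> * (3 * K / real N * Q)"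
      using eps by (simp only: L2_norm_cmult abs_of_pos) (rule mult_left_mono, auto)
  qed
  also have "\<dots> = real p * (\<epsilon> * (3 * K) * sqrt ((exp (\<Lambda> * T) * W)\<^sup>2 * L * pi ^ p)) * (real N ^ p / real N)"
    by (simp add: p_def Q_def)
  finally show "L2_norm (strip_measure d L) (\<rho> t) \<le>
      real p * (\<epsilon> * (3 * K) * sqrt ((exp (\<Lambda> * T) * W)\<^sup>2 * L * pi ^ p)) * (real N ^ p / real N)" .
qed

end

section \<open>The lower bound for the cost\<close>

text \<open>Needed for Fubini's theorem on \<open>control_measure\<close>. The indicators of the
  exhausting sets \<open>A n\<close> are product functions, so finiteness follows from their
  integrability.\<close>

lemma sigma_finite_hyperplane_measure: "sigma_finite_measure (hyperplane_measure (d :: 'n::finite) c)"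
proof
  define q where "q n i = (if i = d then (\<lambda>_. 1) else indicator {- real n..real n} :: real \<Rightarrow> real)" for n i
  define A where "A n = {x :: real ^ 'n. \<forall>i. i \<noteq> d \<longrightarrow> \<bar>x $ i\<bar> \<le> real n}" for n :: nat
  have "sprod (q n) = indicator (A n)" for n
  proof
    fix x :: "real ^ 'n"
    show "sprod (q n) x = indicator (A n) x"
    proof (cases "x \<in> A n")
      case True
      have "x $ i \<in> {- real n..real n}" if "i \<noteq> d" for i
      proof -
        have "\<bar>x $ i\<bar> \<le> real n" using True that by (simp add: A_def)
        then show ?thesis by auto
      qed
      then show ?thesis
        using True unfolding sprod_def by (auto simp: q_def intro!: prod.neutral)
    next
      case False
      then obtain i where "i \<noteq> d" "\<not> \<bar>x $ i\<bar> \<le> real n" by (auto simp: A_def)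
      then have "q n i (x $ i) = 0" by (auto simp: q_def indicator_def)
      then show ?thesis using False by (auto simp: sprod_def intro!: prod_zero)
    qed
  qed
  moreover have "integrable (hyperplane_measure d c) (sprod (q n))" for n
  proof -
    have "integrable lborel (q n i)" if "i \<noteq> d" for i
      using that by (auto simp: q_def emeasure_lborel_Icc_eq)
    moreover have "integrable (dirac c) (q n d)"
      by (intro integrable_dirac) (auto simp: q_def)
    ultimately show ?thesis
      using integrates_products_hyperplane[of d c] unfolding integrates_products_def has_bochner_integral_iff by blast
  qed
  ultimately have fin: "A n \<in> sets (hyperplane_measure d c) \<and> emeasure (hyperplane_measure d c) (A n) < \<infinity>" for n
    by (simp add: integrable_indicator_iff)
  have "x \<in> (\<Union>n. A n)" for x
  proof -
    obtain n where n: "(\<Sum>i\<in>UNIV. \<bar>x $ i\<bar>) \<le> real n" using real_arch_simple by blast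
    have "\<bar>x $ i\<bar> \<le> (\<Sum>i\<in>UNIV. \<bar>x $ i\<bar>)" for i by (intro member_le_sum) auto
    then show ?thesis using n unfolding A_def by (blast intro: order_trans)
  qed
  then have "\<Union> (range A) = UNIV" by auto
  then show "\<exists>A. countable A \<and> A \<subseteq> sets (hyperplane_measure d c) \<and> \<Union> A = space (hyperplane_measure d c) \<and>
      (\<forall>a\<in>A. emeasure (hyperplane_measure d c) a \<noteq> \<infinity>)"
    using fin by (intro exI[of _ "range A"]) (auto simp: less_top)
qed

lemma L2_norm_strip_le_norm_X:
  assumes "\<epsilon> > 0"
  shows "L2_norm (strip_measure d L) u \<le> norm_X d L \<epsilon> u"
  unfolding L2_norm_def norm_X_def inner_X_def bdry_integral_def
  using assms by (intro real_sqrt_le_mono) (auto simp: power2_eq_square intro!: add_nonneg_nonneg mult_nonneg_nonneg integral_nonneg_AE)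

text \<open>The strip norm of \<open>u t\<close> is continuous on the compact interval
  \<open>[0, T]\<close>. Nothing is known about the size of \<open>U\<close>, but it will only meet
  a factor that tends to 0.\<close>

lemma continuous_into_X_bounded:
  assumes "continuous_into_X d L T \<epsilon> u" "\<epsilon> > 0"
  obtains U where "U \<ge> 0" "\<And>t. t \<in> {0..T} \<Longrightarrow> L2_norm (strip_measure d L) (u t) \<le> U"
proof -
  define f where "f t = L2_norm (strip_measure d L) (u t)" for t
  have u: "in_L2 (strip_measure d L) (u t)" if "t \<in> {0..T}" for t
    using assms that by (auto simp: continuous_into_X_def in_X_def)
  have diff: "\<bar>f s - f t\<bar> \<le> norm_X d L \<epsilon> (\<lambda>x. u s x - u t x)" if "s \<in> {0..T}" "t \<in> {0..T}" for s t
  proof -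
    have tri: "f a \<le> f b + L2_norm (strip_measure d L) (\<lambda>x. u a x - u b x)"
      if "a \<in> {0..T}" "b \<in> {0..T}" for a b
      using L2_norm_triangle[OF u[OF that(2)] in_L2_diff[OF u[OF that(1)] u[OF that(2)]]]
      by (simp add: f_def)
    have "L2_norm (strip_measure d L) (\<lambda>x. u t x - u s x) = L2_norm (strip_measure d L) (\<lambda>x. u s x - u t x)"
      by (simp add: L2_norm_def power2_commute)
    then have "\<bar>f s - f t\<bar> \<le> L2_norm (strip_measure d L) (\<lambda>x. u s x - u t x)"
      using tri[OF that] tri[OF that(2,1)] by linarith
    then show ?thesis using L2_norm_strip_le_norm_X[OF assms(2), of d L "\<lambda>x. u s x - u t x"] by linarith
  qed
  have "continuous_on {0..T} f"
    unfolding continuous_on_def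
  proof
    fix t assume t: "t \<in> {0..T}"
    then have lim: "((\<lambda>s. norm_X d L \<epsilon> (\<lambda>x. u s x - u t x)) \<longlongrightarrow> 0) (at t within {0..T})"
      using assms by (auto simp: continuous_into_X_def)
    have "((\<lambda>s. f s - f t) \<longlongrightarrow> 0) (at t within {0..T})"
      by (rule Lim_null_comparison[OF _ lim]) (use diff t in \<open>auto simp: eventually_at_filter\<close>)
    then show "(f \<longlongrightarrow> f t) (at t within {0..T})" by (simp add: LIM_zero_iff)
  qed
  then have "compact (f ` {0..T})" by (intro compact_continuous_image) auto
  then obtain B where B: "\<And>z. z \<in> f ` {0..T} \<Longrightarrow> norm z \<le> B"
    using compact_imp_bounded bounded_iff by metis
  show ?thesis
  proof (rule that[of "\<bar>B\<bar>"])
    show "L2_norm (strip_measure d L) (u t) \<le> \<bar>B\<bar>" if "t \<in> {0..T}" for t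
      using B[of "f t"] that by (auto simp: f_def)
  qed simp
qed

text \<open>Initial data carried by \<open>\<Gamma>\<^sub>1\<close> only, where the adjoint modes are largest.\<close>

definition face_data :: "'n::finite \<Rightarrow> real \<Rightarrow> real ^ 'n \<Rightarrow> real" where
  "face_data d L = sprod (\<lambda>i. if i = d then indicator {- L} else indicator {- 1..1})"

lemma face_data_eq: "face_data d L x = (if x $ d = - L \<and> (\<forall>i. i \<noteq> d \<longrightarrow> \<bar>x $ i\<bar> \<le> 1) then 1 else 0)"
proof (cases "x $ d = - L \<and> (\<forall>i. i \<noteq> d \<longrightarrow> \<bar>x $ i\<bar> \<le> 1)")
  case True
  then show ?thesis
    by (auto simp: face_data_def sprod_def abs_le_iff indicator_def intro!: prod.neutral)
next
  case False
  have "\<exists>i. (if i = d then indicator {- L} else indicator {- 1..1}) (x $ i) = (0::real)"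
  proof (cases "x $ d = - L")
    case True
    then obtain i where "i \<noteq> d" "\<not> \<bar>x $ i\<bar> \<le> 1" using False by auto
    then show ?thesis by (intro exI[of _ i]) (auto simp: indicator_def)
  qed (auto intro!: exI[of _ d])
  then have "face_data d L x = 0"
    unfolding face_data_def sprod_def by (intro prod_zero) auto
  then show ?thesis using False by simp
qed

lemma face_data_integral:
  "has_bochner_integral (Gamma1 d L) (face_data d L) (2 ^ card (UNIV - {d}))"
proof -
  define q where "q i = (if i = d then indicator {- L} else indicator {- 1..1} :: real \<Rightarrow> real)" for i
  have 1: "integrable lborel (q i)" if "i \<noteq> d" for i
    using that by (auto simp: q_def emeasure_lborel_Icc_eq)
  have qd: "q d \<in> borel_measurable borel" by (auto simp: q_def)
  have "has_bochner_integral (Gamma1 d L) (sprod q) ((\<integral>y. q d y \<partial>dirac (- L)) * (\<Prod>i\<in>UNIV - {d}. \<integral>y. q i y \<partial>lborel))"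
    using integrates_products_hyperplane[of d "- L", unfolded integrates_products_def, rule_format, of q]
      1 integrable_dirac[OF qd] by blast
  moreover have "(\<integral>y. q d y \<partial>dirac (- L)) = 1" using integral_dirac[OF qd] by (simp add: q_def)
  moreover have "(\<Prod>i\<in>UNIV - {d}. \<integral>y. q i y \<partial>lborel) = (\<Prod>i\<in>UNIV - {d}. 2)"
    by (intro prod.cong) (auto simp: q_def)
  ultimately show ?thesis by (simp add: face_data_def q_def[abs_def])
qed

lemma face_data_power2: "(face_data d L x)\<^sup>2 = face_data d L x"
  by (simp add: face_data_eq)

lemma face_data_zero:
  assumes "L > 0"
  shows "AE x in Gamma0 d. face_data d L x = 0" "x \<in> strip d L \<Longrightarrow> face_data d L x = 0"
proof -
  show "AE x in Gamma0 d. face_data d L x = 0"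
    using AE_hyperplane_measure[of d 0] by eventually_elim (use assms in \<open>auto simp: face_data_eq\<close>)
qed (auto simp: face_data_eq strip_def)

lemma face_data_measurable: "face_data d L \<in> borel_measurable borel"
  unfolding face_data_def by (intro borel_measurable_sprod) auto

lemma face_data_in_X:
  assumes "L > 0"
  shows "in_X d L (face_data d L)"
proof -
  have "integrable (strip_measure d L) (face_data d L) \<longleftrightarrow> integrable (strip_measure d L) (\<lambda>_. 0::real)"
    by (intro Bochner_Integration.integrable_cong) (auto simp: face_data_zero(2)[OF assms])
  moreover have "integrable (Gamma0 d) (face_data d L) \<longleftrightarrow> integrable (Gamma0 d) (\<lambda>_. 0::real)"
    using face_data_measurable[of d L] face_data_zero(1)[OF assms]
    by (intro integrable_cong_AE) (auto cong: measurable_cong_sets)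
  ultimately show ?thesis
    using face_data_integral[of d L] face_data_measurable[of d L]
    by (auto simp: in_X_def in_L2_def face_data_power2 has_bochner_integral_iff strip_measure_def
        intro!: measurable_restrict_space1 cong: measurable_cong_sets)
qed

lemma face_data_inner:
  assumes "L > 0"
  shows "inner_X d L \<epsilon> (face_data d L) f = \<epsilon> * (\<integral>x. face_data d L x * f x \<partial>Gamma1 d L)"
proof -
  have "(\<integral>x. face_data d L x * f x \<partial>strip_measure d L) = (\<integral>x. 0 \<partial>strip_measure d L)"
    by (intro Bochner_Integration.integral_cong) (auto simp: face_data_zero(2)[OF assms])
  moreover have "(\<integral>x. face_data d L x * f x \<partial>Gamma0 d) = 0"
    by (rule integral_eq_zero_AE) (use face_data_zero(1)[OF assms, of d] in \<open>eventually_elim, simp\<close>)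
  ultimately show ?thesis by (simp add: inner_X_def bdry_integral_def)
qed

lemma face_data_norm:
  assumes "L > 0"
  shows "norm_X d L \<epsilon> (face_data d L) = sqrt (\<epsilon> * 2 ^ card (UNIV - {d}))"
  using face_data_integral[of d L]
  by (simp add: norm_X_def face_data_inner[OF assms] power2_eq_square[symmetric] face_data_power2 has_bochner_integral_iff)

text \<open>The integral of a non-integrable function is \<open>0\<close> by convention.\<close>

lemma abs_integral_le:
  fixes f g :: "'a \<Rightarrow> real"
  assumes "integrable M g" "AE x in M. \<bar>f x\<bar> \<le> g x"
  shows "\<bar>\<integral>x. f x \<partial>M\<bar> \<le> (\<integral>x. g x \<partial>M)"
proof (cases "integrable M f")
  case True
  have "\<bar>\<integral>x. f x \<partial>M\<bar> \<le> (\<integral>x. \<bar>f x\<bar> \<partial>M)" by (rule integral_abs_bound)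
  also have "\<dots> \<le> (\<integral>x. g x \<partial>M)" using True assms by (intro integral_mono_AE) auto
  finally show ?thesis .
next
  case False
  have "0 \<le> (\<integral>x. g x \<partial>M)"
    by (rule integral_nonneg_AE) (use assms(2) in \<open>eventually_elim, linarith\<close>)
  then show ?thesis using False by (simp add: not_integrable_integral_eq)
qed

section \<open>Testing the solution with the cut-off modes\<close>

context modes
begin

text \<open>On the support of the data the arguments \<open>m i * x $ i / N\<close> are at most 1 in
  absolute value and the cut-off is 1, so every tangential factor is at least \<open>cos 1\<close>.
  All \<open>N^p\<close> modes add up without cancellation, each with the factor
  \<open>exp (L / (2 * \<epsilon>))\<close>; the support has measure \<open>2^p\<close>.\<close>

lemma inner_face_data_ge:
  "\<epsilon> * (exp (L / (2 * \<epsilon>)) * cos 1 ^ p * real N ^ p * 2 ^ p) \<le> inner_X d L \<epsilon> (face_data d L) (\<lambda>x. \<psi> (0, x))"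
proof -
  define c where "c = exp (L / (2 * \<epsilon>)) * cos 1 ^ p * real N ^ p"
  have b2: "in_L2 (Gamma1 d L) (face_data d L)" using face_data_in_X[OF L, of d] by (simp add: in_X_def)
  have \<psi>0: "\<psi> (0, x) = Ps 0 x" for x using \<psi>_slice[of 0 x] T by (simp add: Ps_def)
  have int: "integrable (Gamma1 d L) (\<lambda>x. face_data d L x * \<psi> (0, x))"
    unfolding \<psi>0 by (intro in_L2_integrable_mult b2 in_L2_derivs)
  have "face_data d L x * c \<le> face_data d L x * \<psi> (0, x)" for x
  proof (cases "face_data d L x = 0")
    case False
    then have x: "x $ d = - L" "\<And>i. i \<noteq> d \<Longrightarrow> \<bar>x $ i\<bar> \<le> 1" by (auto simp: face_data_eq split: if_splits)
    have cos1: "0 < cos (1::real)" using cos_gt_zero[of 1] pi_gt3 by simp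
    have "exp (L / (2 * \<epsilon>)) * cos 1 ^ p \<le> sprod (fac m) x" if m: "m \<in> M" for m
    proof -
      have "cos 1 \<le> fac m i (x $ i)" if i: "i \<noteq> d" for i
      proof -
        have N1: "1 \<le> real N" using N by simp
        have "\<bar>x $ i / real N\<bar> \<le> 1" using x(2)[OF i] N1 by (simp add: field_simps)
        then have "\<eta> (x $ i / real N) = 1" by (rule eta)
        moreover have "\<bar>real (m i) * x $ i / real N\<bar> \<le> 1"
        proof -
          have "real (m i) * \<bar>x $ i\<bar> \<le> real N * 1"
            using M_D[OF m i] x(2)[OF i] by (intro mult_mono) auto
          then show ?thesis using N by (simp add: abs_mult field_simps)
        qed
        then have "cos 1 \<le> cos \<bar>real (m i) * x $ i / real N\<bar>"
          using pi_gt3 by (intro cos_monotone_0_pi_le) auto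
        then have "cos 1 \<le> cos (real (m i) * x $ i / real N)" by (simp only: cos_abs_real)
        ultimately show ?thesis using i by (simp add: fac_eq)
      qed
      then have "(\<Prod>i\<in>UNIV - {d}. cos 1) \<le> (\<Prod>i\<in>UNIV - {d}. fac m i (x $ i))"
        using cos1 by (intro prod_mono) auto
      then have "cos 1 ^ p \<le> (\<Prod>i\<in>UNIV - {d}. fac m i (x $ i))" by (simp add: p_def)
      then show ?thesis
        using x(1) L m by (simp add: sprod_split[of _ x d] fac_d_equation(1) w_boundary(2))
    qed
    then have "(\<Sum>m\<in>M. exp (L / (2 * \<epsilon>)) * cos 1 ^ p) \<le> Ps 0 x"
      unfolding Ps_def by (intro sum_mono) (simp add: E_def)
    then have "c \<le> Ps 0 x" by (simp add: card_M c_def mult_ac)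
    moreover have "0 \<le> face_data d L x" by (simp add: face_data_eq)
    ultimately show ?thesis unfolding \<psi>0 by (rule mult_left_mono)
  qed simp
  then have "(\<integral>x. face_data d L x * c \<partial>Gamma1 d L) \<le> (\<integral>x. face_data d L x * \<psi> (0, x) \<partial>Gamma1 d L)"
    using face_data_integral[of d L] int by (intro integral_mono) (auto simp: has_bochner_integral_iff)
  then have "c * 2 ^ p \<le> (\<integral>x. face_data d L x * \<psi> (0, x) \<partial>Gamma1 d L)"
    using face_data_integral[of d L] by (simp add: has_bochner_integral_iff p_def mult.commute)
  then show ?thesis using eps by (simp add: face_data_inner[OF L] c_def)
qed

text \<open>As \<open>u T\<close> vanishes, the weak formulation at time \<open>T\<close> equates
  the left-hand side, up to sign, with the time integral of the residual and control terms.
  Cauchy-Schwarz in space bounds the first; the second also takes Cauchy-Schwarz in time.\<close>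

lemma duality_estimate:
  assumes v: "in_L2 (control_measure d T) v"
    and u: "is_solution d L T \<epsilon> u0 v u" "eq_X d L (u T) (\<lambda>_. 0)"
    and U: "\<And>t. t \<in> {0..T} \<Longrightarrow> L2_norm (strip_measure d L) (u t) \<le> U" "U \<ge> 0"
    and P: "\<And>t. t \<in> {0..T} \<Longrightarrow> L2_norm (strip_measure d L) (\<rho> t) \<le> P"
      "\<And>t. t \<in> {0..T} \<Longrightarrow> in_L2 (strip_measure d L) (\<rho> t)"
  shows "\<bar>inner_X d L \<epsilon> u0 (\<lambda>x. \<psi> (0, x))\<bar> \<le>
     T * (U * P) + exp (\<Lambda> * T) * sqrt (pi ^ p) * real N ^ p * (sqrt T * L2_norm (control_measure d T) v)"
proof -
  define B where "B = exp (\<Lambda> * T) * sqrt (pi ^ p) * real N ^ p"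
  define M1 where "M1 = restrict_space lborel {0<..<T}"
  define V where "V t = (\<integral>x. (v (t, x))\<^sup>2 \<partial>Gamma0 d)" for t
  have B0: "B \<ge> 0" by (simp add: B_def)
  have V0: "V t \<ge> 0" for t by (simp add: V_def)
  have sfT: "{0<..<T} \<inter> space lborel \<in> sets lborel" by simp
  have pw: "pair_sigma_finite M1 (Gamma0 d)"
    unfolding M1_def
    by (intro pair_sigma_finite.intro sigma_finite_measure_restrict_space sigma_finite_hyperplane_measure
        sigma_finite_lborel) auto
  have vm: "v \<in> borel_measurable (M1 \<Otimes>\<^sub>M Gamma0 d)" and vi: "integrable (M1 \<Otimes>\<^sub>M Gamma0 d) (\<lambda>z. (v z)\<^sup>2)"
    using v by (auto simp: in_L2_def control_measure_def M1_def)
  have vAE: "AE t in M1. integrable (Gamma0 d) (\<lambda>x. (v (t, x))\<^sup>2)"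
    using pair_sigma_finite.AE_integrable_fst'[OF pw vi] by simp
  have Vi: "integrable M1 V"
    unfolding V_def using pair_sigma_finite.integrable_fst'[OF pw vi] .
  have Vint: "(\<integral>t. V t \<partial>M1) = (L2_norm (control_measure d T) v)\<^sup>2"
    unfolding V_def L2_norm_power2 using pair_sigma_finite.integral_fst'[OF pw vi]
    by (simp add: control_measure_def M1_def)
  have uX: "in_X d L (u t)" if "t \<in> {0..T}" for t
    using u(1) that by (auto simp: is_solution_def continuous_into_X_def)
  \<comment> \<open>The weight \<open>s\<close> replaces the square root of \<open>V t\<close> by a
    bound linear in \<open>V t\<close>, which is integrable in time.\<close>
  have weak: "\<bar>weak_integrand d L \<epsilon> v \<psi> (u t) t\<bar> \<le> U * P + B * (s * V t + 1 / s) / 2"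
    if t: "0 < t" "t < T" and vt: "integrable (Gamma0 d) (\<lambda>x. (v (t, x))\<^sup>2)" and s: "s > 0" for t s
  proof -
    have t': "t \<in> {0..T}" "0 \<le> t" "t \<le> T" using t by auto
    have "(\<lambda>x. v (t, x)) \<in> borel_measurable (Gamma0 d)"
      using vm t by (intro measurable_Pair2[OF vm]) (auto simp: M1_def space_restrict_space)
    with vt have vL: "in_L2 (Gamma0 d) (\<lambda>x. v (t, x))" by (simp add: in_L2_def)
    have "\<bar>\<integral>x. u t x * \<rho> t x \<partial>strip_measure d L\<bar> \<le> L2_norm (strip_measure d L) (u t) * L2_norm (strip_measure d L) (\<rho> t)"
      using uX[OF t'(1)] P(2)[OF t'(1)] by (intro L2_Cauchy_Schwarz) (auto simp: in_X_def)
    also have "\<dots> \<le> U * P"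
      using U P t' by (intro mult_mono) (auto simp: L2_norm_nonneg)
    finally have 1: "\<bar>\<integral>x. u t x * \<rho> t x \<partial>strip_measure d L\<bar> \<le> U * P" .
    have "\<bar>\<integral>x. v (t, x) * \<psi> (t, x) \<partial>Gamma0 d\<bar> \<le> L2_norm (Gamma0 d) (\<lambda>x. v (t, x)) * L2_norm (Gamma0 d) (\<lambda>x. \<psi> (t, x))"
      using t' by (intro L2_Cauchy_Schwarz vL boundary_norm_bound)
    also have "\<dots> \<le> sqrt (V t) * B"
      using boundary_norm_bound(2)[OF t'(2,3)] by (intro mult_mono) (auto simp: L2_norm_def V_def B_def)
    also have "\<dots> \<le> ((s * V t + 1 / s) / 2) * B"
    proof (rule mult_right_mono[OF _ B0])
      have "2 * (s * sqrt (V t)) * 1 \<le> (s * sqrt (V t))\<^sup>2 + 1\<^sup>2" by (rule sum_squares_bound)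
      also have "(s * sqrt (V t))\<^sup>2 = s * (s * V t)" using V0 by (simp add: power_mult_distrib power2_eq_square)
      finally show "sqrt (V t) \<le> (s * V t + 1 / s) / 2" using s by (simp add: field_simps)
    qed
    finally have 2: "\<bar>\<integral>x. v (t, x) * \<psi> (t, x) \<partial>Gamma0 d\<bar> \<le> B * (s * V t + 1 / s) / 2"
      by (simp add: mult.commute)
    show ?thesis
      unfolding weak_integrand_eq[OF t'(2,3) uX[OF t'(1)]]
      by (rule order_trans[OF abs_triangle_ineq add_mono[OF 1 2]])
  qed
  define Z where "Z = (LINT t:{0..T}|lborel. weak_integrand d L \<epsilon> v \<psi> (u t) t)"
  have Zle: "\<bar>Z\<bar> \<le> T * (U * P) + B * (s * (L2_norm (control_measure d T) v)\<^sup>2 + T / s) / 2" if s: "s > 0" for s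
  proof -
    define g where "g t = U * P + B * (s * V t + 1 / s) / 2" for t
    have c: "integrable M1 (\<lambda>_. c)" "(\<integral>t. c \<partial>M1) = T * c" for c :: real
      unfolding M1_def integrable_restrict_space[OF sfT] integral_restrict_space[OF sfT] using T by auto
    have gi: "integrable M1 g" unfolding g_def using Vi c by simp
    have gint: "(\<integral>t. g t \<partial>M1) = T * (U * P) + B * (s * (L2_norm (control_measure d T) v)\<^sup>2 + T / s) / 2"
    proof -
      have "g = (\<lambda>t. (U * P + B * (1 / s) / 2) + B * s / 2 * V t)" by (auto simp: g_def fun_eq_iff field_simps)
      then have "(\<integral>t. g t \<partial>M1) = T * (U * P + B * (1 / s) / 2) + B * s / 2 * (\<integral>t. V t \<partial>M1)"
        using Vi c by simp
      then show ?thesis unfolding Vint by (simp add: field_simps)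
    qed
    have "AE t in lborel. t \<in> {0<..<T} \<longrightarrow> integrable (Gamma0 d) (\<lambda>x. (v (t, x))\<^sup>2)"
      using vAE unfolding M1_def AE_restrict_space_iff[OF sfT] .
    \<comment> \<open>The weak formulation integrates over the closed interval, the control lives on
      the open one; the end points form a null set.\<close>
    then have AE: "AE t in lborel. \<bar>indicator {0..T} t *\<^sub>R weak_integrand d L \<epsilon> v \<psi> (u t) t\<bar> \<le> indicator {0<..<T} t *\<^sub>R g t"
      using AE_lborel_singleton[of 0] AE_lborel_singleton[of T]
      by eventually_elim (use weak s in \<open>auto simp: indicator_def g_def\<close>)
    have "integrable lborel (\<lambda>t. indicator {0<..<T} t *\<^sub>R g t)"
      using gi unfolding M1_def integrable_restrict_space[OF sfT] .
    from abs_integral_le[OF this AE] have "\<bar>Z\<bar> \<le> (\<integral>t. g t \<partial>M1)"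
      unfolding Z_def set_lebesgue_integral_def M1_def integral_restrict_space[OF sfT] .
    then show ?thesis unfolding gint .
  qed
  \<comment> \<open>Optimising over \<open>s\<close> amounts to Cauchy-Schwarz in time.\<close>
  have "\<bar>Z\<bar> - T * (U * P) \<le> sqrt (B * (L2_norm (control_measure d T) v)\<^sup>2) * sqrt (B * T)"
  proof (rule mult_sqrt_le)
    fix s :: real assume "s > 0"
    have "(s * (B * (L2_norm (control_measure d T) v)\<^sup>2) + B * T / s) / 2 =
        B * (s * (L2_norm (control_measure d T) v)\<^sup>2 + T / s) / 2"
      by (simp add: algebra_simps)
    with Zle[OF \<open>s > 0\<close>] show "\<bar>Z\<bar> - T * (U * P) \<le> (s * (B * (L2_norm (control_measure d T) v)\<^sup>2) + B * T / s) / 2"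
      by linarith
  qed (use B0 T in auto)
  also have "\<dots> = B * (sqrt T * L2_norm (control_measure d T) v)"
    using B0 L2_norm_nonneg[of "control_measure d T" v] by (simp add: real_sqrt_mult)
  finally have Z: "\<bar>Z\<bar> \<le> T * (U * P) + B * (sqrt T * L2_norm (control_measure d T) v)" by simp
  have "inner_X d L \<epsilon> (u T) (\<lambda>x. \<psi> (T, x)) - inner_X d L \<epsilon> u0 (\<lambda>x. \<psi> (0, x)) = Z"
    unfolding Z_def using u(1) test_function_\<psi> T by (auto simp: is_solution_def)
  moreover have "inner_X d L \<epsilon> (u T) (\<lambda>x. \<psi> (T, x)) = 0"
  proof -
    have AEs: "AE x in strip_measure d L. u T x = 0" "AE x in Gamma0 d. u T x = 0" "AE x in Gamma1 d L. u T x = 0"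
      using u(2) by (auto simp: eq_X_def)
    have "(\<integral>x. u T x * \<psi> (T, x) \<partial>\<mu>) = 0" if "AE x in \<mu>. u T x = 0" for \<mu>
      by (rule integral_eq_zero_AE) (use that in \<open>eventually_elim, simp\<close>)
    then show ?thesis using AEs by (simp add: inner_X_def bdry_integral_def)
  qed
  ultimately show ?thesis using Z by (simp add: B_def)
qed

end

text \<open>Here \<open>F\<close> stands for \<open>1/4 - \<epsilon>^2 |\<xi>|^2\<close>. The
  intermediate value theorem on \<open>[0, k1]\<close> gives a root \<open>k\<close>. As
  \<open>k1\<close> does not depend on \<open>F\<close> and the cosine decreases,
  \<open>cos (k1 * L / 2)\<close> is a lower bound for all \<open>F\<close> at once.\<close>

lemma mode_parameters_exist:
  fixes L \<epsilon> :: real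
  assumes "L > 0" "\<epsilon> > 0"
  obtains c\<^sub>0 where "c\<^sub>0 > 0"
    "\<And>F. 0 \<le> F \<Longrightarrow> F \<le> 1 / 4 \<Longrightarrow> \<exists>k. 0 \<le> k \<and> k \<le> pi / L \<and> c\<^sub>0 \<le> cos (k * L / 2) \<and>
        \<epsilon> * k * sin (k * L / 2) = (F - \<epsilon>\<^sup>2 * k\<^sup>2) * cos (k * L / 2)"
proof -
  \<comment> \<open>\<open>Y\<close> is the tangent of \<open>k1 * L / 2\<close>. From
    \<open>Y \<ge> 1\<close> follows \<open>k1 \<ge> pi / (2 * L)\<close>, and then
    \<open>Y \<ge> L / (2 * pi * \<epsilon>)\<close> gives
    \<open>\<epsilon> * k1 * Y \<ge> 1 / 4\<close>, hence \<open>H k1 \<ge> 0\<close>.\<close>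
  define Y where "Y = max 1 (L / (2 * pi * \<epsilon>))"
  define k1 where "k1 = 2 * arctan Y / L"
  have Y: "Y \<ge> 1" "L / (2 * pi * \<epsilon>) \<le> Y" by (auto simp: Y_def)
  have at: "pi / 4 \<le> arctan Y" "arctan Y < pi / 2"
    using Y arctan_monotone'[of 1 Y] arctan_ubound by (auto simp: arctan_one)
  have half: "k1 * L / 2 = arctan Y" using assms by (simp add: k1_def)
  have k1: "pi / (2 * L) \<le> k1" "k1 \<le> pi / L" "0 \<le> k1"
    using at assms pi_gt_zero Y by (auto simp: k1_def field_simps)
  have c1: "cos (k1 * L / 2) > 0" unfolding half using at pi_gt_zero by (intro cos_gt_zero_pi) auto
  show ?thesis
  proof (rule that[OF c1])
    fix F :: real assume F: "0 \<le> F" "F \<le> 1 / 4"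
    define H where "H k = \<epsilon> * k * sin (k * L / 2) - (F - \<epsilon>\<^sup>2 * k\<^sup>2) * cos (k * L / 2)" for k
    have "1 / 4 = \<epsilon> * (pi / (2 * L)) * (L / (2 * pi * \<epsilon>))" using assms by (simp add: field_simps)
    also have "\<dots> \<le> \<epsilon> * k1 * Y" using k1 Y assms by (intro mult_mono mult_nonneg_nonneg) auto
    finally have "1 / 4 \<le> \<epsilon> * k1 * Y" .
    moreover have "0 \<le> \<epsilon>\<^sup>2 * k1\<^sup>2" by simp
    ultimately have "0 \<le> \<epsilon> * k1 * Y - F + \<epsilon>\<^sup>2 * k1\<^sup>2" using F by linarith
    moreover have "sin (k1 * L / 2) = Y * cos (k1 * L / 2)"
      using tan_arctan[of Y] c1 unfolding half by (simp add: tan_def field_simps)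
    then have "H k1 = (\<epsilon> * k1 * Y - F + \<epsilon>\<^sup>2 * k1\<^sup>2) * cos (k1 * L / 2)"
      unfolding H_def by (simp only:) (simp add: algebra_simps)
    ultimately have "0 \<le> H k1" using c1 by simp
    moreover have "H 0 \<le> 0" using F by (simp add: H_def)
    moreover have "continuous_on {0..k1} H" unfolding H_def by (intro continuous_intros) auto
    ultimately obtain k where k: "0 \<le> k" "k \<le> k1" "H k = 0"
      using IVT'[of H 0 0 k1] k1 by auto
    have "cos (k1 * L / 2) \<le> cos (k * L / 2)"
    proof (rule cos_monotone_0_pi_le)
      show "k1 * L / 2 \<le> pi" unfolding half using at pi_gt_zero by linarith
    qed (use k assms in auto)
    then show "\<exists>k. 0 \<le> k \<and> k \<le> pi / L \<and> cos (k1 * L / 2) \<le> cos (k * L / 2) \<and>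
        \<epsilon> * k * sin (k * L / 2) = (F - \<epsilon>\<^sup>2 * k\<^sup>2) * cos (k * L / 2)"
      using k k1 by (intro exI[of _ k]) (auto simp: H_def)
  qed
qed

lemma cont_cs_bounded:
  assumes "cont_cs q"
  shows "\<exists>K. \<forall>y. \<bar>q y\<bar> \<le> K"
proof -
  obtain R where R: "\<And>y. \<bar>y\<bar> > R \<Longrightarrow> q y = 0" using assms by (auto simp: cont_cs_def)
  have "continuous_on {- R..R} q" using assms continuous_on_subset by (auto simp: cont_cs_def)
  then have "compact (q ` {- R..R})" by (intro compact_continuous_image) auto
  then obtain B where B: "\<And>z. z \<in> q ` {- R..R} \<Longrightarrow> norm z \<le> B"
    using compact_imp_bounded bounded_iff by metis
  have "\<bar>q y\<bar> \<le> \<bar>B\<bar>" for y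
  proof (cases "\<bar>y\<bar> > R")
    case False
    then have "y \<in> {- R..R}" by auto
    then have "q y \<in> q ` {- R..R}" by (rule imageI)
    then show ?thesis using B by fastforce
  qed (simp add: R)
  then show ?thesis by blast
qed

text \<open>The control \<open>v\<close> and the solution \<open>u\<close> are fixed first and then
  tested with modes at every scale \<open>N\<close>. After division by \<open>N^p\<close> the
  residual is of order \<open>1 / N\<close> and disappears in the limit. The bound on
  \<open>\<epsilon>\<^sup>2 * real n'\<close> makes the equation for \<open>k\<close> solvable at
  all frequencies used.\<close>

lemma null_control_constant_lower_bound:
  fixes d :: "'n::finite"
  defines "n' \<equiv> card (UNIV - {d})"
  assumes L: "L > 0" and T: "T > 0" and eps: "\<epsilon> > 0" "\<epsilon>\<^sup>2 * real n' \<le> 1 / 4"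
    and C: "null_control_constant d L T \<epsilon> C"
  shows "\<epsilon> * (exp (L / (2 * \<epsilon>)) * cos 1 ^ n' * 2 ^ n') \<le>
     exp ((1 / (4 * \<epsilon>) + \<epsilon> * (pi / L)\<^sup>2 + \<epsilon> * real n') * T) * sqrt (pi ^ n') * (sqrt T * (C * sqrt (\<epsilon> * 2 ^ n')))"
proof -
  define H where "H = 1 / (4 * \<epsilon>) + \<epsilon> * (pi / L)\<^sup>2 + \<epsilon> * real n'"
  obtain v u where v: "in_L2 (control_measure d T) v"
    and u: "is_solution d L T \<epsilon> (face_data d L) v u" "eq_X d L (u T) (\<lambda>_. 0)"
    and vn: "L2_norm (control_measure d T) v \<le> C * sqrt (\<epsilon> * 2 ^ n')"
    using C face_data_in_X[OF L, of d] face_data_norm[OF L, of d \<epsilon>]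
    unfolding null_control_constant_def steers_to_zero_def n'_def by metis
  have "continuous_into_X d L T \<epsilon> u" using u(1) by (simp add: is_solution_def)
  then obtain U where U: "U \<ge> 0" "\<And>t. t \<in> {0..T} \<Longrightarrow> L2_norm (strip_measure d L) (u t) \<le> U"
    using continuous_into_X_bounded eps(1) by blast
  obtain \<eta> :: "real \<Rightarrow> real" where eta: "smooth \<eta>" "\<And>x. 0 \<le> \<eta> x" "\<And>x. \<eta> x \<le> 1"
    "\<And>x. \<bar>x\<bar> \<le> 1 \<Longrightarrow> \<eta> x = 1" "\<And>x. 2 \<le> \<bar>x\<bar> \<Longrightarrow> \<eta> x = 0"
    using plateau_exists by blast
  have "cont_cs \<eta>" unfolding cont_cs_def using smooth_continuous[OF eta(1)] eta(5) by (auto intro!: exI[of _ 2])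
  then have "cont_cs (deriv \<eta>)" "cont_cs (deriv (deriv \<eta>))" by (intro cont_cs_deriv smooth_deriv eta(1); assumption)+
  then obtain K1 K2 where K12: "\<And>y. \<bar>deriv \<eta> y\<bar> \<le> K1" "\<And>y. \<bar>deriv (deriv \<eta>) y\<bar> \<le> K2"
    using cont_cs_bounded by metis
  define K where "K = max K1 K2"
  have K: "\<And>y. \<bar>deriv \<eta> y\<bar> \<le> K" "\<And>y. \<bar>deriv (deriv \<eta>) y\<bar> \<le> K"
    using K12 by (auto simp: K_def intro: order_trans[OF _ max.cobounded1] order_trans[OF _ max.cobounded2])
  obtain c\<^sub>0 where c0: "c\<^sub>0 > 0"
    and kex: "\<And>F. 0 \<le> F \<Longrightarrow> F \<le> 1 / 4 \<Longrightarrow> \<exists>k. 0 \<le> k \<and> k \<le> pi / L \<and> c\<^sub>0 \<le> cos (k * L / 2) \<and>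
        \<epsilon> * k * sin (k * L / 2) = (F - \<epsilon>\<^sup>2 * k\<^sup>2) * cos (k * L / 2)"
    using mode_parameters_exist[OF L eps(1)] by blast
  \<comment> \<open>The bound for the residual without its powers of \<open>N\<close>;
    \<open>H\<close>, \<open>K\<close> and \<open>c\<^sub>0\<close> are chosen before
    \<open>N\<close>.\<close>
  define Q where "Q = real n' * (\<epsilon> * (3 * K) * sqrt ((exp (H * T) * (exp (L / (2 * \<epsilon>)) / c\<^sub>0))\<^sup>2 * L * pi ^ n'))"
  define A where "A = \<epsilon> * (exp (L / (2 * \<epsilon>)) * cos 1 ^ n' * 2 ^ n')"
  define R where "R = exp (H * T) * sqrt (pi ^ n') * (sqrt T * (C * sqrt (\<epsilon> * 2 ^ n')))"
  have bound: "A \<le> T * (U * Q) / real N + R" if N: "N > 0" for N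
  proof -
    have "\<exists>k. \<forall>m\<in>(\<Pi>\<^sub>E i\<in>UNIV - {d}. {1..N}). 0 \<le> k m \<and> k m \<le> pi / L \<and> c\<^sub>0 \<le> cos (k m * L / 2) \<and>
      \<epsilon> * k m * sin (k m * L / 2) =
        (1 / 4 - \<epsilon>\<^sup>2 * (\<Sum>i\<in>UNIV - {d}. (real (m i) / real N)\<^sup>2) - \<epsilon>\<^sup>2 * (k m)\<^sup>2) * cos (k m * L / 2)"
    proof (rule bchoice, rule ballI)
      fix m assume m: "m \<in> (\<Pi>\<^sub>E i\<in>UNIV - {d}. {1..N})"
      have "(\<Sum>i\<in>UNIV - {d}. (real (m i) / real N)\<^sup>2) \<le> (\<Sum>i\<in>UNIV - {d}. 1)"
        using m N by (intro sum_mono power_le_one) (auto simp: PiE_def Pi_def)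
      then have "\<epsilon>\<^sup>2 * (\<Sum>i\<in>UNIV - {d}. (real (m i) / real N)\<^sup>2) \<le> \<epsilon>\<^sup>2 * real n'"
        unfolding n'_def by (intro mult_left_mono) auto
      moreover have "0 \<le> \<epsilon>\<^sup>2 * (\<Sum>i\<in>UNIV - {d}. (real (m i) / real N)\<^sup>2)"
        by (intro mult_nonneg_nonneg sum_nonneg) auto
      ultimately show "\<exists>k. 0 \<le> k \<and> k \<le> pi / L \<and> c\<^sub>0 \<le> cos (k * L / 2) \<and> \<epsilon> * k * sin (k * L / 2) =
        (1 / 4 - \<epsilon>\<^sup>2 * (\<Sum>i\<in>UNIV - {d}. (real (m i) / real N)\<^sup>2) - \<epsilon>\<^sup>2 * k\<^sup>2) * cos (k * L / 2)"
        using eps(2) by (intro kex) linarith+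
    qed
    then obtain k where k: "\<And>m. m \<in> (\<Pi>\<^sub>E i\<in>UNIV - {d}. {1..N}) \<Longrightarrow> 0 \<le> k m \<and> k m \<le> pi / L \<and> c\<^sub>0 \<le> cos (k m * L / 2) \<and>
      \<epsilon> * k m * sin (k m * L / 2) =
        (1 / 4 - \<epsilon>\<^sup>2 * (\<Sum>i\<in>UNIV - {d}. (real (m i) / real N)\<^sup>2) - \<epsilon>\<^sup>2 * (k m)\<^sup>2) * cos (k m * L / 2)"
      by blast
    interpret modes d L T \<epsilon> c\<^sub>0 N \<eta> k
      by (unfold_locales; (fact L T eps(1) N eta c0)?) (rule k)
    have n': "p = n'" by (simp add: p_def n'_def)
    have \<Lambda>: "\<Lambda> = H" by (simp add: \<Lambda>_def H_def n')
    have P: "L2_norm (strip_measure d L) (\<rho> t) \<le> Q * (real N ^ n' / real N)" "in_L2 (strip_measure d L) (\<rho> t)"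
      if "t \<in> {0..T}" for t
      using residual_norm_bound[of t K] that K unfolding Q_def W_def n' \<Lambda> by auto
    have "A * real N ^ n' \<le> \<bar>inner_X d L \<epsilon> (face_data d L) (\<lambda>x. \<psi> (0, x))\<bar>"
      using inner_face_data_ge by (simp add: A_def n' mult_ac)
    also have "\<dots> \<le> T * (U * (Q * (real N ^ n' / real N)))
       + exp (H * T) * sqrt (pi ^ n') * real N ^ n' * (sqrt T * L2_norm (control_measure d T) v)"
      using duality_estimate[OF v u U(2) U(1) P] unfolding n' \<Lambda> by simp
    also have "\<dots> \<le> T * (U * (Q * (real N ^ n' / real N)))
       + exp (H * T) * sqrt (pi ^ n') * real N ^ n' * (sqrt T * (C * sqrt (\<epsilon> * 2 ^ n')))"
      using vn T by (intro add_left_mono mult_left_mono) auto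
    also have "\<dots> = (T * (U * Q) / real N + R) * real N ^ n'"
      by (simp add: R_def algebra_simps)
    finally show ?thesis using N by simp
  qed
  have "(\<lambda>N. T * (U * Q) / real N + R) \<longlonglongrightarrow> 0 + R"
    by (intro tendsto_intros lim_const_over_n)
  then have "A \<le> 0 + R"
    by (rule LIMSEQ_le_const) (use bound in \<open>auto intro!: exI[of _ 1]\<close>)
  then show ?thesis by (simp add: A_def R_def H_def)
qed

theorem theorem2:
  fixes d :: "'n::finite" and L :: real
  assumes "L > 0"
  shows "\<forall>T. 0 < T \<and> T < L \<longrightarrow>
           (\<exists>\<epsilon>0>0. \<exists>C>0. \<exists>k>0. \<forall>\<epsilon>. 0 < \<epsilon> \<and> \<epsilon> < \<epsilon>0 \<longrightarrow>
              ereal (C * exp (k / \<epsilon>)) \<le> null_control_cost d L T \<epsilon>)"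
proof (intro allI impI)
  fix T :: real assume T: "0 < T \<and> T < L"
  define p where "p = card (UNIV - {d})"
  \<comment> \<open>For \<open>\<epsilon> \<le> 1\<close> this bounds the part of the exponent that
    does not blow up as \<open>\<epsilon>\<close> tends to 0.\<close>
  define Q where "Q = (pi / L)\<^sup>2 + real p"
  define D where "D = exp (Q * T) * sqrt (pi ^ p) * sqrt T * sqrt (2 ^ p)"
  define G where "G = cos (1::real) ^ p * 2 ^ p"
  have D: "D > 0" using T by (simp add: D_def)
  have "cos (1::real) > 0" using cos_gt_zero[of 1] pi_gt3 by simp
  then have G: "G > 0" by (simp add: G_def)
  have Q0: "Q \<ge> 0" by (simp add: Q_def)
  \<comment> \<open>The factor \<open>exp (L / (2 * \<epsilon>))\<close> is shared out:
    \<open>exp (L / (4 * \<epsilon>))\<close> outweighs \<open>exp (T / (4 * \<epsilon>))\<close>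
    because \<open>T < L\<close>, one factor \<open>exp (L / (8 * \<epsilon>))\<close> absorbs the
    prefactor \<open>\<epsilon>\<close>, and the other one is the rate obtained.\<close>
  have main: "G * (L / 8) / D * exp ((L / 8) / \<epsilon>) \<le> C"
    if e: "0 < \<epsilon>" "\<epsilon> < 1 / (2 * (real p + 1))" and C: "null_control_constant d L T \<epsilon> C" for \<epsilon> C
  proof -
    have C0: "C \<ge> 0" using C by (simp add: null_control_constant_def)
    \<comment> \<open>Both \<open>\<epsilon>\<close> and \<open>\<epsilon> * p\<close> are at most
      \<open>1/2\<close>, whence \<open>\<epsilon>\<^sup>2 * p \<le> 1/4\<close>.\<close>
    have "\<epsilon> * (2 * (real p + 1)) < 1" using e by (simp add: field_simps)
    then have ep: "\<epsilon> + \<epsilon> * real p < 1 / 2" by (simp add: algebra_simps)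
    have ep0: "0 \<le> \<epsilon> * real p" using e by simp
    have e1: "\<epsilon> \<le> 1 / 2" using ep ep0 by linarith
    have "\<epsilon> * (\<epsilon> * real p) \<le> 1 / 2 * (1 / 2)" using ep ep0 e e1 by (intro mult_mono) auto
    then have e2: "\<epsilon>\<^sup>2 * real p \<le> 1 / 4" by (simp add: power2_eq_square mult.assoc)
    have "\<epsilon> * (Q * T) \<le> 1 * (Q * T)" using Q0 T e1 by (intro mult_right_mono) auto
    then have "(1 / (4 * \<epsilon>) + \<epsilon> * (pi / L)\<^sup>2 + \<epsilon> * real p) * T \<le> T / (4 * \<epsilon>) + Q * T"
      by (simp add: Q_def algebra_simps)
    also have "\<dots> \<le> L / (4 * \<epsilon>) + Q * T" using T e by (simp add: divide_right_mono)
    finally have x: "exp ((1 / (4 * \<epsilon>) + \<epsilon> * (pi / L)\<^sup>2 + \<epsilon> * real p) * T) \<le> exp (L / (4 * \<epsilon>)) * exp (Q * T)"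
      by (simp add: exp_add[symmetric])
    have s: "sqrt (\<epsilon> * 2 ^ p) \<le> sqrt (2 ^ p)" using e1 e by (intro real_sqrt_le_mono) (simp add: mult_le_cancel_right1)
    have "L / (8 * \<epsilon>) \<le> exp (L / (8 * \<epsilon>))" using exp_ge_add_one_self[of "L / (8 * \<epsilon>)"] by linarith
    then have y: "L / 8 \<le> \<epsilon> * exp (L / (8 * \<epsilon>))" using e by (simp add: field_simps)
    have z: "exp (L / (2 * \<epsilon>)) = exp (L / (4 * \<epsilon>)) * (exp (L / (8 * \<epsilon>)) * exp (L / (8 * \<epsilon>)))"
      using e by (simp add: exp_add[symmetric] field_simps)
    have "G * (L / 8) * exp (L / (8 * \<epsilon>)) * exp (L / (4 * \<epsilon>)) \<le>
        G * (\<epsilon> * exp (L / (8 * \<epsilon>))) * exp (L / (8 * \<epsilon>)) * exp (L / (4 * \<epsilon>))"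
      using y G by (intro mult_right_mono mult_left_mono) auto
    also have "\<dots> = \<epsilon> * (exp (L / (2 * \<epsilon>)) * cos 1 ^ p * 2 ^ p)"
      unfolding z by (simp add: G_def mult_ac)
    also have "\<dots> \<le> exp ((1 / (4 * \<epsilon>) + \<epsilon> * (pi / L)\<^sup>2 + \<epsilon> * real p) * T) * sqrt (pi ^ p) * (sqrt T * (C * sqrt (\<epsilon> * 2 ^ p)))"
      using null_control_constant_lower_bound[OF assms _ e(1) _ C] T e2 by (simp add: p_def)
    also have "\<dots> \<le> exp (L / (4 * \<epsilon>)) * exp (Q * T) * sqrt (pi ^ p) * (sqrt T * (C * sqrt (2 ^ p)))"
      using x s C0 T e by (intro mult_mono) auto
    also have "\<dots> = C * D * exp (L / (4 * \<epsilon>))" by (simp add: D_def mult_ac)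
    finally have "G * (L / 8) * exp (L / (8 * \<epsilon>)) \<le> C * D" by simp
    then show ?thesis using D by (simp add: field_simps)
  qed
  show "\<exists>\<epsilon>0>0. \<exists>C>0. \<exists>k>0. \<forall>\<epsilon>. 0 < \<epsilon> \<and> \<epsilon> < \<epsilon>0 \<longrightarrow> ereal (C * exp (k / \<epsilon>)) \<le> null_control_cost d L T \<epsilon>"
  proof (rule exI[of _ "1 / (2 * (real p + 1))"], intro conjI, simp,
      rule exI[of _ "G * (L / 8) / D"], intro conjI, simp add: G D assms,
      rule exI[of _ "L / 8"], intro conjI allI impI, simp add: assms)
    show "ereal (G * (L / 8) / D * exp (L / 8 / \<epsilon>)) \<le> null_control_cost d L T \<epsilon>"
      if "0 < \<epsilon> \<and> \<epsilon> < 1 / (2 * (real p + 1))" for \<epsilon>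
      \<comment> \<open>A lower bound for all admissible constants bounds the infimum, also if there
        are none and the cost is infinite.\<close>
      unfolding null_control_cost_def using main that by (intro Inf_greatest) auto
  qed
qed

end
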